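(* Let $F\in C^2(\mathbb{R})$ satisfy $0=F(0)=\min_{\mathbb{R}}F$ and \[ 6\limsup_{t\to-\infty}\frac{F(t)}{t^2}<F''(0). \] Then for almost every (with respect to Lebesgue measure) $q>0$ such that \[ 24\limsup_{t\to-\infty}\frac{F(t)}{t^2}<q^2<4F''(0), \] there exists a nontrivial periodic solution $u:\mathbb{R}\to\mathbb{R}$ to \[ u''''+qu''+F'(u)=0 . \]
   Context: A solution is a $C^4$ function $u:\mathbb{R}\to\mathbb{R}$ satisfying the equation at every point of $\mathbb{R}$. A solution is called nontrivial if it is non-constant. *)

theory Defs
  imports "HOL-Analysis.Analysis" "HOL-Library.Periodic_Fun"
begin

definition C_class :: "nat \<Rightarrow> (real \<Rightarrow> real) \<Rightarrow> bool" where
  "C_class k f \<longleftrightarrow>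
     (\<forall>j<k. (deriv ^^ j) f differentiable_on UNIV) \<and> continuous_on UNIV ((deriv ^^ k) f)"

definition is_solution :: "real \<Rightarrow> (real \<Rightarrow> real) \<Rightarrow> (real \<Rightarrow> real) \<Rightarrow> bool" where
  "is_solution q F u \<longleftrightarrow>
     C_class 4 u \<and> (\<forall>x. (deriv ^^ 4) u x + q * (deriv ^^ 2) u x + deriv F (u x) = 0)"

definition nontrivial :: "(real \<Rightarrow> real) \<Rightarrow> bool" where
  "nontrivial u \<longleftrightarrow> \<not> u constant_on UNIV"

text \<open>A period is required to be positive: \<^term>\<open>periodic_fun_simple u T\<close> alone
  holds for every \<^term>\<open>u\<close> when \<^term>\<open>T = 0\<close>.\<close>

definition periodic :: "(real \<Rightarrow> real) \<Rightarrow> bool" where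
  "periodic u \<longleftrightarrow> (\<exists>T>0. periodic_fun_simple u T)"

text \<open>The limit superior is taken in the extended reals, since the quotient
  need not be bounded as \<open>t\<close> tends to \<open>-\<infinity>\<close>.\<close>

definition quad_limsup :: "(real \<Rightarrow> real) \<Rightarrow> ereal" where
  "quad_limsup F = Limsup at_bot (\<lambda>t. ereal (F t / t\<^sup>2))"

end

theory Submission
  imports Defs "HOL-Complex_Analysis.Great_Picard"
begin

text \<open>
  Write \<open>f = F'\<close>. There are two cases.

  If \<open>f\<close> changes sign from positive to negative somewhere, there are small periodic solutions near such a
  point \<open>m\<close>, for every \<open>q > 0\<close>: \<open>f' \<le> 0\<close> at \<open>m\<close>, and one shoots with \<open>u(0) = \<alpha>\<close>, \<open>u'(0) = u'''(0) = 0\<close>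
  and \<open>u''(0) = - s\<close> small, up to the first positive zero of \<open>u'\<close>. There \<open>u'''\<close> is minus the integral of
  \<open>f(u)\<close>, which has opposite signs for \<open>\<alpha>\<close> on the two sides of \<open>m\<close>; so \<open>u'''\<close> vanishes for some \<open>\<alpha>\<close>, and
  even reflection gives a periodic solution.

  Otherwise \<open>t f(t) \<ge> 0\<close> for all \<open>t\<close>. On an interval \<open>[0, L]\<close> with Neumann conditions
  \<open>u' = u''' = 0\<close> at the ends, the functional \<open>\<integral> u''\<^sup>2/2 - q u'\<^sup>2/2 + F(u)\<close> has a strict local minimum at
  \<open>0\<close> because \<open>q\<^sup>2 < 4 F''(0)\<close>, and it is negative at \<open>- M (1 - cos(\<pi>x/L))\<close> for large \<open>M\<close> and
  \<open>(\<pi>/L)\<^sup>2\<close> close to \<open>q/2\<close>, because \<open>24 F(t) < q\<^sup>2 t\<^sup>2\<close> near \<open>-\<infinity>\<close>. The mountain pass level is monotone in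
  \<open>q\<close>, and by Struwe's monotonicity trick almost critical points with a bound on \<open>\<integral> u'\<^sup>2\<close> exist for almost
  every \<open>q\<close>. Only the mean of \<open>u\<close> can still escape. Adding \<open>\<kappa> t\<^sup>2\<close> to \<open>F\<close>, with \<open>\<kappa>\<close> tending to \<open>0\<close>, prevents
  this: the force \<open>f + 2 \<kappa> t\<close> then has strictly the sign of \<open>t\<close>, so a function \<open>u\<close> with almost vanishing
  gradient, for which the integral of the force is almost \<open>0\<close>, must almost vanish somewhere. For the same
  reason the limit is not a constant: the only possible constant is \<open>0\<close>, whose level is too low.
\<close>

section \<open>Even reflection of Neumann solutions\<close>

text \<open>Where the constants come from: for q > 0 the symbol k^4 - q k^2 + F''(0) of the
  linearisation at 0 is positive for all k exactly when q^2 < 4 F''(0). On -M (1 - cos kx) the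
  averages of u''^2/2, u'^2/2, u^2 are M^2 times k^4/4, k^2/4, 3/2; with the best k^2 = q/2,
  negativity of k^4/4 - q k^2/4 + 3a/2 reads 24 a < q^2. The trick compares levels at different q,
  so L and the endpoint must be shared by a whole interval [q1, q2]: q1 fixes L, q2 governs the
  strict minimum, and countably many such intervals cover all admissible q. The coefficient of the
  added quadratic, the step size and the increment of q all change with n. So one meets a sequence
  of level functions, each with its own increment, and Fatou's lemma replaces almost everywhere
  differentiability of one monotone function. The rate K that it yields depends on q and is unknown
  when the increments are chosen; they are therefore made small enough for every K up to n. States
  have a continuous u'' and the gradient is explicit (the force integrated twice), so no Sobolev
  space is needed: compactness is used only for u, through Arzela-Ascoli.\<close>

lemma iterated_deriv:
  assumes "\<And>j x. j < k \<Longrightarrow> (g j has_real_derivative g (Suc j) x) (at x)" "j \<le> k"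
  shows "(deriv ^^ j) (g 0) = g j"
  using assms(2)
proof (induction j)
  case (Suc j)
  then show ?case
    using assms(1)[of j] by (auto intro!: ext DERIV_imp_deriv)
qed simp

lemma C_classI:
  assumes "\<And>j x. j < k \<Longrightarrow> (g j has_real_derivative g (Suc j) x) (at x)"
    and "continuous_on UNIV (g k)"
  shows "C_class k (g 0)"
  unfolding C_class_def
proof (intro conjI allI impI)
  fix j assume "j < k"
  then show "(deriv ^^ j) (g 0) differentiable_on UNIV"
    using assms(1) iterated_deriv[of k g j]
    by (fastforce simp: differentiable_on_def real_differentiable_def)
qed (use assms iterated_deriv[of k g k] in simp)

lemma is_solutionI:
  assumes "\<And>x. (u has_real_derivative u1 x) (at x)" "\<And>x. (u1 has_real_derivative u2 x) (at x)"
    "\<And>x. (u2 has_real_derivative u3 x) (at x)"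
    "\<And>x. (u3 has_real_derivative - (q * u2 x + deriv F (u x))) (at x)"
    and "continuous_on UNIV (deriv F)"
  shows "is_solution q F u"
proof -
  define g where "g j = [u, u1, u2, u3, \<lambda>x. - (q * u2 x + deriv F (u x))] ! j" for j
  have g: "(g j has_real_derivative g (Suc j) x) (at x)" if "j < 4" for j x
  proof -
    from that consider "j = 0" | "j = 1" | "j = 2" | "j = 3" by linarith
    then show ?thesis using assms(1-4) by cases (auto simp: g_def numeral_2_eq_2 numeral_3_eq_3)
  qed
  have u: "u = g 0" by (simp add: g_def)
  have c: "continuous_on UNIV u" "continuous_on UNIV u2"
    using assms(1,3) by (auto intro!: DERIV_continuous_on)
  have "continuous_on UNIV (\<lambda>x. deriv F (u x))"
    using continuous_on_compose2[OF assms(5) c(1)] by simp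
  then have "continuous_on UNIV (g 4)"
    using c by (auto simp: g_def intro!: continuous_intros)
  then have "C_class 4 u"
    unfolding u using C_classI[of 4 g] g by blast
  moreover have "(deriv ^^ 4) u = g 4" "(deriv ^^ 2) u = g 2"
    unfolding u by (rule iterated_deriv[of 4 g]; use g in simp)+
  ultimately show ?thesis
    unfolding is_solution_def by (simp add: g_def)
qed

lemma antiderivative_on_reals:
  fixes g :: "real \<Rightarrow> real"
  assumes "continuous_on UNIV g"
  obtains G where "G 0 = c" "\<And>x. (G has_real_derivative g x) (at x)"
proof -
  have "\<exists>F. \<forall>x::real. -\<infinity> < ereal x \<longrightarrow> ereal x < \<infinity> \<longrightarrow> (F has_vector_derivative g x) (at x)"
    using assms by (intro einterval_antiderivative) (auto simp: continuous_on_eq_continuous_at)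
  then obtain F where F: "\<And>x. (F has_real_derivative g x) (at x)"
    by (auto simp: has_real_derivative_iff_has_vector_derivative)
  show ?thesis
    by (rule that[of "\<lambda>x. F x - F 0 + c"]) (auto intro!: derivative_eq_intros F)
qed

lemma eq_on_interval_from_deriv:
  assumes "\<And>x. x \<in> {0..L} \<Longrightarrow> (f has_real_derivative d x) (at x within {0..L})"
    and "\<And>x. x \<in> {0..L} \<Longrightarrow> (g has_real_derivative d x) (at x within {0..L})"
    and "f 0 = g 0" and "x \<in> {0..L}"
  shows "f x = g x"
proof -
  have "\<exists>c. \<forall>x\<in>{0..L}. f x - g x = c"
    by (rule has_field_derivative_zero_constant)
      (auto intro!: derivative_eq_intros assms(1,2))
  then obtain c where "\<And>x. x \<in> {0..L} \<Longrightarrow> f x - g x = c" by auto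
  from this[of 0] this[OF assms(4)] assms(3,4) show ?thesis by simp
qed

text \<open>\<open>G (x + 2 * L) - G x\<close> is constant; at \<open>x = - L\<close> oddness turns
  it into \<open>2 * G L\<close>, which is where \<open>G L = 0\<close> is needed.\<close>

lemma odd_periodic_antiderivative:
  fixes L :: real
  assumes G: "\<And>x. (G has_real_derivative g x) (at x)" and "G 0 = 0" "G L = 0"
    and "\<And>x. g (- x) = g x" and "\<And>x. g (x + 2 * L) = g x"
  shows "G (- x) = - G x" and "G (x + 2 * L) = G x"
proof -
  have odd: "G (- x) = - G x" for x
  proof -
    have "((\<lambda>x. G (- x) + G x) has_real_derivative 0) (at x)" for x
      using assms(4)[of x] by (auto intro!: derivative_eq_intros G DERIV_chain2[OF G])
    with DERIV_isconst_all[of "\<lambda>x. G (- x) + G x" x 0]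
    show ?thesis using assms(2) by simp
  qed
  then show "G (- x) = - G x" .
  have "((\<lambda>x. G (x + 2 * L) - G x) has_real_derivative 0) (at x)" for x
    using assms(5)[of x] G[of "x + 2 * L"] G[of x]
    by (auto intro!: derivative_eq_intros simp: DERIV_shift)
  then have "G (x + 2 * L) - G x = G (- L + 2 * L) - G (- L)"
    using DERIV_isconst_all[of "\<lambda>x. G (x + 2 * L) - G x" x "- L"] by simp
  then show "G (x + 2 * L) = G x"
    using odd[of L] assms(3) by simp
qed

lemma even_periodic_antiderivative:
  fixes L :: real
  assumes G: "\<And>x. (G has_real_derivative g x) (at x)"
    and "\<And>x. g (- x) = - g x" and "\<And>x. g (x + 2 * L) = g x"
  shows "G (- x) = G x" and "G (x + 2 * L) = G x"
proof -
  have even: "G (- x) = G x" for x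
  proof -
    have "((\<lambda>x. G (- x) - G x) has_real_derivative 0) (at x)" for x
      using assms(2)[of x] by (auto intro!: derivative_eq_intros G DERIV_chain2[OF G])
    with DERIV_isconst_all[of "\<lambda>x. G (- x) - G x" x 0]
    show ?thesis by simp
  qed
  then show "G (- x) = G x" .
  have "((\<lambda>x. G (x + 2 * L) - G x) has_real_derivative 0) (at x)" for x
    using assms(3)[of x] G[of "x + 2 * L"] G[of x]
    by (auto intro!: derivative_eq_intros simp: DERIV_shift)
  then have "G (x + 2 * L) - G x = G (- L + 2 * L) - G (- L)"
    using DERIV_isconst_all[of "\<lambda>x. G (x + 2 * L) - G x" x "- L"] by simp
  then show "G (x + 2 * L) = G x"
    using even[of L] by simp
qed

text \<open>The triangle wave that folds the line onto \<open>{0..L}\<close>.\<close>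

definition fold_line :: "real \<Rightarrow> real \<Rightarrow> real" where
  "fold_line L x = L / pi * arccos (cos (pi * x / L))"

lemma fold_props:
  assumes "L > 0"
  shows "fold_line L x \<in> {0..L}" and "x \<in> {0..L} \<Longrightarrow> fold_line L x = x"
    and "continuous_on UNIV (fold_line L)" and "fold_line L (- x) = fold_line L x"
    and "fold_line L (x + 2 * L) = fold_line L x"
proof -
  have "0 \<le> arccos (cos (pi * x / L))" "arccos (cos (pi * x / L)) \<le> pi"
    by (auto simp: arccos_lbound arccos_ubound)
  then show "fold_line L x \<in> {0..L}"
    using assms by (auto simp: fold_line_def field_simps)
  show "fold_line L x = x" if "x \<in> {0..L}"
    unfolding fold_line_def using that assms by (subst arccos_cos) (auto simp: field_simps)
  show "continuous_on UNIV (fold_line L)"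
    unfolding fold_line_def using assms by (auto intro!: continuous_intros)
  show "fold_line L (- x) = fold_line L x" by (simp add: fold_line_def)
  have "pi * (x + 2 * L) / L = pi * x / L + 2 * pi"
    using assms by (simp add: field_simps)
  then show "fold_line L (x + 2 * L) = fold_line L x" by (simp add: fold_line_def)
qed

text \<open>Equality of the two cosines says that \<open>fold_line L x\<close> is \<open>x\<close>
  or \<open>- x\<close> up to a multiple of \<open>2 * L\<close>, and \<open>G\<close> sees neither
  the sign nor the multiple.\<close>

lemma even_periodic_fold:
  assumes "L > 0" and even: "\<And>x. G (- x) = G x" and per: "\<And>x. G (x + 2 * L) = G x"
  shows "G (fold_line L x) = G x"
proof -
  interpret periodic_fun_simple G "2 * L" by standard (rule per)
  have "cos (pi * fold_line L x / L) = cos (pi * x / L)"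
    using assms(1) by (simp add: fold_line_def)
  then obtain n where n: "n \<in> \<int>"
    "pi * fold_line L x / L = pi * x / L + 2 * n * pi \<or> pi * fold_line L x / L = - (pi * x / L) + 2 * n * pi"
    unfolding cos_eq by blast
  then obtain m where m: "n = of_int m" by (auto elim: Ints_cases)
  have "fold_line L x = x + of_int m * (2 * L) \<or> fold_line L x = - x + of_int m * (2 * L)"
  proof (rule disjE[OF n(2)])
    assume "pi * fold_line L x / L = pi * x / L + 2 * n * pi"
    then have "pi * fold_line L x = pi * (x + of_int m * (2 * L))"
      using assms(1) m by (simp add: field_simps)
    then show ?thesis by simp
  next
    assume "pi * fold_line L x / L = - (pi * x / L) + 2 * n * pi"
    then have "pi * fold_line L x = pi * (- x + of_int m * (2 * L))"
      using assms(1) m by (simp add: field_simps)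
    then show ?thesis by simp
  qed
  then show ?thesis using plus_of_int[of x m] plus_of_int[of "- x" m] even[of x] by auto
qed

text \<open>Differentiating a reflected function at the junctions is avoided. Only the continuous
  folded function \<open>V\<close> enters the force; the other functions are rebuilt by integration.
  The boundary values make each antiderivative odd or even and periodic, and the final
  \<open>U\<close> agrees with \<open>V\<close> because both are even, periodic and equal to
  \<open>u\<close> on \<open>{0..L}\<close>.\<close>

lemma neumann_extension:
  fixes u u1 u2 u3 f :: "real \<Rightarrow> real"
  assumes L: "L > 0" and f: "continuous_on UNIV f"
    and d0: "\<And>x. x \<in> {0..L} \<Longrightarrow> (u has_real_derivative u1 x) (at x within {0..L})"
    and d1: "\<And>x. x \<in> {0..L} \<Longrightarrow> (u1 has_real_derivative u2 x) (at x within {0..L})"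
    and d2: "\<And>x. x \<in> {0..L} \<Longrightarrow> (u2 has_real_derivative u3 x) (at x within {0..L})"
    and d3: "\<And>x. x \<in> {0..L} \<Longrightarrow>
      (u3 has_real_derivative - (q * u2 x + f (u x))) (at x within {0..L})"
    and bc: "u1 0 = 0" "u1 L = 0" "u3 0 = 0" "u3 L = 0"
  obtains U U1 U2 U3 where "\<And>x. (U has_real_derivative U1 x) (at x)"
    "\<And>x. (U1 has_real_derivative U2 x) (at x)" "\<And>x. (U2 has_real_derivative U3 x) (at x)"
    "\<And>x. (U3 has_real_derivative - (q * U2 x + f (U x))) (at x)"
    "\<And>x. U (x + 2 * L) = U x" "\<And>x. x \<in> {0..L} \<Longrightarrow> U x = u x"
proof -
  define V where "V x = u (fold_line L x)" for x
  note fold = fold_props[OF L]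
  have cu: "continuous_on {0..L} u"
    using d0 by (rule DERIV_continuous_on)
  have V: "continuous_on UNIV V" "\<And>x. V (- x) = V x" "\<And>x. V (x + 2 * L) = V x"
    "\<And>x. x \<in> {0..L} \<Longrightarrow> V x = u x"
    unfolding V_def using fold by (auto intro!: continuous_on_compose2[OF cu])
  have fV: "continuous_on UNIV (\<lambda>x. f (V x))"
    using continuous_on_compose2[OF f V(1)] by simp
  obtain H1 where H1: "H1 0 = 0" "\<And>x. (H1 has_real_derivative f (V x)) (at x)"
    using antiderivative_on_reals[OF fV] by blast
  have H1L: "H1 x = - (u3 x + q * u1 x)" if "x \<in> {0..L}" for x
  proof (rule eq_on_interval_from_deriv[OF _ _ _ that])
    show "(H1 has_real_derivative f (V x)) (at x within {0..L})" for x
      using H1(2) has_field_derivative_at_within by blast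
    show "((\<lambda>x. - (u3 x + q * u1 x)) has_real_derivative f (V x)) (at x within {0..L})"
      if "x \<in> {0..L}" for x
      using that V(4)[OF that] by (auto intro!: derivative_eq_intros d1 d3)
  qed (use bc H1 in auto)
  have H1p: "\<And>x. H1 (- x) = - H1 x" "\<And>x. H1 (x + 2 * L) = H1 x"
    using odd_periodic_antiderivative[OF H1(2,1)] H1L[of L] L bc V(2,3) by auto
  have "continuous_on UNIV H1"
    using H1(2) by (rule DERIV_continuous_on)
  then obtain H2 where H2: "H2 0 = 0" "\<And>x. (H2 has_real_derivative H1 x) (at x)"
    using antiderivative_on_reals by blast
  have H2p: "\<And>x. H2 (- x) = H2 x" "\<And>x. H2 (x + 2 * L) = H2 x"
    using even_periodic_antiderivative[OF H2(2) H1p] by auto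
  \<comment> \<open>The candidate for the second derivative: the equation integrated twice from 0,
    using \<open>u1 0 = u3 0 = 0\<close>. It is written with \<open>V\<close>, so it becomes
    differentiable only once \<open>U = V\<close> is known.\<close>
  define P where "P x = (u2 0 + q * u 0) - q * V x - H2 x" for x
  have PL: "P x = u2 x" if "x \<in> {0..L}" for x
  proof -
    have "H2 x = (u2 0 + q * u 0) - q * u x - u2 x"
    proof (rule eq_on_interval_from_deriv[OF _ _ _ that])
      show "(H2 has_real_derivative H1 x) (at x within {0..L})" for x
        using H2(2) has_field_derivative_at_within by blast
      show "((\<lambda>x. (u2 0 + q * u 0) - q * u x - u2 x) has_real_derivative H1 x) (at x within {0..L})"
        if "x \<in> {0..L}" for x
        using that H1L[OF that] by (auto intro!: derivative_eq_intros d0 d2)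
    qed (use H2 in auto)
    then show ?thesis using V(4)[OF that] by (simp add: P_def)
  qed
  have "continuous_on UNIV H2"
    using H2(2) by (rule DERIV_continuous_on)
  then have "continuous_on UNIV P"
    unfolding P_def using V(1) by (auto intro!: continuous_intros)
  then obtain R1 where R1: "R1 0 = 0" "\<And>x. (R1 has_real_derivative P x) (at x)"
    using antiderivative_on_reals by blast
  have R1L: "R1 x = u1 x" if "x \<in> {0..L}" for x
  proof (rule eq_on_interval_from_deriv[OF _ _ _ that])
    show "(R1 has_real_derivative u2 x) (at x within {0..L})" if "x \<in> {0..L}" for x
      using R1(2)[of x] PL[OF that] has_field_derivative_at_within by metis
  qed (use d1 R1 bc in auto)
  have P: "\<And>x. P (- x) = P x" "\<And>x. P (x + 2 * L) = P x"
    using V(2,3) H2p by (auto simp: P_def)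
  have R1p: "\<And>x. R1 (- x) = - R1 x" "\<And>x. R1 (x + 2 * L) = R1 x"
    using odd_periodic_antiderivative[OF R1(2,1) _ P] R1L[of L] L bc by auto
  have "continuous_on UNIV R1"
    using R1(2) by (rule DERIV_continuous_on)
  then obtain U where U: "U 0 = u 0" "\<And>x. (U has_real_derivative R1 x) (at x)"
    using antiderivative_on_reals by blast
  have Up: "\<And>x. U (- x) = U x" "\<And>x. U (x + 2 * L) = U x"
    using even_periodic_antiderivative[OF U(2) R1p] by auto
  have UL: "U x = u x" if "x \<in> {0..L}" for x
  proof (rule eq_on_interval_from_deriv[OF _ _ _ that])
    show "(U has_real_derivative u1 x) (at x within {0..L})" if "x \<in> {0..L}" for x
      using U(2)[of x] R1L[OF that] has_field_derivative_at_within by metis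
  qed (use d0 U in auto)
  have "U = V"
  proof
    fix x
    have "U x = U (fold_line L x)" using even_periodic_fold[OF L Up] by simp
    then show "U x = V x" using UL fold(1) by (simp add: V_def)
  qed
  define U3 where "U3 x = - q * R1 x - H1 x" for x
  show ?thesis
  proof (rule that)
    show "(U has_real_derivative R1 x) (at x)" "(R1 has_real_derivative P x) (at x)" for x
      by (fact U R1)+
    show "(P has_real_derivative U3 x) (at x)" for x
      unfolding P_def U3_def \<open>U = V\<close>[symmetric]
      by (auto intro!: derivative_eq_intros U H2)
    show "(U3 has_real_derivative - (q * P x + f (U x))) (at x)" for x
      unfolding U3_def \<open>U = V\<close> by (auto intro!: derivative_eq_intros R1 H1)
  qed (fact Up(2) UL)+
qed

lemma solution_from_neumann:
  fixes F :: "real \<Rightarrow> real"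
  assumes L: "L > 0" and f: "continuous_on UNIV (deriv F)"
    and d0: "\<And>x. x \<in> {0..L} \<Longrightarrow> (u has_real_derivative u1 x) (at x within {0..L})"
    and d1: "\<And>x. x \<in> {0..L} \<Longrightarrow> (u1 has_real_derivative u2 x) (at x within {0..L})"
    and d2: "\<And>x. x \<in> {0..L} \<Longrightarrow> (u2 has_real_derivative u3 x) (at x within {0..L})"
    and d3: "\<And>x. x \<in> {0..L} \<Longrightarrow>
      (u3 has_real_derivative - (q * u2 x + deriv F (u x))) (at x within {0..L})"
    and bc: "u1 0 = 0" "u1 L = 0" "u3 0 = 0" "u3 L = 0"
    and nc: "\<not> u constant_on {0..L}"
  shows "\<exists>u. is_solution q F u \<and> nontrivial u \<and> periodic u"
proof -
  obtain U U1 U2 U3 where U: "\<And>x. (U has_real_derivative U1 x) (at x)"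
    "\<And>x. (U1 has_real_derivative U2 x) (at x)" "\<And>x. (U2 has_real_derivative U3 x) (at x)"
    "\<And>x. (U3 has_real_derivative - (q * U2 x + deriv F (U x))) (at x)"
    "\<And>x. U (x + 2 * L) = U x" "\<And>x. x \<in> {0..L} \<Longrightarrow> U x = u x"
    using neumann_extension[OF L f d0 d1 d2 d3 bc] by blast
  have "is_solution q F U" by (rule is_solutionI[OF U(1-4) f])
  moreover have "nontrivial U"
    using nc U(6) unfolding nontrivial_def constant_on_def by (metis UNIV_I)
  moreover have "periodic U"
    unfolding periodic_def using L U(5)
    by (intro exI[of _ "2 * L"]) (auto intro!: periodic_fun_simple.intro)
  ultimately show ?thesis by blast
qed

section \<open>Families of initial value problems\<close>

text \<open>Rescaling the integration variable by \<open>x\<close> moves the variable endpoint into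
  the integrand, so that continuity of integrals over the fixed interval [0, 1] applies.\<close>

lemma continuous_on_indefinite_integral:
  fixes g :: "'a::topological_space \<Rightarrow> real \<Rightarrow> 'b::banach"
  assumes g: "continuous_on (S \<times> {0..X}) (\<lambda>(s, x). g s x)"
  shows "continuous_on (S \<times> {0..X}) (\<lambda>(s, x). integral {0..x} (g s))"
proof -
  have eq: "integral {0..x} (g s) = integral (cbox 0 1) (\<lambda>t. x *\<^sub>R g s (x * t))"
    if "s \<in> S" "x \<in> {0..X}" for s x
  proof -
    have "continuous_on {0..x} (g s)"
      using that by (intro continuous_on_compose2[OF g, of _ "\<lambda>x. (s, x)", unfolded prod.case])
        (auto intro!: continuous_intros)
    then have D: "((\<lambda>y. integral {0..y} (g s)) has_vector_derivative g s y) (at y within {0..x})"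
      if "y \<in> {0..x}" for y
      using that by (rule integral_has_vector_derivative)
    have "((\<lambda>t. x *\<^sub>R g s (x * t)) has_integral
        integral {0..x * 1} (g s) - integral {0..x * 0} (g s)) {0..1}"
    proof (rule fundamental_theorem_of_calculus)
      fix t :: real assume t: "t \<in> {0..1}"
      have "((\<lambda>y. integral {0..y} (g s)) has_vector_derivative g s (x * t))
          (at (x * t) within (*) x ` {0..1})"
        using that t by (intro has_vector_derivative_within_subset[OF D])
          (auto simp: mult_left_le)
      moreover have "((*) x has_vector_derivative x) (at t within {0..1})"
        by (auto intro!: derivative_eq_intros)
      ultimately show "((\<lambda>t. integral {0..x * t} (g s)) has_vector_derivative x *\<^sub>R g s (x * t))
          (at t within {0..1})"
        using vector_diff_chain_within[of "(*) x" x t "{0..1}"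
            "\<lambda>y. integral {0..y} (g s)" "g s (x * t)"]
        by (simp add: o_def)
    qed simp
    from integral_unique[OF this] show ?thesis by (simp del: integral_scaleR_right)
  qed
  have "continuous_on (S \<times> {0..X}) (\<lambda>p. integral (cbox 0 1) (\<lambda>t. snd p *\<^sub>R g (fst p) (snd p * t)))"
  proof (rule integral_continuous_on_param)
    have "continuous_on ((S \<times> {0..X}) \<times> cbox 0 1)
        (\<lambda>r. (\<lambda>(s, x). g s x) (fst (fst r), snd (fst r) * snd r))"
      by (rule continuous_on_compose2[OF g])
        (auto intro!: continuous_intros mult_nonneg_nonneg simp: mult_left_le order_trans[OF mult_left_le])
    then have "continuous_on ((S \<times> {0..X}) \<times> cbox 0 1)
        (\<lambda>r. snd (fst r) *\<^sub>R g (fst (fst r)) (snd (fst r) * snd r))"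
      by (auto intro!: continuous_intros)
    then show "continuous_on ((S \<times> {0..X}) \<times> cbox 0 1)
        (\<lambda>(p, t). snd p *\<^sub>R g (fst p) (snd p * t))"
      by (simp add: case_prod_unfold)
  qed
  then show ?thesis
    by (rule continuous_on_eq) (auto simp: eq)
qed

lemma continuous_on_slice:
  assumes "continuous_on (S \<times> T) (\<lambda>(s, x). g s x)" "s \<in> S"
  shows "continuous_on T (g s)"
proof -
  have "continuous_on T (\<lambda>x. (\<lambda>(s, x). g s x) (s, x))"
    by (rule continuous_on_compose2[OF assms(1)]) (use assms(2) in \<open>auto intro!: continuous_intros\<close>)
  then show ?thesis by simp
qed

text \<open>Picard iteration in the norm \<open>sup exp(- \<gamma> x) |Y(\<alpha>, x)|\<close>, with the parameter of the initial
  value as a second variable, so that continuous dependence comes for free.\<close>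

lemma ode_family:
  fixes \<Phi> :: "'a::banach \<Rightarrow> 'a" and Y0 :: "real \<Rightarrow> 'a"
  assumes \<Phi>: "\<Lambda>-lipschitz_on UNIV \<Phi>" and Y0: "continuous_on {a..b} Y0"
    and "a \<le> b" "0 \<le> X"
  obtains Y where "continuous_on ({a..b} \<times> {0..X}) (\<lambda>(\<alpha>, x). Y \<alpha> x)"
    "\<And>\<alpha>. \<alpha> \<in> {a..b} \<Longrightarrow> Y \<alpha> 0 = Y0 \<alpha>"
    "\<And>\<alpha> x. \<alpha> \<in> {a..b} \<Longrightarrow> x \<in> {0..X} \<Longrightarrow>
      (Y \<alpha> has_vector_derivative \<Phi> (Y \<alpha> x)) (at x within {0..X})"
proof -
  \<comment> \<open>Any weight with \<open>\<Lambda> / \<gamma> \<le> 1 / 2\<close> gives a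
    contraction; the summand 1 keeps \<open>\<gamma>\<close> positive when
    \<open>\<Lambda> = 0\<close>.\<close>
  define \<gamma> where "\<gamma> = 2 * \<Lambda> + 1"
  have \<Lambda>: "0 \<le> \<Lambda>" using \<Phi> by (simp add: lipschitz_on_def)
  then have \<gamma>: "\<gamma> > 0" "\<Lambda> / \<gamma> \<le> 1 / 2" by (auto simp: \<gamma>_def field_simps)
  have c\<Phi>: "continuous_on UNIV \<Phi>" using \<Phi> by (rule lipschitz_on_continuous_on)
  \<comment> \<open>The Banach space at hand consists of bounded continuous functions on the whole
    plane, so arguments are first retracted to the rectangle.\<close>
  define ca where "ca = (\<lambda>\<alpha>. max a (min b \<alpha>))"
  define cx where "cx = (\<lambda>x. max 0 (min X x))"
  have ca: "ca \<alpha> \<in> {a..b}" "\<alpha> \<in> {a..b} \<Longrightarrow> ca \<alpha> = \<alpha>" for \<alpha>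
    using \<open>a \<le> b\<close> by (auto simp: ca_def)
  have cx: "cx x \<in> {0..X}" "x \<in> {0..X} \<Longrightarrow> cx x = x" for x
    using \<open>0 \<le> X\<close> by (auto simp: cx_def)
  \<comment> \<open>The unknown \<open>v\<close> stands for exp(- \<gamma> x) Y, so that the plain
    supremum norm of \<open>v\<close> is the weighted norm of Y.\<close>
  define G :: "(real \<times> real \<Rightarrow> 'a) \<Rightarrow> real \<Rightarrow> real \<Rightarrow> 'a" where
    "G v \<alpha> t = \<Phi> (exp (\<gamma> * t) *\<^sub>R v (\<alpha>, t))" for v \<alpha> t
  define T0 :: "(real \<times> real \<Rightarrow> 'a) \<Rightarrow> real \<times> real \<Rightarrow> 'a" where
    "T0 v p = exp (- \<gamma> * cx (snd p)) *\<^sub>R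
      (Y0 (ca (fst p)) + integral {0..cx (snd p)} (G v (ca (fst p))))" for v p
  have cG: "continuous_on ({a..b} \<times> {0..X}) (\<lambda>(\<alpha>, t). G v \<alpha> t)" if "continuous_on UNIV v" for v
    unfolding G_def case_prod_unfold
    by (intro continuous_on_compose2[OF c\<Phi>] continuous_intros continuous_on_compose2[OF that]) auto
  have T0: "T0 v \<in> bcontfun" if v: "continuous_on UNIV v" for v
  proof -
    define h where "h p = exp (- \<gamma> * snd p) *\<^sub>R
      (Y0 (fst p) + (\<lambda>(\<alpha>, x). integral {0..x} (G v \<alpha>)) p)" for p
    have h: "continuous_on ({a..b} \<times> {0..X}) h"
      unfolding h_def
      by (intro continuous_intros continuous_on_indefinite_integral[OF cG[OF v]]
          continuous_on_compose2[OF Y0]) auto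
    have eq: "T0 v = (\<lambda>p. h (ca (fst p), cx (snd p)))"
      by (simp add: T0_def h_def fun_eq_iff)
    have "continuous_on UNIV (\<lambda>p. h (ca (fst p), cx (snd p)))"
      by (rule continuous_on_compose2[OF h])
        (use ca(1) cx(1) in \<open>auto simp: ca_def cx_def intro!: continuous_intros\<close>)
    moreover have "bounded (range (\<lambda>p. h (ca (fst p), cx (snd p))))"
    proof (rule bounded_subset)
      show "bounded (h ` ({a..b} \<times> {0..X}))"
        by (intro compact_imp_bounded compact_continuous_image h compact_Times compact_Icc)
    qed (use ca(1) cx(1) in auto)
    ultimately show ?thesis by (simp add: eq bcontfun_def)
  qed
  define T where "T v = Bcontfun (T0 (apply_bcontfun v))" for v
  have T: "apply_bcontfun (T v) = T0 (apply_bcontfun v)" for v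
    unfolding T_def by (rule Bcontfun_inverse) (rule T0, simp)
  have "dist (T v) (T w) \<le> 1 / 2 * dist v w" for v w
  proof (rule dist_bound)
    fix p :: "real \<times> real"
    define \<alpha> where "\<alpha> = ca (fst p)"
    define x where "x = cx (snd p)"
    have \<alpha>: "\<alpha> \<in> {a..b}" and x: "x \<in> {0..X}" unfolding \<alpha>_def x_def by (rule ca(1) cx(1))+
    have ig: "G (apply_bcontfun v) \<alpha> integrable_on {0..x}" for v
      using x by (intro integrable_continuous_real continuous_on_subset[OF
            continuous_on_slice[OF cG \<alpha>]]) auto
    have "norm (integral {0..x} (\<lambda>t. G v \<alpha> t - G w \<alpha> t)) \<le>
        integral {0..x} (\<lambda>t. \<Lambda> * dist v w * exp (\<gamma> * t))"
    proof (rule integral_norm_bound_integral)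
      fix t assume "t \<in> {0..x}"
      have "norm (G v \<alpha> t - G w \<alpha> t) \<le>
          \<Lambda> * norm (exp (\<gamma> * t) *\<^sub>R v (\<alpha>, t) - exp (\<gamma> * t) *\<^sub>R w (\<alpha>, t))"
        using lipschitz_onD[OF \<Phi>] by (simp add: G_def dist_norm)
      also have "\<dots> = \<Lambda> * (exp (\<gamma> * t) * dist (v (\<alpha>, t)) (w (\<alpha>, t)))"
        by (simp add: dist_norm flip: scaleR_diff_right)
      also have "\<dots> \<le> \<Lambda> * (exp (\<gamma> * t) * dist v w)"
        using \<Lambda> by (intro mult_left_mono dist_bounded) auto
      finally show "norm (G v \<alpha> t - G w \<alpha> t) \<le> \<Lambda> * dist v w * exp (\<gamma> * t)"
        by (simp add: mult_ac)
    qed (rule integrable_diff[OF ig ig], auto intro!: integrable_continuous_real continuous_intros)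
    also have "\<dots> = \<Lambda> * dist v w * exp (\<gamma> * x) / \<gamma> - \<Lambda> * dist v w * exp (\<gamma> * 0) / \<gamma>"
      using x \<gamma> by (intro integral_unique fundamental_theorem_of_calculus)
        (auto intro!: derivative_eq_intros simp flip: has_real_derivative_iff_has_vector_derivative)
    also have "\<dots> \<le> \<Lambda> / \<gamma> * dist v w * exp (\<gamma> * x)"
      using \<gamma> \<Lambda> by (simp add: field_simps)
    also have "\<dots> \<le> 1 / 2 * dist v w * exp (\<gamma> * x)"
      using \<gamma> by (intro mult_right_mono) auto
    finally have *: "norm (integral {0..x} (G v \<alpha>) - integral {0..x} (G w \<alpha>)) \<le>
        1 / 2 * dist v w * exp (\<gamma> * x)"
      by (subst (asm) integral_diff[OF ig ig])
    have "dist (T v p) (T w p) =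
        exp (- \<gamma> * x) * norm (integral {0..x} (G v \<alpha>) - integral {0..x} (G w \<alpha>))"
      by (simp add: T T0_def dist_norm flip: \<alpha>_def x_def scaleR_diff_right)
    also have "\<dots> \<le> exp (- \<gamma> * x) * (1 / 2 * dist v w * exp (\<gamma> * x))"
      by (intro mult_left_mono *) auto
    also have "\<dots> = 1 / 2 * dist v w" by (simp add: exp_minus field_simps)
    finally show "dist (T v p) (T w p) \<le> 1 / 2 * dist v w" .
  qed
  then obtain v where v: "T v = v"
    using banach_fix_type[of "1 / 2" T] by auto
  have cv: "continuous_on S (apply_bcontfun v)" for S by simp
  define Y where "Y \<alpha> x = exp (\<gamma> * x) *\<^sub>R v (\<alpha>, x)" for \<alpha> x
  have Y: "Y \<alpha> x = Y0 \<alpha> + integral {0..x} (\<lambda>t. \<Phi> (Y \<alpha> t))" if "\<alpha> \<in> {a..b}" "x \<in> {0..X}" for \<alpha> x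
  proof -
    have 1: "v (\<alpha>, x) = T0 v (\<alpha>, x)" using T[of v] v by simp
    have 2: "T0 v (\<alpha>, x) = exp (- \<gamma> * x) *\<^sub>R (Y0 \<alpha> + integral {0..x} (G v \<alpha>))"
      unfolding T0_def fst_conv snd_conv ca(2)[OF that(1)] cx(2)[OF that(2)] by (rule refl)
    have 3: "G v \<alpha> = (\<lambda>t. \<Phi> (Y \<alpha> t))"
      by (rule ext) (simp only: G_def Y_def)
    have 4: "exp (\<gamma> * x) * exp (- \<gamma> * x) = 1"
      by (simp add: exp_minus_inverse)
    show ?thesis
      unfolding Y_def[of \<alpha> x] 1 2 scaleR_scaleR 4 3 scaleR_one by (rule refl)
  qed
  have cY: "continuous_on ({a..b} \<times> {0..X}) (\<lambda>(\<alpha>, x). Y \<alpha> x)"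
    unfolding Y_def case_prod_unfold
    by (intro continuous_intros continuous_on_compose2[OF cv]) auto
  show ?thesis
  proof (rule that[OF cY])
    show "Y \<alpha> 0 = Y0 \<alpha>" if "\<alpha> \<in> {a..b}" for \<alpha>
      using Y[OF that, of 0] \<open>0 \<le> X\<close> by simp
    fix \<alpha> x assume \<alpha>: "\<alpha> \<in> {a..b}" and x: "x \<in> {0..X}"
    have "continuous_on {0..X} (\<lambda>t. \<Phi> (Y \<alpha> t))"
      by (intro continuous_on_compose2[OF c\<Phi>] continuous_on_slice[OF cY \<alpha>]) auto
    then have "((\<lambda>x. Y0 \<alpha> + integral {0..x} (\<lambda>t. \<Phi> (Y \<alpha> t))) has_vector_derivative 0 + \<Phi> (Y \<alpha> x))
        (at x within {0..X})"
      by (intro has_vector_derivative_add integral_has_vector_derivative x) auto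
    then show "(Y \<alpha> has_vector_derivative \<Phi> (Y \<alpha> x)) (at x within {0..X})"
      using has_vector_derivative_transform[OF x Y[OF \<alpha>]] by simp
  qed
qed

section \<open>Shooting near a downcrossing of the force\<close>

lemma nondecreasing_within:
  fixes F :: "real \<Rightarrow> real"
  assumes "a \<le> b" "{a..b} \<subseteq> S"
    and F: "\<And>t. t \<in> S \<Longrightarrow> (F has_real_derivative D t) (at t within S)"
    and D: "\<And>t. a < t \<Longrightarrow> t < b \<Longrightarrow> D t \<ge> 0"
  shows "F a \<le> F b"
proof (rule DERIV_nonneg_imp_increasing_open[OF \<open>a \<le> b\<close>])
  show "\<exists>y. (F has_real_derivative y) (at x) \<and> 0 \<le> y" if "a < x" "x < b" for x
  proof -
    have "(F has_real_derivative D x) (at x within {a<..<b})"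
      using that assms(2) by (intro has_field_derivative_subset[OF F]) auto
    then have "(F has_real_derivative D x) (at x)"
      using that by (simp add: at_within_open[of x "{a<..<b}"])
    with D that show ?thesis by blast
  qed
  show "continuous_on {a..b} F"
    using DERIV_continuous_on[OF F] assms(2) continuous_on_subset by blast
qed

text \<open>Variation of constants: the derivative of \<open>F\<close> is the forcing y'' +
  \<omega>^2 y times the kernel sin(\<omega> (x - t)), which is nonnegative as long as \<omega> x is
  at most pi; \<open>F 0\<close> and \<open>F x\<close> are the two sides of the claim.\<close>

lemma oscillator_lower_bound:
  fixes y :: "real \<Rightarrow> real"
  assumes "0 < \<omega>" "0 \<le> x" "x \<le> pi / \<omega>" "{0..x} \<subseteq> S"
    and y: "\<And>t. t \<in> S \<Longrightarrow> (y has_real_derivative c t) (at t within S)"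
    and c: "\<And>t. t \<in> S \<Longrightarrow> (c has_real_derivative d t) (at t within S)"
    and d: "\<And>t. 0 < t \<Longrightarrow> t < x \<Longrightarrow> d t + \<omega>\<^sup>2 * y t \<ge> 0"
    and "y 0 = 0" "c 0 = - s"
  shows "- s * sin (\<omega> * x) \<le> \<omega> * y x"
proof -
  define F where "F t = c t * sin (\<omega> * (x - t)) + \<omega> * y t * cos (\<omega> * (x - t))" for t
  have "F 0 \<le> F x"
  proof (rule nondecreasing_within[OF \<open>0 \<le> x\<close> \<open>{0..x} \<subseteq> S\<close>])
    show "(F has_real_derivative (d t + \<omega>\<^sup>2 * y t) * sin (\<omega> * (x - t))) (at t within S)"
      if "t \<in> S" for t
      unfolding F_def using that
      by (auto intro!: derivative_eq_intros y c simp: algebra_simps power2_eq_square)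
    show "0 \<le> (d t + \<omega>\<^sup>2 * y t) * sin (\<omega> * (x - t))" if t: "0 < t" "t < x" for t
    proof (intro mult_nonneg_nonneg d t sin_ge_zero)
      have "\<omega> * (x - t) \<le> \<omega> * x" using t \<open>0 < \<omega>\<close> by simp
      also have "\<dots> \<le> pi" using assms(1,3) by (simp add: field_simps)
      finally show "\<omega> * (x - t) \<le> pi" .
    qed (use t \<open>0 < \<omega>\<close> in auto)
  qed
  then show ?thesis by (simp add: F_def assms)
qed

lemma first_zero:
  fixes y :: "real \<Rightarrow> real"
  assumes y: "continuous_on {0..b} y" and "0 < \<xi>" "\<xi> \<le> b" "0 \<le> y b" "y 0 = 0"
    and neg: "\<And>t. 0 < t \<Longrightarrow> t \<le> \<xi> \<Longrightarrow> y t < 0"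
  obtains x where "\<xi> \<le> x" "x \<le> b" "y x = 0" "\<And>t. t \<in> {0..x} \<Longrightarrow> y t \<le> 0"
proof -
  define Z where "Z = {t \<in> {\<xi>..b}. y t = 0}"
  have c: "continuous_on {\<xi>..b} y"
    using y \<open>0 < \<xi>\<close> by (auto intro: continuous_on_subset)
  have "closed Z"
    unfolding Z_def using continuous_closed_preimage_constant[OF c closed_atLeastAtMost]
    by simp
  moreover have "Z \<noteq> {}"
    using IVT'[of y \<xi> 0 b] c neg[of \<xi>] assms unfolding Z_def by fastforce
  moreover have "bdd_below Z" by (auto simp: Z_def)
  ultimately have x: "Inf Z \<in> Z" by (intro closed_contains_Inf)
  show ?thesis
  proof (rule that[of "Inf Z"])
    fix t assume t: "t \<in> {0..Inf Z}"
    show "y t \<le> 0"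
    proof (rule ccontr)
      assume "\<not> y t \<le> 0"
      then have t': "\<xi> < t" "0 \<le> y t" using neg[of t] t \<open>y 0 = 0\<close> by (cases "t = 0"; force)+
      then obtain t'' where "\<xi> \<le> t''" "t'' \<le> t" "y t'' = 0"
        using IVT'[of y \<xi> 0 t] neg[of \<xi>] \<open>0 < \<xi>\<close> t x continuous_on_subset[OF c, of "{\<xi>..t}"]
        by (force simp: Z_def)
      then have "Inf Z \<le> t''"
        using t x by (intro cInf_lower \<open>bdd_below Z\<close>) (auto simp: Z_def)
      then have "t'' = t" using \<open>t'' \<le> t\<close> t by auto
      then show False using \<open>\<not> y t \<le> 0\<close> \<open>y t'' = 0\<close> by simp
    qed
  qed (use x in \<open>auto simp: Z_def\<close>)
qed

text \<open>With \<open>y = u'\<close>, \<open>c = u''\<close> and \<open>z = - (u''' + \<omega>\<^sup>2 u')\<close> the system below is the equation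
  \<open>u'''' + (10 / 9) \<omega>\<^sup>2 u'' + g = 0\<close>, where \<open>g\<close> is the nonlinearity along the trajectory. The splitting
  \<open>q = \<omega>\<^sup>2 + \<omega>\<^sup>2 / 9\<close> absorbs a slope of the nonlinearity of up to \<open>\<omega>\<^sup>4 / 9\<close>.\<close>

locale trajectory =
  fixes u y c z g :: "real \<Rightarrow> real" and \<omega> s :: real
  assumes \<omega>: "\<omega> > 0" and s: "s > 0"
    and u': "\<And>t. t \<in> {0..4 / \<omega>} \<Longrightarrow> (u has_real_derivative y t) (at t within {0..4 / \<omega>})"
    and y': "\<And>t. t \<in> {0..4 / \<omega>} \<Longrightarrow> (y has_real_derivative c t) (at t within {0..4 / \<omega>})"
    and c': "\<And>t. t \<in> {0..4 / \<omega>} \<Longrightarrow>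
      (c has_real_derivative - \<omega>\<^sup>2 * y t - z t) (at t within {0..4 / \<omega>})"
    and z': "\<And>t. t \<in> {0..4 / \<omega>} \<Longrightarrow>
      (z has_real_derivative \<omega>\<^sup>2 / 9 * c t + g t) (at t within {0..4 / \<omega>})"
    and init: "y 0 = 0" "c 0 = - s" "z 0 = 0"
    and slope: "\<And>t t'. t \<in> {0..4 / \<omega>} \<Longrightarrow> t' \<in> {0..4 / \<omega>} \<Longrightarrow> u t' \<le> u t \<Longrightarrow>
      g t - g t' \<le> \<omega> ^ 4 / 9 * (u t - u t')"
begin

text \<open>The horizon \<open>4 / \<omega>\<close> is a convenient number above the half period
  \<open>pi / \<omega>\<close>; the strict gap keeps zeros of \<open>y\<close> interior, where
  \<open>y\<close> has a two-sided derivative.\<close>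

lemma pi_less: "pi / \<omega> < 4 / \<omega>"
  using \<omega> pi_less_4 by (simp add: divide_strict_right_mono)

lemma u_decreasing:
  assumes "x \<le> 4 / \<omega>" "\<And>t. t \<in> {0..x} \<Longrightarrow> y t \<le> 0" "0 \<le> t" "t \<le> t'" "t' \<le> x"
  shows "u t' \<le> u t"
proof -
  have "- u t \<le> - u t'"
    using assms by (intro nondecreasing_within[of t t' "{0..4 / \<omega>}" "\<lambda>t. - u t" "\<lambda>t. - y t"])
      (auto intro!: derivative_eq_intros u')
  then show ?thesis by simp
qed

text \<open>Maximum principle: \<open>z' + (\<omega>\<^sup>2 / 9) \<integral> z\<close> is nondecreasing as long as \<open>u\<close> decreases.\<close>

lemma z_nonpos:
  assumes x: "0 < x" "x \<le> 4 / \<omega>" and y: "\<And>t. t \<in> {0..x} \<Longrightarrow> y t \<le> 0" and zx: "z x \<le> 0"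
    and t: "t \<in> {0..x}"
  shows "z t \<le> 0"
proof (rule ccontr)
  assume "\<not> z t \<le> 0"
  have cz: "continuous_on {0..x} z"
    using DERIV_continuous_on[OF z'] x continuous_on_subset[of "{0..4 / \<omega>}" z "{0..x}"] by force
  then obtain m where m: "m \<in> {0..x}" "\<And>t. t \<in> {0..x} \<Longrightarrow> z t \<le> z m"
    using continuous_attains_sup[of "{0..x}" z] x by auto
  with \<open>\<not> z t \<le> 0\<close> t have Z: "z m > 0" by force
  then have m': "0 < m" "m < x" using init zx m(1) by (auto simp: less_le)
  have "(z has_real_derivative \<omega>\<^sup>2 / 9 * c m + g m) (at m)"
  proof -
    have "(z has_real_derivative \<omega>\<^sup>2 / 9 * c m + g m) (at m within {0<..<x})"
      using m' x by (intro has_field_derivative_subset[OF z']) auto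
    then show ?thesis using m' by (simp add: at_within_open[of m "{0<..<x}"])
  qed
  then have z'm: "\<omega>\<^sup>2 / 9 * c m + g m = 0"
  proof (rule DERIV_local_max)
    show "0 < min m (x - m)" using m' by simp
    show "\<forall>t. \<bar>m - t\<bar> < min m (x - m) \<longrightarrow> z t \<le> z m"
      using m(2) by (auto simp: abs_if split: if_splits)
  qed
  \<comment> \<open>Since \<open>z\<close> lies below \<open>z m\<close>, the function c +
    \<omega>^2 u falls at most at rate \<open>z m\<close> after \<open>m\<close>. The resulting loss
    \<omega>^4 / 9 times the drop of \<open>u\<close> is cancelled by the bound on the slope of
    \<open>g\<close>.\<close>
  have z'_ge: "\<omega>\<^sup>2 / 9 * c t + g t + \<omega>\<^sup>2 / 9 * z m * (t - m) \<ge> 0" if t: "m \<le> t" "t \<le> x" for t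
  proof -
    define Q where "Q t = c t + \<omega>\<^sup>2 * u t + z m * t" for t
    have "Q m \<le> Q t"
      using t m' m x
      by (intro nondecreasing_within[of m t "{0..4 / \<omega>}" Q "\<lambda>t. z m - z t"])
        (auto simp: Q_def[abs_def] intro!: derivative_eq_intros c' u')
    then have "0 \<le> \<omega>\<^sup>2 / 9 * (c t - c m - \<omega>\<^sup>2 * (u m - u t) + z m * (t - m))"
      by (intro mult_nonneg_nonneg) (auto simp: Q_def algebra_simps)
    also have "\<dots> = \<omega>\<^sup>2 / 9 * c t - \<omega>\<^sup>2 / 9 * c m - \<omega> ^ 4 / 9 * (u m - u t) + \<omega>\<^sup>2 / 9 * z m * (t - m)"
      by (simp add: field_simps power4_eq_xxxx power2_eq_square)
    finally have "0 \<le> \<omega>\<^sup>2 / 9 * c t - \<omega>\<^sup>2 / 9 * c m - \<omega> ^ 4 / 9 * (u m - u t) + \<omega>\<^sup>2 / 9 * z m * (t - m)" .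
    moreover have "g m - g t \<le> \<omega> ^ 4 / 9 * (u m - u t)"
      using t m' x by (intro slope u_decreasing[OF x(2) y]) auto
    ultimately show ?thesis
      using z'm by linarith
  qed
  define P where "P t = z t + \<omega>\<^sup>2 / 18 * z m * (t - m)\<^sup>2" for t
  have "P m \<le> P x"
    using m' x z'_ge
    by (intro nondecreasing_within[of m x "{0..4 / \<omega>}" P
          "\<lambda>t. \<omega>\<^sup>2 / 9 * c t + g t + \<omega>\<^sup>2 / 9 * z m * (t - m)"])
      (auto simp: P_def[abs_def] intro!: derivative_eq_intros z')
  then have "z m \<le> \<omega>\<^sup>2 / 18 * z m * (x - m)\<^sup>2" using zx by (simp add: P_def)
  \<comment> \<open>The horizon decides: 16 / 18 < 1, so \<open>z\<close> cannot come down from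
    \<open>z m\<close> to a nonpositive value in the available time.\<close>
  also have "\<dots> \<le> \<omega>\<^sup>2 / 18 * z m * (4 / \<omega>)\<^sup>2"
    using m' x Z by (intro mult_left_mono power_mono) auto
  also have "\<dots> = 16 / 18 * z m" using \<omega> by (simp add: field_simps)
  finally show False using Z by simp
qed

text \<open>\<open>W\<close> is the Wronskian of \<open>y\<close> with sin(\<omega> t). It is
  nondecreasing because \<open>z \<le> 0\<close>, and a double zero at \<open>x\<close> would make
  it vanish at both ends, hence force \<open>z = 0\<close> in between. Then \<open>y\<close> is a
  free oscillation, for which \<open>V\<close> is conserved; but \<open>V\<close> equals
  \<open>- s\<close> at 0 and would be 0 at \<open>x\<close>.\<close>

lemma zero_transversal:
  assumes x: "0 < x" "x \<le> pi / \<omega>" and z: "\<And>t. t \<in> {0..x} \<Longrightarrow> z t \<le> 0" and yx: "y x = 0"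
  shows "c x \<noteq> 0"
proof
  assume cx: "c x = 0"
  have x4: "x \<le> 4 / \<omega>" using x pi_less by linarith
  define W where "W t = c t * sin (\<omega> * t) - \<omega> * y t * cos (\<omega> * t)" for t
  define V where "V t = c t * cos (\<omega> * t) + \<omega> * y t * sin (\<omega> * t)" for t
  have sin: "sin (\<omega> * t) > 0" if "0 < t" "t < x" for t
  proof (rule sin_gt_zero)
    have "\<omega> * t < \<omega> * x" using that \<omega> by simp
    also have "\<dots> \<le> pi" using x \<omega> by (simp add: field_simps)
    finally show "\<omega> * t < pi" .
  qed (use that \<omega> in simp)
  have W': "(W has_real_derivative - z t * sin (\<omega> * t)) (at t within {0..4 / \<omega>})"
    if "t \<in> {0..4 / \<omega>}" for t
    unfolding W_def using that
    by (auto intro!: derivative_eq_intros y' c' simp: algebra_simps power2_eq_square)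
  have mono: "W a \<le> W b" if "0 \<le> a" "a \<le> b" "b \<le> x" for a b
    using that x4 sin z
    by (intro nondecreasing_within[OF _ _ W']) (auto simp: mult_nonpos_nonneg less_imp_le)
  have W0: "W t = 0" if "t \<in> {0..x}" for t
    using mono[of 0 t] mono[of t x] that by (simp add: W_def init yx cx)
  have z0: "z t = 0" if t: "0 < t" "t < x" for t
  proof -
    have "(W has_real_derivative - z t * sin (\<omega> * t)) (at t within {0<..<x})"
      using t x4 by (intro has_field_derivative_subset[OF W']) auto
    then have "(W has_real_derivative - z t * sin (\<omega> * t)) (at t)"
      using t by (simp add: at_within_open[of t "{0<..<x}"])
    moreover have "(W has_real_derivative 0) (at t)"
    proof (rule DERIV_cong_ev[THEN iffD1, of t t "\<lambda>_. 0" W 0 0])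
      show "\<forall>\<^sub>F t in nhds t. 0 = W t"
        using eventually_nhds_in_open[of "{0<..<x}" t] t
        by (auto elim!: eventually_mono simp: W0)
    qed auto
    ultimately have "- z t * sin (\<omega> * t) = 0" by (rule DERIV_unique)
    then show ?thesis using sin[OF t] by simp
  qed
  have V': "(V has_real_derivative - z t * cos (\<omega> * t)) (at t within {0..4 / \<omega>})"
    if "t \<in> {0..4 / \<omega>}" for t
    unfolding V_def using that
    by (auto intro!: derivative_eq_intros y' c' simp: algebra_simps power2_eq_square)
  have "- V 0 \<le> - V x"
    by (rule nondecreasing_within[of 0 x "{0..4 / \<omega>}" "\<lambda>t. - V t" "\<lambda>t. z t * cos (\<omega> * t)"])
      (use x x4 z0 in \<open>auto intro!: derivative_eq_intros V'\<close>)
  then show False using s by (simp add: V_def init yx cx)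
qed

text \<open>An interior zero of \<open>y\<close> would be a maximum, hence a double zero, which
  \<open>zero_transversal\<close> excludes; comparison with the free oscillator gives
  \<open>y \<ge> 0\<close> at \<open>pi / \<omega>\<close>, so the zero has occurred by then. The
  strict sign of \<open>c x\<close> makes the zero persist under small changes of the initial
  height.\<close>

lemma zero_props:
  assumes x: "0 < x" "x \<le> 4 / \<omega>" and y: "\<And>t. t \<in> {0..x} \<Longrightarrow> y t \<le> 0"
    and yx: "y x = 0" and zx: "z x \<le> 0"
  shows "x \<le> pi / \<omega>" and "c x > 0" and "\<And>t. 0 < t \<Longrightarrow> t < x \<Longrightarrow> y t < 0"
    and "\<And>t. t \<in> {0..x} \<Longrightarrow> - s / \<omega> \<le> y t"
proof -
  note z = z_nonpos[OF x y zx]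
  have at_x: "(y has_real_derivative c t) (at t)" if "0 < t" "t < 4 / \<omega>" for t
  proof -
    have "(y has_real_derivative c t) (at t within {0<..<4 / \<omega>})"
      using that by (intro has_field_derivative_subset[OF y']) auto
    then show ?thesis using that by (simp add: at_within_open[of t "{0<..<4 / \<omega>}"])
  qed
  have neg: "y t < 0" if t: "0 < t" "t < x" "t \<le> pi / \<omega>" for t
  proof (rule ccontr)
    assume "\<not> y t < 0"
    then have yt: "y t = 0" using y[of t] t by simp
    have "c t = 0"
    proof (rule DERIV_local_max[OF at_x])
      show "0 < min t (x - t)" using t by simp
      show "\<forall>t'. \<bar>t - t'\<bar> < min t (x - t) \<longrightarrow> y t' \<le> y t"
        using y yt by (auto simp: abs_if split: if_splits)
    qed (use t x in auto)
    then show False using zero_transversal[of t] t z yt by auto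
  qed
  have low: "- s * sin (\<omega> * t) \<le> \<omega> * y t" if "t \<in> {0..x}" "t \<le> pi / \<omega>" for t
    using that x z
    by (intro oscillator_lower_bound[OF \<omega> _ _ _ y' c' _ init(1,2)]) auto
  show xpi: "x \<le> pi / \<omega>"
  proof (rule ccontr)
    assume "\<not> x \<le> pi / \<omega>"
    then have "y (pi / \<omega>) < 0" using \<omega> by (intro neg) auto
    moreover have "0 \<le> \<omega> * y (pi / \<omega>)"
      using low[of "pi / \<omega>"] \<open>\<not> x \<le> pi / \<omega>\<close> \<omega> by auto
    ultimately show False using \<omega> by (simp add: zero_le_mult_iff)
  qed
  show "y t < 0" if "0 < t" "t < x" for t using neg that xpi by auto
  have x4: "x < 4 / \<omega>" using xpi pi_less by simp
  have "c x \<noteq> 0" using zero_transversal[OF x(1) xpi z yx] by simp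
  moreover have "\<not> c x < 0"
  proof
    assume "c x < 0"
    from DERIV_neg_dec_left[OF at_x this] x(1) x4 obtain d where
      d: "d > 0" "\<And>h. 0 < h \<Longrightarrow> h < d \<Longrightarrow> y x < y (x - h)" by auto
    define h where "h = min d x / 2"
    have "0 < h" "h < d" "h < x" using d x(1) by (auto simp: h_def)
    then show False using d(2)[of h] y[of "x - h"] yx by simp
  qed
  ultimately show "c x > 0" by simp
  show "- s / \<omega> \<le> y t" if t: "t \<in> {0..x}" for t
  proof -
    have "- s \<le> - s * sin (\<omega> * t)" using s by simp
    also have "\<dots> \<le> \<omega> * y t" using low t xpi by auto
    finally show ?thesis using \<omega> by (simp add: field_simps)
  qed
qed

lemma u_bound:
  assumes "0 \<le> x" "x \<le> 4 / \<omega>" "\<And>t. t \<in> {0..x} \<Longrightarrow> - k \<le> y t"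
  shows "u 0 - k * x \<le> u x"
proof -
  have "0 \<le> y t + k" if "0 < t" "t < x" for t
    using assms(3)[of t] that by simp
  then have "u 0 + k * 0 \<le> u x + k * x"
    using assms(1,2) by (intro nondecreasing_within[of 0 x "{0..4 / \<omega>}" "\<lambda>t. u t + k * t" "\<lambda>t. y t + k"])
      (auto intro!: derivative_eq_intros u' simp: add.commute)
  then show ?thesis by simp
qed

end

section \<open>Shooting over a compact interval of initial heights\<close>

lemma joint_limit:
  assumes "continuous_on (A \<times> B) (\<lambda>(\<alpha>, x). g \<alpha> x)"
    and "\<alpha> \<longlonglongrightarrow> \<alpha>0" "x \<longlonglongrightarrow> x0" "\<And>n::nat. \<alpha> n \<in> A" "\<And>n. x n \<in> B" "\<alpha>0 \<in> A" "x0 \<in> B"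
  shows "(\<lambda>n. g (\<alpha> n) (x n)) \<longlonglongrightarrow> g \<alpha>0 x0"
proof -
  have "(\<lambda>n. (\<lambda>(\<alpha>, x). g \<alpha> x) (\<alpha> n, x n)) \<longlonglongrightarrow> (\<lambda>(\<alpha>, x). g \<alpha> x) (\<alpha>0, x0)"
    by (rule continuous_on_tendsto_compose[OF assms(1)]) (use assms in \<open>auto intro!: tendsto_intros\<close>)
  then show ?thesis by simp
qed

lemma dist_Pair_le: "dist (x1, x2) (y1, y2) \<le> dist x1 y1 + dist x2 y2"
  unfolding dist_Pair_Pair by (rule sqrt_sum_squares_le_sum) auto

text \<open>If no shot ended with \<open>z = 0\<close>, the shots returning with
  \<open>z \<le> 0\<close> would form a relatively open and closed set of initial heights containing
  \<open>b\<close> but not \<open>a\<close>. The hypotheses on \<open>h\<close> are global so that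
  solutions exist up to the horizon; since \<open>u\<close> is confined to
  \<open>{a - r..b}\<close>, \<open>h\<close> may be a truncation of the actual force.\<close>

lemma shooting:
  fixes h :: "real \<Rightarrow> real"
  assumes q: "q > 0" and h: "\<Lambda>-lipschitz_on UNIV h"
    and slope: "\<And>t t'. t' \<le> t \<Longrightarrow> h t - h t' \<le> 9 / 100 * q\<^sup>2 * (t - t')"
    and ab: "a \<le> b" and r: "r > 0"
    and ha: "\<And>t. a - r \<le> t \<Longrightarrow> t \<le> a \<Longrightarrow> h t > 0" and hb: "\<And>t. b - r \<le> t \<Longrightarrow> h t \<le> 0"
  obtains L u y c d where "L > 0"
    "\<And>t. t \<in> {0..L} \<Longrightarrow> (u has_real_derivative y t) (at t within {0..L})"
    "\<And>t. t \<in> {0..L} \<Longrightarrow> (y has_real_derivative c t) (at t within {0..L})"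
    "\<And>t. t \<in> {0..L} \<Longrightarrow> (c has_real_derivative d t) (at t within {0..L})"
    "\<And>t. t \<in> {0..L} \<Longrightarrow> (d has_real_derivative - (q * c t + h (u t))) (at t within {0..L})"
    "y 0 = 0" "y L = 0" "d 0 = 0" "d L = 0" "c 0 \<noteq> 0" "\<And>t. t \<in> {0..L} \<Longrightarrow> u t \<in> {a - r..b}"
proof -
  \<comment> \<open>Chosen so that q = \<omega>^2 + \<omega>^2 / 9, the splitting used in
    \<open>trajectory\<close>; the slope bound then equals \<omega>^4 / 9.\<close>
  define \<omega> where "\<omega> = sqrt (9 / 10 * q)"
  have om: "\<omega> > 0" "\<omega>\<^sup>2 = 9 / 10 * q" using q by (auto simp: \<omega>_def)
  note \<omega> = om
  have "\<omega> ^ 4 = (\<omega>\<^sup>2)\<^sup>2" by (simp flip: power_mult)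
  then have \<omega>4: "\<omega> ^ 4 / 9 = 9 / 100 * q\<^sup>2"
    unfolding om(2) by (simp add: power_mult_distrib power_divide)
  define X where "X = 4 / \<omega>"
  \<comment> \<open>The speed is at most s / \<omega> and the time at most 4 / \<omega>, so with
    this \<open>s\<close> the height drops by at most \<open>r\<close>.\<close>
  define s where "s = r * \<omega>\<^sup>2 / 4"
  have X: "X > 0" and s: "s > 0" using \<omega> r by (auto simp: X_def s_def)
  define \<Phi> :: "real \<times> real \<times> real \<times> real \<Rightarrow> real \<times> real \<times> real \<times> real" where
    "\<Phi> = (\<lambda>(u, y, c, z). (y, c, - \<omega>\<^sup>2 * y - z, \<omega>\<^sup>2 / 9 * c + h u))"
  have lip: "(1 + 1 + (\<omega>\<^sup>2 + 1) + (\<omega>\<^sup>2 / 9 + \<Lambda>))-lipschitz_on UNIV \<Phi>"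
  proof (rule lipschitz_onI)
    have \<Lambda>: "0 \<le> \<Lambda>" using h by (simp add: lipschitz_on_def)
    then show "0 \<le> 1 + 1 + (\<omega>\<^sup>2 + 1) + (\<omega>\<^sup>2 / 9 + \<Lambda>)" by simp
    fix p p' :: "real \<times> real \<times> real \<times> real"
    obtain u y c z where p: "p = (u, y, c, z)" by (cases p)
    obtain u' y' c' z' where p': "p' = (u', y', c', z')" by (cases p')
    have comp: "dist u u' \<le> dist p p'" "dist y y' \<le> dist p p'" "dist c c' \<le> dist p p'" "dist z z' \<le> dist p p'"
      using dist_fst_le[of p p'] dist_snd_le[of p p'] dist_fst_le[of "snd p" "snd p'"]
        dist_snd_le[of "snd p" "snd p'"] dist_fst_le[of "snd (snd p)" "snd (snd p')"]
        dist_snd_le[of "snd (snd p)" "snd (snd p')"]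
      unfolding p p' fst_conv snd_conv by linarith+
    have "dist (\<Phi> p) (\<Phi> p') \<le> dist y y' + dist c c' + dist (- \<omega>\<^sup>2 * y - z) (- \<omega>\<^sup>2 * y' - z')
        + dist (\<omega>\<^sup>2 / 9 * c + h u) (\<omega>\<^sup>2 / 9 * c' + h u')"
      unfolding p p' \<Phi>_def prod.case
      using dist_Pair_le[of y "(c, - \<omega>\<^sup>2 * y - z, \<omega>\<^sup>2 / 9 * c + h u)"
          y' "(c', - \<omega>\<^sup>2 * y' - z', \<omega>\<^sup>2 / 9 * c' + h u')"]
        dist_Pair_le[of c "(- \<omega>\<^sup>2 * y - z, \<omega>\<^sup>2 / 9 * c + h u)" c' "(- \<omega>\<^sup>2 * y' - z', \<omega>\<^sup>2 / 9 * c' + h u')"]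
        dist_Pair_le[of "- \<omega>\<^sup>2 * y - z" "\<omega>\<^sup>2 / 9 * c + h u" "- \<omega>\<^sup>2 * y' - z'" "\<omega>\<^sup>2 / 9 * c' + h u'"]
      by linarith
    also have "dist (- \<omega>\<^sup>2 * y - z) (- \<omega>\<^sup>2 * y' - z') \<le> \<omega>\<^sup>2 * dist y y' + dist z z'"
    proof -
      have "(- \<omega>\<^sup>2 * y - z) - (- \<omega>\<^sup>2 * y' - z') = - (\<omega>\<^sup>2 * (y - y')) - (z - z')"
        by (simp add: algebra_simps)
      then show ?thesis
        unfolding dist_real_def using abs_triangle_ineq4[of "- (\<omega>\<^sup>2 * (y - y'))" "z - z'"]
        by (simp add: abs_mult)
    qed
    also have "dist (\<omega>\<^sup>2 / 9 * c + h u) (\<omega>\<^sup>2 / 9 * c' + h u') \<le> \<omega>\<^sup>2 / 9 * dist c c' + \<Lambda> * dist u u'"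
    proof -
      have "(\<omega>\<^sup>2 / 9 * c + h u) - (\<omega>\<^sup>2 / 9 * c' + h u') = \<omega>\<^sup>2 / 9 * (c - c') + (h u - h u')"
        by (simp add: field_simps)
      then show ?thesis
        using abs_triangle_ineq[of "\<omega>\<^sup>2 / 9 * (c - c')" "h u - h u'"] lipschitz_onD[OF h, of u u']
        by (simp add: abs_mult dist_real_def)
    qed
    also have "\<omega>\<^sup>2 * dist y y' \<le> \<omega>\<^sup>2 * dist p p'" using comp by (intro mult_left_mono) auto
    also have "\<omega>\<^sup>2 / 9 * dist c c' \<le> \<omega>\<^sup>2 / 9 * dist p p'" using comp by (intro mult_left_mono) auto
    also have "\<Lambda> * dist u u' \<le> \<Lambda> * dist p p'" using comp \<Lambda> by (intro mult_left_mono) auto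
    finally show "dist (\<Phi> p) (\<Phi> p') \<le> (1 + 1 + (\<omega>\<^sup>2 + 1) + (\<omega>\<^sup>2 / 9 + \<Lambda>)) * dist p p'"
      using comp unfolding distrib_right mult_1 by linarith
  qed
  have init_cont: "continuous_on {a..b} (\<lambda>\<alpha>. (\<alpha>, 0::real, - s, 0::real))"
    by (intro continuous_intros)
  obtain Y where cY: "continuous_on ({a..b} \<times> {0..X}) (\<lambda>(\<alpha>, x). Y \<alpha> x)"
    and Y0: "\<And>\<alpha>. \<alpha> \<in> {a..b} \<Longrightarrow> Y \<alpha> 0 = (\<alpha>, 0, - s, 0)"
    and Y': "\<And>\<alpha> x. \<alpha> \<in> {a..b} \<Longrightarrow> x \<in> {0..X} \<Longrightarrow>
      (Y \<alpha> has_vector_derivative \<Phi> (Y \<alpha> x)) (at x within {0..X})"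
    by (rule ode_family[OF lip init_cont ab less_imp_le[OF X]]) (rule that; assumption)
  define u y c z where "u \<alpha> x = fst (Y \<alpha> x)" and "y \<alpha> x = fst (snd (Y \<alpha> x))"
    and "c \<alpha> x = fst (snd (snd (Y \<alpha> x)))" and "z \<alpha> x = snd (snd (snd (Y \<alpha> x)))" for \<alpha> x
  note cY' = cY[unfolded case_prod_unfold]
  have cont: "continuous_on ({a..b} \<times> {0..X}) (\<lambda>(\<alpha>, x). y \<alpha> x)"
    "continuous_on ({a..b} \<times> {0..X}) (\<lambda>(\<alpha>, x). c \<alpha> x)"
    "continuous_on ({a..b} \<times> {0..X}) (\<lambda>(\<alpha>, x). z \<alpha> x)"
    unfolding y_def c_def z_def case_prod_unfold by (intro continuous_intros cY')+
  have traj: "trajectory (u \<alpha>) (y \<alpha>) (c \<alpha>) (z \<alpha>) (\<lambda>t. h (u \<alpha> t)) \<omega> s" if \<alpha>: "\<alpha> \<in> {a..b}" for \<alpha>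
  proof
    fix t assume "t \<in> {0..4 / \<omega>}"
    then have t: "t \<in> {0..X}" by (simp add: X_def)
    note D = Y'[OF \<alpha> t]
    have \<Phi>: "\<Phi> (Y \<alpha> t) = (y \<alpha> t, c \<alpha> t, - \<omega>\<^sup>2 * y \<alpha> t - z \<alpha> t, \<omega>\<^sup>2 / 9 * c \<alpha> t + h (u \<alpha> t))"
      by (simp add: \<Phi>_def u_def y_def c_def z_def case_prod_unfold)
    have f: "((\<lambda>x. fst (g x)) has_vector_derivative fst g') F" and
      sd: "((\<lambda>x. snd (g x)) has_vector_derivative snd g') F"
      if "(g has_vector_derivative g') F" for g :: "real \<Rightarrow> 'c::real_normed_vector \<times> 'd::real_normed_vector" and g' F
      using bounded_linear.has_vector_derivative[OF bounded_linear_fst that]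
        bounded_linear.has_vector_derivative[OF bounded_linear_snd that] by auto
    show "(u \<alpha> has_real_derivative y \<alpha> t) (at t within {0..4 / \<omega>})"
      using f[OF D] by (simp add: \<Phi> X_def u_def[abs_def] has_real_derivative_iff_has_vector_derivative)
    show "(y \<alpha> has_real_derivative c \<alpha> t) (at t within {0..4 / \<omega>})"
      using f[OF sd[OF D]] by (simp add: \<Phi> X_def y_def[abs_def] has_real_derivative_iff_has_vector_derivative)
    show "(c \<alpha> has_real_derivative - \<omega>\<^sup>2 * y \<alpha> t - z \<alpha> t) (at t within {0..4 / \<omega>})"
      using f[OF sd[OF sd[OF D]]] by (simp add: \<Phi> X_def c_def[abs_def] has_real_derivative_iff_has_vector_derivative)
    show "(z \<alpha> has_real_derivative \<omega>\<^sup>2 / 9 * c \<alpha> t + h (u \<alpha> t)) (at t within {0..4 / \<omega>})"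
      using sd[OF sd[OF sd[OF D]]] by (simp add: \<Phi> X_def z_def[abs_def] has_real_derivative_iff_has_vector_derivative)
  next
    show "y \<alpha> 0 = 0" "c \<alpha> 0 = - s" "z \<alpha> 0 = 0"
      using Y0[OF \<alpha>] by (auto simp: y_def c_def z_def)
  qed (unfold \<omega>4, rule om(1), rule s, rule slope)
  have u0: "u \<alpha> 0 = \<alpha>" if "\<alpha> \<in> {a..b}" for \<alpha>
    using Y0[OF that] by (simp add: u_def)
  \<comment> \<open>\<open>x\<close> is a return time of the shot: by \<open>Pprops\<close> it is
    the first positive zero of \<open>y\<close>. There \<open>z\<close> is minus the third
    derivative, so the target is \<open>z \<alpha> x = 0\<close>.\<close>
  define P where "P \<alpha> x \<longleftrightarrow> x \<in> {0<..X} \<and> (\<forall>t\<in>{0..x}. y \<alpha> t \<le> 0) \<and> y \<alpha> x = 0 \<and> z \<alpha> x \<le> 0" for \<alpha> x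
  have Pprops: "x \<le> pi / \<omega>" "c \<alpha> x > 0" "\<And>t. 0 < t \<Longrightarrow> t < x \<Longrightarrow> y \<alpha> t < 0"
    "\<And>t. t \<in> {0..x} \<Longrightarrow> u \<alpha> t \<in> {\<alpha> - r..\<alpha>}" if \<alpha>: "\<alpha> \<in> {a..b}" and P: "P \<alpha> x" for \<alpha> x
  proof -
    interpret trajectory "u \<alpha>" "y \<alpha>" "c \<alpha>" "z \<alpha>" "\<lambda>t. h (u \<alpha> t)" \<omega> s by (rule traj[OF \<alpha>])
    have x: "0 < x" "x \<le> 4 / \<omega>" and yle: "\<And>t. t \<in> {0..x} \<Longrightarrow> y \<alpha> t \<le> 0" and "y \<alpha> x = 0" "z \<alpha> x \<le> 0"
      using P by (auto simp: P_def X_def)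
    note props = zero_props[OF x yle \<open>y \<alpha> x = 0\<close> \<open>z \<alpha> x \<le> 0\<close>]
    show "x \<le> pi / \<omega>" by (rule props(1))
    show "c \<alpha> x > 0" by (rule props(2))
    show "y \<alpha> t < 0" if "0 < t" "t < x" for t using props(3) that by blast
    fix t assume t: "t \<in> {0..x}"
    have "u \<alpha> 0 - s / \<omega> * t \<le> u \<alpha> t"
      using t x props(4) by (intro u_bound) auto
    moreover have "s / \<omega> * t \<le> s / \<omega> * (4 / \<omega>)"
      using t x \<omega> s by (intro mult_left_mono) auto
    moreover have "s / \<omega> * (4 / \<omega>) = r" using \<omega> by (simp add: s_def field_simps power2_eq_square)
    moreover have "u \<alpha> t \<le> u \<alpha> 0" using t x by (intro u_decreasing[OF x(2) yle]) auto
    ultimately show "u \<alpha> t \<in> {\<alpha> - r..\<alpha>}" using u0[OF \<alpha>] by auto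
  qed
  show ?thesis
  proof (cases "\<exists>\<alpha>\<in>{a..b}. \<exists>x. P \<alpha> x \<and> z \<alpha> x = 0")
    case True
    then obtain \<alpha> L where \<alpha>: "\<alpha> \<in> {a..b}" and P: "P \<alpha> L" and zL: "z \<alpha> L = 0" by blast
    interpret trajectory "u \<alpha>" "y \<alpha>" "c \<alpha>" "z \<alpha>" "\<lambda>t. h (u \<alpha> t)" \<omega> s by (rule traj[OF \<alpha>])
    have L: "L > 0" "L \<le> 4 / \<omega>" "y \<alpha> L = 0" using P by (auto simp: P_def X_def)
    have sub: "(g has_real_derivative D) (at t within {0..L})"
      if "(g has_real_derivative D) (at t within {0..4 / \<omega>})" for g D t
      using that L by (rule_tac has_field_derivative_subset) auto
    have mem: "t \<in> {0..4 / \<omega>}" if "t \<in> {0..L}" for t using that L by auto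
    show ?thesis
    proof (rule that[of L "u \<alpha>" "y \<alpha>" "c \<alpha>" "\<lambda>t. - \<omega>\<^sup>2 * y \<alpha> t - z \<alpha> t"])
      show "((\<lambda>t. - \<omega>\<^sup>2 * y \<alpha> t - z \<alpha> t) has_real_derivative - (q * c \<alpha> t + h (u \<alpha> t)))
          (at t within {0..L})" if "t \<in> {0..L}" for t
        using mem[OF that] om(2)
        by (intro sub) (auto intro!: derivative_eq_intros y' z' simp: algebra_simps)
      show "u \<alpha> t \<in> {a - r..b}" if "t \<in> {0..L}" for t
        using Pprops(4)[OF \<alpha> P that] \<alpha> by auto
    qed (use L zL init s mem u' y' c' sub in auto)
  next
    case False
    define S where "S = {\<alpha> \<in> {a..b}. \<exists>x. P \<alpha> x}"
    \<comment> \<open>A lower bound for the return times, uniform in the height: \<open>c\<close>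
      starts at \<open>- s\<close> and is uniformly continuous. It prevents zeros from collapsing to
      0 in the limits below.\<close>
    obtain \<xi> where \<xi>: "0 < \<xi>" "\<xi> \<le> X" "\<And>\<alpha> t. \<alpha> \<in> {a..b} \<Longrightarrow> 0 < t \<Longrightarrow> t \<le> \<xi> \<Longrightarrow> y \<alpha> t < 0"
    proof -
      have "uniformly_continuous_on ({a..b} \<times> {0..X}) (\<lambda>(\<alpha>, x). c \<alpha> x)"
        by (intro compact_uniformly_continuous cont compact_Times compact_Icc)
      then obtain d where d: "d > 0" "\<And>p p'. p \<in> {a..b} \<times> {0..X} \<Longrightarrow> p' \<in> {a..b} \<times> {0..X} \<Longrightarrow>
          dist p' p < d \<Longrightarrow> dist ((\<lambda>(\<alpha>, x). c \<alpha> x) p') ((\<lambda>(\<alpha>, x). c \<alpha> x) p) < s / 2"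
        unfolding uniformly_continuous_on_def using s by (meson half_gt_zero)
      define \<xi> where "\<xi> = min (d / 2) X"
      have "y \<alpha> t < 0" if \<alpha>: "\<alpha> \<in> {a..b}" and t: "0 < t" "t \<le> \<xi>" for \<alpha> t
      proof -
        interpret trajectory "u \<alpha>" "y \<alpha>" "c \<alpha>" "z \<alpha>" "\<lambda>t. h (u \<alpha> t)" \<omega> s by (rule traj[OF \<alpha>])
        have "0 \<le> - c \<alpha> t' - s / 2" if "0 < t'" "t' < t" for t'
        proof -
          have "dist (\<alpha>, t') (\<alpha>, 0::real) < d"
            using that t d(1) by (auto simp: dist_Pair_Pair \<xi>_def min_def split: if_splits)
          then have "dist (c \<alpha> t') (c \<alpha> 0) < s / 2"
            using d(2)[of "(\<alpha>, 0)" "(\<alpha>, t')"] \<alpha> that t X by (auto simp: \<xi>_def)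
          then show ?thesis using init unfolding dist_real_def by linarith
        qed
        then have "- y \<alpha> 0 - s / 2 * 0 \<le> - y \<alpha> t - s / 2 * t"
          using t by (intro nondecreasing_within[of 0 t "{0..4 / \<omega>}" "\<lambda>t. - y \<alpha> t - s / 2 * t" "\<lambda>t. - c \<alpha> t - s / 2"])
            (auto intro!: derivative_eq_intros y' simp: \<xi>_def X_def)
        moreover have "s / 2 * t > 0" using s t by simp
        ultimately show ?thesis using init by simp
      qed
      moreover have "0 < \<xi>" "\<xi> \<le> X" using d X by (auto simp: \<xi>_def)
      ultimately show ?thesis by (rule_tac that)
    qed
    have piX: "pi / \<omega> < X"
      unfolding X_def using \<omega> pi_less_4 by (simp add: divide_strict_right_mono)
    have Pxi: "\<xi> < x" if "\<alpha> \<in> {a..b}" "P \<alpha> x" for \<alpha> x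
      using \<xi>(3)[OF that(1), of x] that(2) by (force simp: P_def)
    \<comment> \<open>Return times stay in a compact interval away from 0, so a subsequence
      converges, and the nonstrict conditions in \<open>P\<close> survive the limit.\<close>
    have "closed S"
      unfolding closed_sequential_limits
    proof (intro allI impI)
      fix \<alpha> :: "nat \<Rightarrow> real" and \<alpha>0
      assume "(\<forall>n. \<alpha> n \<in> S) \<and> \<alpha> \<longlonglongrightarrow> \<alpha>0"
      then have \<alpha>: "\<And>n. \<alpha> n \<in> {a..b}" "\<And>n. \<exists>x. P (\<alpha> n) x" and lim: "\<alpha> \<longlonglongrightarrow> \<alpha>0"
        by (auto simp: S_def)
      then obtain x where x: "\<And>n. P (\<alpha> n) (x n)" by metis
      have \<alpha>0: "\<alpha>0 \<in> {a..b}"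
        using closed_sequentially[OF closed_atLeastAtMost _ lim] \<alpha> by blast
      have xX: "x n \<in> {\<xi>..X}" for n using Pxi[OF \<alpha>(1)[of n] x[of n]] x[of n] by (force simp: P_def)
      obtain x0 r where r: "x0 \<in> {\<xi>..X}" "strict_mono (r :: nat \<Rightarrow> nat)" "(x \<circ> r) \<longlonglongrightarrow> x0"
        using compact_Icc[of \<xi> X, unfolded compact_def] xX by blast
      have lim': "(\<lambda>n. \<alpha> (r n)) \<longlonglongrightarrow> \<alpha>0" using LIMSEQ_subseq_LIMSEQ[OF lim r(2)] by (simp add: o_def)
      have lx: "(\<lambda>n. x (r n)) \<longlonglongrightarrow> x0" using r(3) by (simp add: o_def)
      have xm: "x n \<in> {0..X}" "x0 \<in> {0..X}" for n using xX[of n] r(1) \<xi>(1) by auto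
      note L = joint_limit[OF _ lim' _ \<alpha>(1) _ \<alpha>0]
      have yx: "(\<lambda>n. y (\<alpha> (r n)) (x (r n))) \<longlonglongrightarrow> y \<alpha>0 x0"
        and zx: "(\<lambda>n. z (\<alpha> (r n)) (x (r n))) \<longlonglongrightarrow> z \<alpha>0 x0"
        using L[OF cont(1) lx xm] L[OF cont(3) lx xm] by auto
      have "y \<alpha>0 x0 = 0"
        using LIMSEQ_unique[OF yx] x by (simp add: P_def)
      moreover have "z \<alpha>0 x0 \<le> 0"
        using LIMSEQ_le_const2[OF zx] x by (auto simp: P_def)
      moreover have "y \<alpha>0 t \<le> 0" if t: "t \<in> {0..x0}" for t
      proof (cases "t = x0")
        case False
        then have "\<forall>\<^sub>F n in sequentially. t < x (r n)"
          using order_tendstoD(1)[OF lx, of t] t by auto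
        then have "\<forall>\<^sub>F n in sequentially. y (\<alpha> (r n)) t \<le> 0"
          using x t by (auto simp: P_def elim!: eventually_mono)
        moreover have "(\<lambda>n. y (\<alpha> (r n)) t) \<longlonglongrightarrow> y \<alpha>0 t"
          using t xm by (intro L[OF cont(1)]) auto
        ultimately show ?thesis
          by (meson eventually_sequentially LIMSEQ_le_const2)
      qed (use \<open>y \<alpha>0 x0 = 0\<close> in simp)
      ultimately have "P \<alpha>0 x0" using r(1) \<xi>(1) by (auto simp: P_def)
      then show "\<alpha>0 \<in> S" using \<alpha>0 by (auto simp: S_def)
    qed
    \<comment> \<open>If the limit height did return, with \<open>z < 0\<close> as
      \<open>z = 0\<close> is excluded here, then \<open>y\<close> would be positive just after
      \<open>x0\<close>. The nearby shots would become positive too, and their first zeros, having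
      \<open>z > 0\<close>, would accumulate at a zero \<open>x1\<close> of the limit shot with
      \<open>z \<ge> 0\<close>. But \<open>x0\<close> is its only zero in that range.\<close>
    moreover have "closed ({a..b} - S)"
      unfolding closed_sequential_limits
    proof (intro allI impI)
      fix \<alpha> :: "nat \<Rightarrow> real" and \<alpha>0
      assume "(\<forall>n. \<alpha> n \<in> {a..b} - S) \<and> \<alpha> \<longlonglongrightarrow> \<alpha>0"
      then have \<alpha>: "\<And>n. \<alpha> n \<in> {a..b}" "\<And>n x. \<not> P (\<alpha> n) x" and lim: "\<alpha> \<longlonglongrightarrow> \<alpha>0"
        by (auto simp: S_def)
      have \<alpha>0: "\<alpha>0 \<in> {a..b}"
        using closed_sequentially[OF closed_atLeastAtMost _ lim] \<alpha>(1) by blast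
      have "\<not> P \<alpha>0 x0" for x0
      proof
        assume P: "P \<alpha>0 x0"
        interpret trajectory "u \<alpha>0" "y \<alpha>0" "c \<alpha>0" "z \<alpha>0" "\<lambda>t. h (u \<alpha>0 t)" \<omega> s by (rule traj[OF \<alpha>0])
        note props = Pprops(1-3)[OF \<alpha>0 P]
        have x0: "\<xi> < x0" "x0 < X" "y \<alpha>0 x0 = 0" "z \<alpha>0 x0 < 0"
        proof -
          have "z \<alpha>0 x0 \<noteq> 0" using False \<alpha>0 P by blast
          then show "\<xi> < x0" "x0 < X" "y \<alpha>0 x0 = 0" "z \<alpha>0 x0 < 0"
            using Pxi[OF \<alpha>0 P] props(1) piX P by (auto simp: P_def)
        qed
        have "(y \<alpha>0 has_real_derivative c \<alpha>0 x0) (at x0)"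
        proof -
          have "(y \<alpha>0 has_real_derivative c \<alpha>0 x0) (at x0 within {0<..<X})"
            using x0 \<xi> by (intro has_field_derivative_subset[OF y']) (auto simp: X_def)
          then show ?thesis using x0 \<xi> by (simp add: at_within_open[of x0 "{0<..<X}"])
        qed
        from DERIV_pos_inc_right[OF this props(2)] obtain d where
          d: "d > 0" "\<And>e. 0 < e \<Longrightarrow> e < d \<Longrightarrow> 0 < y \<alpha>0 (x0 + e)"
          using x0(3) by auto
        define \<delta> where "\<delta> = min (d / 2) (X - x0)"
        have \<delta>: "0 < \<delta>" "\<delta> < d" "x0 + \<delta> \<le> X" using d(1) x0 by (auto simp: \<delta>_def)
        have y\<delta>: "(\<lambda>n. y (\<alpha> n) (x0 + \<delta>)) \<longlonglongrightarrow> y \<alpha>0 (x0 + \<delta>)"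
          using \<delta> x0 \<xi> by (intro joint_limit[OF cont(1) lim _ \<alpha>(1) _ \<alpha>0]) auto
        then obtain N where N: "\<And>n. n \<ge> N \<Longrightarrow> 0 < y (\<alpha> n) (x0 + \<delta>)"
          using order_tendstoD(1)[OF y\<delta>, of 0] d(2)[OF \<delta>(1,2)] by (auto simp: eventually_sequentially)
        have "\<exists>x\<in>{\<xi>..x0 + \<delta>}. y (\<alpha> (n + N)) x = 0 \<and> 0 < z (\<alpha> (n + N)) x" for n
        proof -
          define \<beta> where "\<beta> = \<alpha> (n + N)"
          have \<beta>: "\<beta> \<in> {a..b}" using \<alpha> by (simp add: \<beta>_def)
          have "continuous_on {0..x0 + \<delta>} (y \<beta>)"
            using continuous_on_slice[OF cont(1) \<beta>] \<delta> by (auto intro: continuous_on_subset)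
          then obtain x where x: "\<xi> \<le> x" "x \<le> x0 + \<delta>" "y \<beta> x = 0" "\<And>t. t \<in> {0..x} \<Longrightarrow> y \<beta> t \<le> 0"
          proof (rule first_zero)
            show "0 \<le> y \<beta> (x0 + \<delta>)" using N[of "n + N"] by (simp add: \<beta>_def)
            show "y \<beta> 0 = 0" using trajectory.init(1)[OF traj[OF \<beta>]] .
            show "\<xi> \<le> x0 + \<delta>" using x0 \<delta> by simp
          qed (use \<xi> \<beta> in auto)
          moreover have "\<not> P \<beta> x" using \<alpha> by (simp add: \<beta>_def)
          ultimately show ?thesis
            using \<xi>(1) \<delta> unfolding P_def \<beta>_def[symmetric] by (intro bexI[of _ x]) auto
        qed
        then obtain x where x: "\<And>n. x n \<in> {\<xi>..x0 + \<delta>}" "\<And>n. y (\<alpha> (n + N)) (x n) = 0"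
          "\<And>n. 0 < z (\<alpha> (n + N)) (x n)" by metis
        obtain x1 r where r: "x1 \<in> {\<xi>..x0 + \<delta>}" "strict_mono (r :: nat \<Rightarrow> nat)" "(x \<circ> r) \<longlonglongrightarrow> x1"
          using compact_Icc[of \<xi> "x0 + \<delta>", unfolded compact_def] x(1) by blast
        have lim': "(\<lambda>n. \<alpha> (r n + N)) \<longlonglongrightarrow> \<alpha>0"
          using LIMSEQ_subseq_LIMSEQ[OF LIMSEQ_ignore_initial_segment[OF lim] r(2)] by (simp add: o_def)
        have lx: "(\<lambda>n. x (r n)) \<longlonglongrightarrow> x1" using r(3) by (simp add: o_def)
        have xm: "x n \<in> {0..X}" "x1 \<in> {0..X}" for n using x(1)[of n] r(1) \<xi>(1) \<delta> by auto
        have yx: "(\<lambda>n. y (\<alpha> (r n + N)) (x (r n))) \<longlonglongrightarrow> y \<alpha>0 x1"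
          and zx: "(\<lambda>n. z (\<alpha> (r n + N)) (x (r n))) \<longlonglongrightarrow> z \<alpha>0 x1"
          using joint_limit[OF cont(1) lim' lx \<alpha>(1) xm(1) \<alpha>0 xm(2)]
            joint_limit[OF cont(3) lim' lx \<alpha>(1) xm(1) \<alpha>0 xm(2)] by auto
        have "y \<alpha>0 x1 = 0"
          using LIMSEQ_unique[OF yx] x(2) by simp
        moreover have "0 \<le> z \<alpha>0 x1"
          using LIMSEQ_le_const[OF zx] x(3) by (auto intro: less_imp_le)
        moreover have "x1 \<noteq> x0" using x0(4) \<open>0 \<le> z \<alpha>0 x1\<close> by auto
        moreover have "y \<alpha>0 x1 < 0" if "x1 < x0" using props(3)[of x1] that r(1) \<xi>(1) by auto
        moreover have "0 < y \<alpha>0 x1" if "x0 < x1" using d(2)[of "x1 - x0"] that r(1) \<delta> by auto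
        ultimately show False by (cases x1 x0 rule: linorder_cases) auto
      qed
      then show "\<alpha>0 \<in> {a..b} - S" using \<alpha>0 by (auto simp: S_def)
    qed
    \<comment> \<open>While \<open>u\<close> stays above \<open>b - r\<close> the force is
      nonpositive, so \<open>k\<close>, which is -(u''' + q u'), is nonpositive, that is y'' + q y
      \<ge> 0. Comparison with frequency sqrt(q) forces a zero by time \<open>pi / \<kappa>\<close>,
      and \<open>z = k \<le> 0\<close> there.\<close>
    moreover have "b \<in> S"
    proof -
      have b: "b \<in> {a..b}" using ab by simp
      interpret trajectory "u b" "y b" "c b" "z b" "\<lambda>t. h (u b t)" \<omega> s by (rule traj[OF b])
      define \<kappa> where "\<kappa> = sqrt q"
      have \<kappa>: "\<kappa> > 0" "\<kappa>\<^sup>2 = q" using q by (auto simp: \<kappa>_def)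
      have "\<omega> \<le> \<kappa>" unfolding \<omega>_def \<kappa>_def using q by (intro real_sqrt_le_mono) auto
      then have \<kappa>X: "pi / \<kappa> < X"
        using piX \<omega> \<kappa> by (smt (verit) frac_le pi_gt_zero)
      define k where "k t = z b t - \<omega>\<^sup>2 / 9 * y b t" for t
      have k': "(k has_real_derivative h (u b t)) (at t within {0..4 / \<omega>})" if "t \<in> {0..4 / \<omega>}" for t
        unfolding k_def using that by (auto intro!: derivative_eq_intros z' y')
      have low: "- s * sin (\<kappa> * x) \<le> \<kappa> * y b x" and yx: "- s / \<kappa> \<le> y b x"
        if x: "0 \<le> x" "x \<le> pi / \<kappa>" and ub: "\<And>t. 0 \<le> t \<Longrightarrow> t < x \<Longrightarrow> b - r \<le> u b t" for x
      proof -
        have k0: "k t \<le> 0" if "0 \<le> t" "t < x" for t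
        proof -
          have "- k 0 \<le> - k t"
            using that x \<kappa>X hb ub by (intro nondecreasing_within[of 0 t "{0..4 / \<omega>}" "\<lambda>t. - k t" "\<lambda>t. - h (u b t)"])
              (auto intro!: derivative_eq_intros k' simp: X_def)
          then show ?thesis by (simp add: k_def init)
        qed
        show "- s * sin (\<kappa> * x) \<le> \<kappa> * y b x"
        proof (rule oscillator_lower_bound[OF \<kappa>(1) x _ y' c' _ init(1,2)])
          fix t assume "0 < t" "t < x"
          then have "0 \<le> - k t" using k0[of t] by simp
          also have "\<dots> = - \<omega>\<^sup>2 * y b t - z b t + (\<omega>\<^sup>2 + \<omega>\<^sup>2 / 9) * y b t"
            by (simp add: k_def algebra_simps)
          also have "\<omega>\<^sup>2 + \<omega>\<^sup>2 / 9 = \<kappa>\<^sup>2" using om(2) \<kappa>(2) by simp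
          finally show "0 \<le> - \<omega>\<^sup>2 * y b t - z b t + \<kappa>\<^sup>2 * y b t" .
        qed (use x \<kappa>X in \<open>auto simp: X_def\<close>)
        moreover have "- s \<le> - s * sin (\<kappa> * x)" using s by simp
        ultimately have "- s \<le> \<kappa> * y b x" by linarith
        then show "- s / \<kappa> \<le> y b x" using \<kappa> by (simp add: field_simps)
      qed
      have ub: "b - r \<le> u b t" if t: "0 \<le> t" "t \<le> pi / \<kappa>" for t
      proof (rule ccontr)
        assume neg: "\<not> b - r \<le> u b t"
        define Z where "Z = {x \<in> {0..t}. u b x \<le> b - r}"
        have "continuous_on {0..4 / \<omega>} (u b)" by (rule DERIV_continuous_on[OF u'])
        then have "continuous_on {0..t} (u b)"
          using t \<kappa>X by (auto intro: continuous_on_subset simp: X_def)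
        then have "closed Z"
          unfolding Z_def using closed_vimage_Int[of "{..b - r}" "{0..t}" "u b"]
          by (simp add: continuous_on_closed_vimage Int_def vimage_def conj_commute)
        moreover have "Z \<noteq> {}" "bdd_below Z" using neg t by (auto simp: Z_def)
        ultimately have x: "Inf Z \<in> Z" by (intro closed_contains_Inf)
        have before: "b - r \<le> u b x" if "0 \<le> x" "x < Inf Z" for x
        proof (rule ccontr)
          assume "\<not> b - r \<le> u b x"
          then have "Inf Z \<le> x"
            using that x by (intro cInf_lower \<open>bdd_below Z\<close>) (auto simp: Z_def)
          with that show False by simp
        qed
        have I: "0 \<le> Inf Z" "Inf Z \<le> t" "u b (Inf Z) \<le> b - r" using x by (auto simp: Z_def)
        have "u b 0 - s / \<kappa> * Inf Z \<le> u b (Inf Z)"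
        proof (rule u_bound)
          fix t' assume "t' \<in> {0..Inf Z}"
          then have "- s / \<kappa> \<le> y b t'" using I t before by (intro yx) auto
          then show "- (s / \<kappa>) \<le> y b t'" by simp
        qed (use I t \<kappa>X in \<open>auto simp: X_def\<close>)
        moreover have "s / \<kappa> * Inf Z \<le> s / \<kappa> * (pi / \<kappa>)"
          using I t s \<kappa> by (intro mult_left_mono) auto
        \<comment> \<open>The drop up to the half period is r times 9 pi / 40 < 1, so the trajectory
          cannot reach the level \<open>b - r\<close> and the assumption on the sign of the force is
          never left.\<close>
        moreover have "s / \<kappa> * (pi / \<kappa>) < r"
        proof -
          have "s / \<kappa> * (pi / \<kappa>) = s * pi / q" using \<kappa> by (simp add: power2_eq_square)
          also have "\<dots> = r * (9 / 40 * pi)" using q by (simp add: s_def om(2))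
          also have "\<dots> < r * 1" using r pi_less_4 by (intro mult_strict_left_mono) auto
          finally show ?thesis by simp
        qed
        ultimately show False using I(3) u0[OF b] by simp
      qed
      have "0 \<le> \<kappa> * y b (pi / \<kappa>)" using low[of "pi / \<kappa>"] ub \<kappa> by auto
      then have ypi: "0 \<le> y b (pi / \<kappa>)" using \<kappa> by (simp add: zero_le_mult_iff)
      then have \<xi>pi: "\<xi> \<le> pi / \<kappa>" using \<xi>(3)[OF b, of "pi / \<kappa>"] \<kappa> by force
      have "continuous_on {0..pi / \<kappa>} (y b)"
        using continuous_on_slice[OF cont(1) b] \<kappa>X by (auto intro: continuous_on_subset)
      then obtain x where x: "\<xi> \<le> x" "x \<le> pi / \<kappa>" "y b x = 0" "\<And>t. t \<in> {0..x} \<Longrightarrow> y b t \<le> 0"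
        using first_zero[OF _ \<xi>(1) \<xi>pi ypi init(1) \<xi>(3)[OF b]] by blast
      have "- k 0 \<le> - k x"
        using x \<xi> \<kappa>X hb ub by (intro nondecreasing_within[of 0 x "{0..4 / \<omega>}" "\<lambda>t. - k t" "\<lambda>t. - h (u b t)"])
          (auto intro!: derivative_eq_intros k' simp: X_def)
      then have "z b x \<le> 0" using x by (simp add: k_def init)
      then have "P b x" using x \<xi> \<kappa>X by (auto simp: P_def)
      then show ?thesis using b by (auto simp: S_def)
    qed
    \<comment> \<open>A returning shot stays in \<open>{a - r..a}\<close>, where the force is
      positive; then \<open>k\<close> increases strictly from 0 and
      \<open>z x = k x > 0\<close>.\<close>
    moreover have "a \<notin> S"
    proof
      assume "a \<in> S"
      then obtain x where a: "a \<in> {a..b}" and P: "P a x" by (auto simp: S_def)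
      interpret trajectory "u a" "y a" "c a" "z a" "\<lambda>t. h (u a t)" \<omega> s by (rule traj[OF a])
      have x: "0 < x" "x \<le> 4 / \<omega>" "y a x = 0" "z a x \<le> 0" using P by (auto simp: P_def X_def)
      have pos: "h (u a t) > 0" if "t \<in> {0..x}" for t
        using ha Pprops(4)[OF a P that] by auto
      define k where "k t = z a t - \<omega>\<^sup>2 / 9 * y a t" for t
      have k': "(k has_real_derivative h (u a t)) (at t within {0..4 / \<omega>})" if "t \<in> {0..4 / \<omega>}" for t
        unfolding k_def using that by (auto intro!: derivative_eq_intros z' y')
      have "k 0 < k x"
      proof (rule DERIV_pos_imp_increasing_open[OF x(1)])
        fix t assume t: "0 < t" "t < x"
        have "(k has_real_derivative h (u a t)) (at t within {0<..<x})"
          using t x by (intro has_field_derivative_subset[OF k']) auto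
        then have "(k has_real_derivative h (u a t)) (at t)"
          using t by (simp add: at_within_open[of t "{0<..<x}"])
        then show "\<exists>d. (k has_real_derivative d) (at t) \<and> 0 < d" using pos[of t] t by auto
      next
        show "continuous_on {0..x} k"
          using DERIV_continuous_on[OF k'] x(2) by (auto intro: continuous_on_subset)
      qed
      then show False using x by (simp add: k_def init)
    qed
    moreover have "S \<subseteq> {a..b}" by (auto simp: S_def)
    ultimately have "\<not> connected {a..b}"
      using ab unfolding connected_closed not_not
      by (intro exI[of _ S] exI[of _ "{a..b} - S"] conjI) auto
    then show ?thesis by simp
  qed
qed

text \<open>Freezing \<open>f\<close> outside \<open>{a..b}\<close> makes it globally Lipschitz; the
  slope there is 0, which is covered by \<open>\<eta> \<ge> 0\<close>.\<close>

lemma clamp_lipschitz_slope: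
  fixes f :: "real \<Rightarrow> real"
  assumes f': "\<And>t. (f has_real_derivative f' t) (at t)" and cont: "continuous_on UNIV f'" and "a \<le> b"
    and le: "\<And>t. t \<in> {a..b} \<Longrightarrow> f' t \<le> \<eta>" and "\<eta> \<ge> 0"
  defines "h \<equiv> \<lambda>t. f (max a (min b t))"
  shows "\<exists>\<Lambda>. \<Lambda>-lipschitz_on UNIV h" and "t' \<le> t \<Longrightarrow> h t - h t' \<le> \<eta> * (t - t')"
proof -
  define cl where "cl t = max a (min b t)" for t
  have cl: "cl t \<in> {a..b}" for t using \<open>a \<le> b\<close> by (auto simp: cl_def)
  have mvt: "\<exists>\<xi>\<in>{a..b}. h t - h t' = f' \<xi> * (cl t - cl t') \<and> 0 \<le> cl t - cl t' \<and> cl t - cl t' \<le> t - t'"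
    if "t' \<le> t" for t t'
  proof (cases "cl t' < cl t")
    case True
    then obtain \<xi> where "cl t' < \<xi>" "\<xi> < cl t" "f (cl t) - f (cl t') = (cl t - cl t') * f' \<xi>"
      using MVT2[OF True f'] by blast
    moreover have "cl t - cl t' \<le> t - t'" using that by (auto simp: cl_def)
    ultimately show ?thesis using cl[of t] cl[of t'] True
      by (intro bexI[of _ \<xi>]) (auto simp: h_def cl_def[symmetric])
  next
    case False
    moreover have "cl t' \<le> cl t" using that by (auto simp: cl_def)
    ultimately show ?thesis using that \<open>a \<le> b\<close> by (intro bexI[of _ a]) (auto simp: h_def cl_def)
  qed
  show "h t - h t' \<le> \<eta> * (t - t')" if t: "t' \<le> t" for t t'
  proof -
    obtain \<xi> where \<xi>: "\<xi> \<in> {a..b}" "h t - h t' = f' \<xi> * (cl t - cl t')"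
      "0 \<le> cl t - cl t'" "cl t - cl t' \<le> t - t'" using mvt[OF t] by blast
    have "h t - h t' \<le> \<eta> * (cl t - cl t')"
      unfolding \<xi>(2) using \<xi> le by (intro mult_right_mono) auto
    also have "\<dots> \<le> \<eta> * (t - t')" using \<xi> \<open>\<eta> \<ge> 0\<close> by (intro mult_left_mono) auto
    finally show ?thesis .
  qed
  have "bounded (f' ` {a..b})"
    by (intro compact_imp_bounded compact_continuous_image continuous_on_subset[OF cont]) auto
  then obtain \<Lambda> where \<Lambda>: "\<And>t. t \<in> {a..b} \<Longrightarrow> \<bar>f' t\<bar> \<le> \<Lambda>"
    by (fastforce simp: bounded_iff)
  then have \<Lambda>0: "0 \<le> \<Lambda>" using \<open>a \<le> b\<close> by (meson abs_ge_zero atLeastAtMost_iff order_refl order_trans)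
  have *: "\<bar>h t - h t'\<bar> \<le> \<Lambda> * \<bar>t - t'\<bar>" if t: "t' \<le> t" for t t'
  proof -
    obtain \<xi> where \<xi>: "\<xi> \<in> {a..b}" "h t - h t' = f' \<xi> * (cl t - cl t')"
      "0 \<le> cl t - cl t'" "cl t - cl t' \<le> t - t'" using mvt[OF t] by blast
    then show ?thesis using \<Lambda>[OF \<xi>(1)] \<Lambda>0 by (auto simp: abs_mult intro!: mult_mono)
  qed
  have "\<Lambda>-lipschitz_on UNIV h"
  proof (rule lipschitz_onI)
    show "dist (h t) (h t') \<le> \<Lambda> * dist t t'" for t t'
      using *[of t t'] *[of t' t] by (cases "t \<le> t'") (auto simp: dist_real_def abs_minus_commute)
  qed fact
  then show "\<exists>\<Lambda>. \<Lambda>-lipschitz_on UNIV h" by blast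
qed

lemma near_less:
  fixes f :: "real \<Rightarrow> real"
  assumes "isCont f a" "f a < k"
  obtains e where "e > 0" "\<And>t. dist t a < e \<Longrightarrow> f t < k"
proof -
  have "\<forall>\<^sub>F t in at a. f t < k"
    using order_tendstoD(2)[of f "f a" "at a" k] assms by (simp add: isCont_def)
  then obtain e where e: "e > 0" "\<And>t. t \<noteq> a \<Longrightarrow> dist t a < e \<Longrightarrow> f t < k"
    by (auto simp: eventually_at)
  show ?thesis
    by (rule that[OF e(1)]) (metis e(2) assms(2))
qed

text \<open>The crossing is \<open>m\<close>, the supremum of the points of \<open>{t1..t2}\<close>
  with \<open>f > 0\<close>. To its right \<open>f \<le> 0\<close>, which gives
  \<open>f m = 0\<close> and \<open>f' m \<le> 0\<close>, so \<open>f'\<close> is below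
  \<open>\<eta>\<close> nearby. On the left \<open>f\<close> need not be positive throughout, so
  \<open>a\<close> is picked among points of positivity accumulating at \<open>m\<close>.\<close>

lemma downcrossing:
  fixes f :: "real \<Rightarrow> real"
  assumes f': "\<And>t. (f has_real_derivative f' t) (at t)" and cont: "continuous_on UNIV f'"
    and "t1 < t2" "f t1 > 0" "f t2 < 0" "\<eta> > 0"
  obtains a b r where "a \<le> b" "r > 0" "\<And>t. t \<in> {a - r..b} \<Longrightarrow> f' t \<le> \<eta>"
    "\<And>t. t \<in> {a - r..a} \<Longrightarrow> f t > 0" "\<And>t. t \<in> {b - r..b} \<Longrightarrow> f t \<le> 0"
proof -
  have cf: "continuous (at t) f" for t using f' DERIV_isCont by blast
  define Z where "Z = {t \<in> {t1..t2}. f t > 0}"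
  define m where "m = Sup Z"
  have "t1 \<in> Z" using assms by (simp add: Z_def)
  then have Z: "Z \<noteq> {}" "bdd_above Z" by (auto simp: Z_def)
  have m_ge: "t \<le> m" if "t \<in> {t1..t2}" "f t > 0" for t
    unfolding m_def using that Z by (intro cSup_upper) (auto simp: Z_def)
  have m_le: "m \<le> t2" unfolding m_def using Z by (intro cSup_least) (auto simp: Z_def)
  have m1: "t1 \<le> m" using m_ge[of t1] assms by simp
  have near: "\<exists>t\<in>{m - e<..m}. t \<in> Z" if "e > 0" for e
    using less_cSup_iff[OF Z, of "m - e"] that Z cSup_upper[OF _ Z(2)] unfolding m_def[symmetric] by force
  have right: "f t \<le> 0" if "m < t" "t \<le> t2" for t
    using m_ge[of t] that m1 by force
  have "f m \<ge> 0"
  proof (rule ccontr)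
    assume "\<not> f m \<ge> 0"
    then obtain e where "e > 0" and e: "\<And>t. dist t m < e \<Longrightarrow> f t < 0"
      using near_less[OF cf[of m], of 0] by auto
    moreover obtain t where t: "t \<in> {m - e<..m}" "f t > 0"
      using near[OF \<open>e > 0\<close>] by (auto simp: Z_def)
    then have "dist t m < e" by (auto simp: dist_real_def)
    then have "f t < 0" by (rule e)
    ultimately show False using t by simp
  qed
  then have "m < t2" using m_le assms by (cases "m = t2") auto
  have "f m \<le> 0"
  proof (rule ccontr)
    assume "\<not> f m \<le> 0"
    then obtain e where e: "e > 0" "\<And>t. dist t m < e \<Longrightarrow> f t > 0"
      using near_less[OF isCont_minus[OF cf[of m]], of 0] by auto
    define t where "t = m + min (e / 2) (t2 - m)"
    have "m < t" "t \<le> t2" "dist t m < e" using e(1) \<open>m < t2\<close> by (auto simp: t_def dist_real_def)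
    then show False using right[of t] e(2)[of t] by simp
  qed
  with \<open>f m \<ge> 0\<close> have fm: "f m = 0" by simp
  have "f' m \<le> 0"
  proof (rule ccontr)
    assume "\<not> f' m \<le> 0"
    then obtain d where d: "d > 0" "\<And>e. 0 < e \<Longrightarrow> e < d \<Longrightarrow> f m < f (m + e)"
      using DERIV_pos_inc_right[OF f'[of m]] by auto
    define e where "e = min (d / 2) (t2 - m)"
    have "0 < e" "e < d" "m + e \<le> t2" using d(1) \<open>m < t2\<close> by (auto simp: e_def)
    then show False using d(2)[of e] right[of "m + e"] fm by simp
  qed
  then obtain \<epsilon> where \<epsilon>: "\<epsilon> > 0" "\<And>t. dist t m < \<epsilon> \<Longrightarrow> f' t < \<eta>"
    using near_less[of m f' \<eta>] cont \<open>\<eta> > 0\<close> by (auto simp: continuous_on_eq_continuous_at)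
  obtain a where a: "m - \<epsilon> / 2 < a" "a \<le> m" "f a > 0" using near[of "\<epsilon> / 2"] \<epsilon>(1) by (auto simp: Z_def)
  then obtain d where d: "d > 0" "\<And>t. dist t a < d \<Longrightarrow> f t > 0"
    using near_less[OF isCont_minus[OF cf[of a]], of 0] by auto
  define b where "b = m + min (\<epsilon> / 2) (t2 - m)"
  have b: "m < b" "b \<le> t2" "b < m + \<epsilon>" using \<epsilon>(1) \<open>m < t2\<close> by (auto simp: b_def min_def)
  define r where "r = min (min (d / 2) (\<epsilon> / 2)) ((b - m) / 2)"
  have r: "r > 0" "r < d" "r \<le> \<epsilon> / 2" "r < b - m" using \<epsilon>(1) d(1) b by (auto simp: r_def min_def)
  show ?thesis
  proof (rule that[of a b r])
    show "f' t \<le> \<eta>" if "t \<in> {a - r..b}" for t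
      using \<epsilon>(2)[of t] that a b r by (auto simp: dist_real_def abs_less_iff)
    show "f t > 0" if "t \<in> {a - r..a}" for t
      using d(2)[of t] that r by (auto simp: dist_real_def)
    show "f t \<le> 0" if "t \<in> {b - r..b}" for t
      using right[of t] that b r by auto
  qed (use a b r in auto)
qed

lemma solution_at_downcrossing:
  fixes F :: "real \<Rightarrow> real"
  assumes q: "q > 0" and f': "\<And>t. (deriv F has_real_derivative f' t) (at t)" and cont: "continuous_on UNIV f'"
    and t: "t1 < t2" "deriv F t1 > 0" "deriv F t2 < 0"
  shows "\<exists>u. is_solution q F u \<and> nontrivial u \<and> periodic u"
proof -
  have uniq: "D1 = D2" if "(g has_real_derivative D1) (at t within {0..L})"
    "(g has_real_derivative D2) (at t within {0..L})" "t \<in> {0..L}" "L > 0" for g D1 D2 t L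
    using that vector_derivative_unique_within_closed_interval[of 0 L t g D1 D2]
    by (simp add: has_real_derivative_iff_has_vector_derivative)
  have "9 / 100 * q\<^sup>2 > 0" using q by simp
  from downcrossing[OF f' cont t this] obtain a b r where
    ab: "a \<le> b" "r > 0" "\<And>t. t \<in> {a - r..b} \<Longrightarrow> f' t \<le> 9 / 100 * q\<^sup>2"
    "\<And>t. t \<in> {a - r..a} \<Longrightarrow> deriv F t > 0" "\<And>t. t \<in> {b - r..b} \<Longrightarrow> deriv F t \<le> 0" by blast
  define h where "h = (\<lambda>t. deriv F (max (a - r) (min b t)))"
  have arb: "a - r \<le> b" using ab by simp
  have h: "h t = deriv F t" if "t \<in> {a - r..b}" for t using that by (auto simp: h_def)
  note cls = clamp_lipschitz_slope[OF f' cont arb ab(3)]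
  obtain \<Lambda> where \<Lambda>: "\<Lambda>-lipschitz_on UNIV h" using cls(1) q unfolding h_def by auto
  have slope: "h t - h t' \<le> 9 / 100 * q\<^sup>2 * (t - t')" if "t' \<le> t" for t t'
    using cls(2)[OF _ _ that] q unfolding h_def by simp
  have ha: "h t > 0" if "a - r \<le> t" "t \<le> a" for t
    using ab(4)[of t] h[of t] that ab(1) by simp
  have hb: "h t \<le> 0" if "b - r \<le> t" for t
  proof -
    have "max (a - r) (min b t) \<in> {b - r..b}" using that ab(1,2) by auto
    then show ?thesis using ab(5) unfolding h_def by blast
  qed
  from shooting[OF q \<Lambda> slope ab(1,2) ha hb] obtain L u y c d where L: "L > 0"
    and D: "\<And>t. t \<in> {0..L} \<Longrightarrow> (u has_real_derivative y t) (at t within {0..L})"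
    "\<And>t. t \<in> {0..L} \<Longrightarrow> (y has_real_derivative c t) (at t within {0..L})"
    "\<And>t. t \<in> {0..L} \<Longrightarrow> (c has_real_derivative d t) (at t within {0..L})"
    "\<And>t. t \<in> {0..L} \<Longrightarrow> (d has_real_derivative - (q * c t + h (u t))) (at t within {0..L})"
    and bc: "y 0 = 0" "y L = 0" "d 0 = 0" "d L = 0" and "c 0 \<noteq> 0"
    and u: "\<And>t. t \<in> {0..L} \<Longrightarrow> u t \<in> {a - r..b}" by blast
  show ?thesis
  proof (rule solution_from_neumann[OF L _ D(1-3) _ bc])
    show "continuous_on UNIV (deriv F)" using f' by (auto intro: DERIV_continuous_on)
    show "(d has_real_derivative - (q * c t + deriv F (u t))) (at t within {0..L})" if "t \<in> {0..L}" for t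
      using D(4)[OF that] h[OF u[OF that]] by simp
    show "\<not> u constant_on {0..L}"
    proof
      assume "u constant_on {0..L}"
      then obtain k where k: "\<And>t. t \<in> {0..L} \<Longrightarrow> u t = k" by (auto simp: constant_on_def)
      have "y t = 0" if "t \<in> {0..L}" for t
      proof (rule uniq[OF D(1)[OF that] _ that L])
        show "(u has_real_derivative 0) (at t within {0..L})"
          by (rule has_field_derivative_transform_within[OF DERIV_const[of k] zero_less_one that]) (use k in auto)
      qed
      then have y0: "(y has_real_derivative 0) (at 0 within {0..L})"
        by (intro has_field_derivative_transform_within[OF DERIV_const zero_less_one]) (use L in auto)
      have 0: "0 \<in> {0..L}" using L by simp
      have "c 0 = 0" by (rule uniq[OF D(2)[OF 0] y0 0 L])
      then show False using \<open>c 0 \<noteq> 0\<close> by simp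
    qed
  qed
qed

section \<open>The functional on a Neumann interval\<close>

text \<open>Cauchy-Schwarz against the constant 1, from nonnegativity of the integral of (g - m)^2
  with \<open>m\<close> the mean.\<close>

lemma integral_square_le:
  fixes g :: "real \<Rightarrow> real"
  assumes "0 \<le> x" and g: "continuous_on {0..x} g"
  shows "(integral {0..x} g)\<^sup>2 \<le> x * integral {0..x} (\<lambda>t. (g t)\<^sup>2)"
proof (cases "x = 0")
  case False
  then have x: "x > 0" using assms by simp
  define m where "m = integral {0..x} g / x"
  have "0 \<le> integral {0..x} (\<lambda>t. (g t - m)\<^sup>2)"
    by (intro integral_nonneg integrable_continuous_real continuous_intros g) auto
  also have "\<dots> = integral {0..x} (\<lambda>t. (g t)\<^sup>2 - 2 * m * g t + m\<^sup>2)"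
    by (intro integral_cong) (simp add: power2_diff mult_ac)
  also have "\<dots> = integral {0..x} (\<lambda>t. (g t)\<^sup>2) - 2 * m * integral {0..x} g + m\<^sup>2 * x"
  proof -
    have "(\<lambda>t. (g t)\<^sup>2) integrable_on {0..x}" "(\<lambda>t. 2 * m * g t) integrable_on {0..x}"
      "(\<lambda>t. m\<^sup>2) integrable_on {0..x}"
      by (intro integrable_continuous_real continuous_intros g)+
    then show ?thesis
      using x by (subst integral_add integral_diff; (intro integrable_diff)?; simp)+
  qed
  also have "\<dots> = integral {0..x} (\<lambda>t. (g t)\<^sup>2) - (integral {0..x} g)\<^sup>2 / x"
    using x by (simp add: m_def power2_eq_square field_simps)
  finally show ?thesis using x by (simp add: field_simps)
qed simp

lemma integral_le_const:
  fixes g :: "real \<Rightarrow> real"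
  assumes "0 \<le> L" "continuous_on {0..L} g" "\<And>x. x \<in> {0..L} \<Longrightarrow> g x \<le> c"
  shows "integral {0..L} g \<le> L * c"
  using integral_le[of g "{0..L}" "\<lambda>_. c"] assms by (auto intro: integrable_continuous_real)

lemma const_le_integral:
  fixes g :: "real \<Rightarrow> real"
  assumes "0 \<le> L" "continuous_on {0..L} g" "\<And>x. x \<in> {0..L} \<Longrightarrow> c \<le> g x"
  shows "L * c \<le> integral {0..L} g"
  using integral_le[of "\<lambda>_. c" "{0..L}" g] assms by (auto intro: integrable_continuous_real)

type_synonym state = "(real \<Rightarrow> real) \<times> (real \<Rightarrow> real) \<times> (real \<Rightarrow> real)"

locale neumann =
  fixes L :: real
  assumes L: "L > 0"
begin

text \<open>The triple carries u, u', u'' explicitly, with one-sided derivatives at the ends and a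
  continuous second derivative. Only u' = 0 is imposed; u''' = 0 is the natural boundary condition
  and appears for critical points.\<close>

definition is_state :: "state \<Rightarrow> bool" where
  "is_state = (\<lambda>(u, v, p). (\<forall>x\<in>{0..L}. (u has_real_derivative v x) (at x within {0..L})) \<and>
    (\<forall>x\<in>{0..L}. (v has_real_derivative p x) (at x within {0..L})) \<and>
    continuous_on {0..L} p \<and> v 0 = 0 \<and> v L = 0)"

definition A :: "(real \<Rightarrow> real) \<Rightarrow> state \<Rightarrow> real" where
  "A F = (\<lambda>(u, v, p). integral {0..L} (\<lambda>x. (p x)\<^sup>2 / 2 + F (u x)))"

definition B :: "state \<Rightarrow> real" where
  "B = (\<lambda>(u, v, p). integral {0..L} (\<lambda>x. (v x)\<^sup>2 / 2))"

definition force1 :: "(real \<Rightarrow> real) \<Rightarrow> (real \<Rightarrow> real) \<Rightarrow> real \<Rightarrow> real" where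
  "force1 f u x = integral {0..x} (\<lambda>t. f (u t))"

definition force2 :: "(real \<Rightarrow> real) \<Rightarrow> (real \<Rightarrow> real) \<Rightarrow> real \<Rightarrow> real" where
  "force2 f u x = integral {0..x} (force1 f u)"

text \<open>Two integrations by parts write the derivative of \<open>A F - q B\<close> in a
  direction w with w' = 0 at both ends as the integral of \<open>residual\<close> times w'' plus
  \<open>force1 f u L\<close> times w(0).\<close>

definition residual :: "(real \<Rightarrow> real) \<Rightarrow> real \<Rightarrow> (real \<Rightarrow> real) \<Rightarrow> (real \<Rightarrow> real) \<Rightarrow> real \<Rightarrow> real" where
  "residual f q u p x = p x + q * u x + force2 f u x - force1 f u L * x"

text \<open>A direction has w'' of mean zero, so \<open>residual\<close> matters only modulo
  constants; subtracting the mean makes \<open>vdir\<close> vanish at \<open>L\<close>.\<close>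

definition pdir where
  "pdir f q u p x = residual f q u p x - integral {0..L} (residual f q u p) / L"

definition vdir where
  "vdir f q u p x = integral {0..x} (pdir f q u p)"

definition udir where
  "udir f q u p x = force1 f u L + integral {0..x} (vdir f q u p)"

text \<open>The squared norm of the gradient of \<open>A F - q B\<close> (with \<open>F' = f\<close>) for the inner product
  \<open>\<integral> u'' w'' + u(0) w(0)\<close>; the gradient itself is \<open>udir\<close>.\<close>

definition slope :: "(real \<Rightarrow> real) \<Rightarrow> real \<Rightarrow> state \<Rightarrow> real" where
  "slope f q = (\<lambda>(u, v, p). integral {0..L} (\<lambda>x. (pdir f q u p x)\<^sup>2) + (force1 f u L)\<^sup>2)"

definition step :: "(real \<Rightarrow> real) \<Rightarrow> real \<Rightarrow> real \<Rightarrow> state \<Rightarrow> state" where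
  "step f q \<eta> = (\<lambda>(u, v, p). (\<lambda>x. u x - \<eta> * udir f q u p x, \<lambda>x. v x - \<eta> * vdir f q u p x,
    \<lambda>x. p x - \<eta> * pdir f q u p x))"

lemma stateD:
  assumes "is_state (u, v, p)"
  shows "\<And>x. x \<in> {0..L} \<Longrightarrow> (u has_real_derivative v x) (at x within {0..L})"
    "\<And>x. x \<in> {0..L} \<Longrightarrow> (v has_real_derivative p x) (at x within {0..L})"
    "continuous_on {0..L} u" "continuous_on {0..L} v" "continuous_on {0..L} p" "v 0 = 0" "v L = 0"
  using assms by (auto simp: is_state_def intro: DERIV_continuous_on)

lemma integral_deriv:
  assumes "\<And>x. x \<in> {0..L} \<Longrightarrow> (g has_real_derivative d x) (at x within {0..L})" "x \<in> {0..L}"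
  shows "integral {0..x} d = g x - g 0"
proof (rule integral_unique, rule fundamental_theorem_of_calculus)
  show "(g has_vector_derivative d y) (at y within {0..x})" if "y \<in> {0..x}" for y
    using assms(1)[of y] that assms(2) unfolding has_real_derivative_iff_has_vector_derivative
    by (auto intro: has_vector_derivative_within_subset)
qed (use assms in auto)

lemma deriv_integral:
  fixes g :: "real \<Rightarrow> real"
  assumes "continuous_on {0..L} g"
  shows "\<And>x. x \<in> {0..L} \<Longrightarrow> ((\<lambda>x. integral {0..x} g) has_real_derivative g x) (at x within {0..L})"
    "continuous_on {0..L} (\<lambda>x. integral {0..x} g)"
proof -
  show D: "((\<lambda>x. integral {0..x} g) has_real_derivative g x) (at x within {0..L})" if "x \<in> {0..L}" for x
    using integral_has_real_derivative[OF assms that] .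
  then show "continuous_on {0..L} (\<lambda>x. integral {0..x} g)" by (rule DERIV_continuous_on)
qed

lemma state_bounds:
  assumes z: "is_state (u, v, p)"
  defines "k \<equiv> sqrt (L * integral {0..L} (\<lambda>x. (p x)\<^sup>2))"
  shows "x \<in> {0..L} \<Longrightarrow> \<bar>v x\<bar> \<le> k" "x \<in> {0..L} \<Longrightarrow> y \<in> {0..L} \<Longrightarrow> \<bar>u x - u y\<bar> \<le> k * \<bar>x - y\<bar>"
proof -
  note zD = stateD[OF z]
  have ip: "0 \<le> integral {0..L} (\<lambda>x. (p x)\<^sup>2)"
    by (intro integral_nonneg integrable_continuous_real continuous_intros zD) auto
  show v: "\<bar>v x\<bar> \<le> k" if x: "x \<in> {0..L}" for x
  proof -
    have p: "continuous_on {0..x} p" using zD(5) x by (auto intro: continuous_on_subset)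
    have "v x = integral {0..x} p" using integral_deriv[OF zD(2) x] zD(6) by simp
    then have "(v x)\<^sup>2 \<le> x * integral {0..x} (\<lambda>t. (p t)\<^sup>2)"
      using integral_square_le[OF _ p] x by simp
    also have "\<dots> \<le> L * integral {0..L} (\<lambda>t. (p t)\<^sup>2)"
      using x p zD(5)
      by (intro mult_mono integral_subset_le integral_nonneg integrable_continuous_real continuous_intros) auto
    finally show ?thesis unfolding k_def using real_le_rsqrt[of "\<bar>v x\<bar>"] by simp
  qed
  show "\<bar>u x - u y\<bar> \<le> k * \<bar>x - y\<bar>" if "x \<in> {0..L}" "y \<in> {0..L}"
    using field_differentiable_bound[of "{0..L}" u v k x y] zD(1) v that by (auto simp: real_norm_def)
qed

context
  fixes f :: "real \<Rightarrow> real" and q :: real and u v p :: "real \<Rightarrow> real"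
  assumes f: "continuous_on UNIV f" and z: "is_state (u, v, p)"
begin

lemma force_props:
  shows "continuous_on {0..L} (\<lambda>x. f (u x))"
    "\<And>x. x \<in> {0..L} \<Longrightarrow> (force1 f u has_real_derivative f (u x)) (at x within {0..L})"
    "\<And>x. x \<in> {0..L} \<Longrightarrow> (force2 f u has_real_derivative force1 f u x) (at x within {0..L})"
    "continuous_on {0..L} (force1 f u)" "continuous_on {0..L} (force2 f u)"
proof -
  show c: "continuous_on {0..L} (\<lambda>x. f (u x))"
    using continuous_on_compose2[OF f stateD(3)[OF z]] by simp
  note d1 = deriv_integral[OF c, folded force1_def]
  show "\<And>x. x \<in> {0..L} \<Longrightarrow> (force1 f u has_real_derivative f (u x)) (at x within {0..L})"
    "continuous_on {0..L} (force1 f u)" using d1 by auto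
  note d2 = deriv_integral[OF d1(2), folded force2_def]
  show "\<And>x. x \<in> {0..L} \<Longrightarrow> (force2 f u has_real_derivative force1 f u x) (at x within {0..L})"
    "continuous_on {0..L} (force2 f u)" using d2 by auto
qed

lemma residual_cont: "continuous_on {0..L} (residual f q u p)" "continuous_on {0..L} (pdir f q u p)"
  unfolding residual_def[abs_def] pdir_def[abs_def]
  by (intro continuous_intros stateD[OF z] force_props)+

lemma integral_pdir: "integral {0..L} (pdir f q u p) = 0"
proof -
  have "integral {0..L} (pdir f q u p) = integral {0..L} (residual f q u p) -
      integral {0..L} (\<lambda>x. integral {0..L} (residual f q u p) / L)"
    unfolding pdir_def[abs_def]
    by (intro integral_diff integrable_continuous_real residual_cont continuous_intros)
  then show ?thesis using L by simp
qed

lemma dir_state: "is_state (udir f q u p, vdir f q u p, pdir f q u p)"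
proof -
  note d1 = deriv_integral[OF residual_cont(2), folded vdir_def]
  note d2 = deriv_integral[OF d1(2)]
  have "(udir f q u p has_real_derivative vdir f q u p x) (at x within {0..L})" if "x \<in> {0..L}" for x
    unfolding udir_def[abs_def] using d2(1)[OF that] by (auto intro!: derivative_eq_intros)
  then show ?thesis
    using d1 residual_cont integral_pdir by (auto simp: is_state_def) (auto simp: vdir_def)
qed

lemma step_state: "is_state (step f q \<eta> (u, v, p))"
  unfolding is_state_def step_def prod.case
  using stateD(6,7)[OF z] stateD(6,7)[OF dir_state]
  by (intro conjI ballI)
    (auto intro!: derivative_eq_intros continuous_intros stateD[OF z] stateD[OF dir_state])

lemma slope_nonneg: "slope f q (u, v, p) \<ge> 0"
  unfolding slope_def prod.case
  by (intro add_nonneg_nonneg integral_nonneg integrable_continuous_real continuous_intros residual_cont) auto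

lemma udir_bound:
  assumes x: "x \<in> {0..L}"
  shows "(udir f q u p x)\<^sup>2 \<le> (2 + 2 * L ^ 3) * slope f q (u, v, p)"
proof -
  let ?I = "integral {0..L} (\<lambda>x. (pdir f q u p x)\<^sup>2)"
  have I: "?I \<ge> 0"
    by (intro integral_nonneg integrable_continuous_real continuous_intros residual_cont) auto
  have "udir f q u p 0 = force1 f u L" by (simp add: udir_def)
  then have "\<bar>udir f q u p x - force1 f u L\<bar> \<le> sqrt (L * ?I) * \<bar>x\<bar>"
    using state_bounds(2)[OF dir_state x, of 0] L by simp
  also have "\<dots> \<le> sqrt (L * ?I) * L" using x I L by (intro mult_left_mono) auto
  finally have "(udir f q u p x - force1 f u L)\<^sup>2 \<le> (sqrt (L * ?I) * L)\<^sup>2"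
    using abs_le_square_iff[of _ "sqrt (L * ?I) * L"] L I by simp
  also have "\<dots> = L ^ 3 * ?I" using L I by (simp add: power_mult_distrib power3_eq_cube power2_eq_square)
  finally have *: "(udir f q u p x - force1 f u L)\<^sup>2 \<le> L ^ 3 * ?I" .
  have "(udir f q u p x)\<^sup>2 \<le> 2 * (udir f q u p x - force1 f u L)\<^sup>2 + 2 * (force1 f u L)\<^sup>2"
    using zero_le_power2[of "udir f q u p x - 2 * force1 f u L"] by (simp add: power2_eq_square algebra_simps)
  also have "\<dots> \<le> 2 * (L ^ 3 * ?I) + 2 * (force1 f u L)\<^sup>2" using * by simp
  also have "\<dots> \<le> (2 + 2 * L ^ 3) * (?I + (force1 f u L)\<^sup>2)"
    using I L by (simp add: algebra_simps)
  finally show ?thesis by (simp add: slope_def)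
qed

text \<open>The derivative along the gradient is its squared norm: this is what makes
  \<open>slope\<close> the rate of descent.\<close>

lemma first_variation:
  defines "\<phi> \<equiv> udir f q u p" and "\<psi> \<equiv> vdir f q u p" and "\<pi> \<equiv> pdir f q u p"
  shows "integral {0..L} (\<lambda>x. p x * \<pi> x - q * v x * \<psi> x + f (u x) * \<phi> x) = slope f q (u, v, p)"
proof -
  note zD = stateD[OF z] and dD = stateD[OF dir_state, folded \<phi>_def \<psi>_def \<pi>_def]
  note fp = force_props
  let ?\<sigma> = "force1 f u L"
  define m where "m = integral {0..L} (residual f q u p) / L"
  \<comment> \<open>The boundary terms of all integrations by parts, as an antiderivative of the
    integrand minus the square of \<open>\<pi>\<close>. Its total increment is the squared force
    integral, because \<open>\<psi>\<close> vanishes at both ends and \<open>\<phi>\<close> starts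
    at that integral.\<close>
  define G where "G x = - q * (u x * \<psi> x) + (force1 f u x * \<phi> x - force2 f u x * \<psi> x)
    - ?\<sigma> * (\<phi> x - x * \<psi> x) + m * \<psi> x" for x
  have G: "(G has_real_derivative (p x * \<pi> x - q * v x * \<psi> x + f (u x) * \<phi> x) - (\<pi> x)\<^sup>2) (at x within {0..L})"
    if "x \<in> {0..L}" for x
  proof -
    have "(G has_real_derivative - q * (u x * \<pi> x + v x * \<psi> x) +
      (force1 f u x * \<psi> x + f (u x) * \<phi> x - (force2 f u x * \<pi> x + force1 f u x * \<psi> x))
      - ?\<sigma> * (\<psi> x - (x * \<pi> x + \<psi> x)) + m * \<pi> x) (at x within {0..L})"
      unfolding G_def using that by (auto intro!: derivative_eq_intros zD dD fp)
    moreover have "\<pi> x = p x + q * u x + force2 f u x - ?\<sigma> * x - m"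
      by (simp add: \<pi>_def pdir_def residual_def m_def)
    then have "(\<pi> x)\<^sup>2 = \<pi> x * (p x + q * u x + force2 f u x - ?\<sigma> * x - m)"
      by (simp add: power2_eq_square)
    ultimately show ?thesis by (auto elim!: DERIV_cong simp: algebra_simps)
  qed
  have "integral {0..L} (\<lambda>x. (p x * \<pi> x - q * v x * \<psi> x + f (u x) * \<phi> x) - (\<pi> x)\<^sup>2) = G L - G 0"
    using integral_deriv[OF G, of L] L by simp
  also have "\<dots> = ?\<sigma>\<^sup>2"
    using dD(6,7) by (simp add: G_def power2_eq_square) (simp add: \<phi>_def udir_def force1_def)
  finally have "integral {0..L} (\<lambda>x. p x * \<pi> x - q * v x * \<psi> x + f (u x) * \<phi> x) -
      integral {0..L} (\<lambda>x. (\<pi> x)\<^sup>2) = ?\<sigma>\<^sup>2"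
    by (subst (asm) integral_diff) (auto intro!: integrable_continuous_real continuous_intros zD dD fp)
  then show ?thesis by (simp add: slope_def \<pi>_def)
qed

end

end

section \<open>Descent along a gradient step\<close>

lemma second_order_bound:
  fixes F :: "real \<Rightarrow> real"
  assumes F: "\<And>t. (F has_real_derivative f t) (at t)" and f: "\<And>t. (f has_real_derivative f' t) (at t)"
    and \<Lambda>: "\<And>t. \<bar>t\<bar> \<le> R \<Longrightarrow> \<bar>f' t\<bar> \<le> \<Lambda>" and ab: "\<bar>a\<bar> \<le> R" "\<bar>b\<bar> \<le> R"
  shows "F b \<le> F a + f a * (b - a) + \<Lambda> * (b - a)\<^sup>2"
proof -
  have lip: "\<bar>f x - f y\<bar> \<le> \<Lambda> * \<bar>x - y\<bar>" if "x \<in> {-R..R}" "y \<in> {-R..R}" for x y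
  proof -
    have "norm (f x - f y) \<le> \<Lambda> * norm (x - y)"
      by (rule field_differentiable_bound[OF _ has_field_derivative_at_within[OF f], of "{-R..R}"])
        (use that \<Lambda> in auto)
    then show ?thesis by simp
  qed
  have "\<exists>\<xi>. F b - F a = (b - a) * f \<xi> \<and> \<bar>\<xi> - a\<bar> \<le> \<bar>b - a\<bar> \<and> \<xi> \<in> {-R..R}"
  proof (cases a b rule: linorder_cases)
    case less
    then obtain \<xi> where "a < \<xi>" "\<xi> < b" "F b - F a = (b - a) * f \<xi>" using MVT2[OF less F] by blast
    then show ?thesis using ab by (intro exI[of _ \<xi>]) auto
  next
    case greater
    then obtain \<xi> where "b < \<xi>" "\<xi> < a" "F a - F b = (a - b) * f \<xi>" using MVT2[OF greater F] by blast
    then show ?thesis using ab by (intro exI[of _ \<xi>]) (auto simp: algebra_simps)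
  qed (use ab in \<open>auto intro!: exI[of _ a]\<close>)
  then obtain \<xi> where \<xi>: "F b - F a = (b - a) * f \<xi>" "\<bar>\<xi> - a\<bar> \<le> \<bar>b - a\<bar>" "\<xi> \<in> {-R..R}" by blast
  have a: "a \<in> {-R..R}" using ab by auto
  have \<Lambda>0: "0 \<le> \<Lambda>" using \<Lambda>[OF ab(1)] by linarith
  have "F b - F a - f a * (b - a) = (b - a) * (f \<xi> - f a)"
    using \<xi>(1) by (simp add: algebra_simps)
  also have "\<dots> \<le> \<bar>b - a\<bar> * \<bar>f \<xi> - f a\<bar>" by (metis abs_ge_self abs_mult)
  also have "\<dots> \<le> \<bar>b - a\<bar> * (\<Lambda> * \<bar>b - a\<bar>)"
    using lip[OF \<xi>(3) a] \<xi>(2) \<Lambda>0 by (intro mult_left_mono order_trans[OF lip[OF \<xi>(3) a]]) auto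
  also have "\<dots> = \<Lambda> * (b - a)\<^sup>2" by (simp add: power2_eq_square)
  finally show ?thesis by simp
qed

lemma bounded_on_interval:
  fixes g :: "real \<Rightarrow> real"
  assumes "continuous_on UNIV g"
  obtains M where "M \<ge> 0" "\<And>t. \<bar>t\<bar> \<le> R \<Longrightarrow> \<bar>g t\<bar> \<le> M"
proof -
  have "bounded (g ` {-R..R})"
    by (intro compact_imp_bounded compact_continuous_image continuous_on_subset[OF assms]) auto
  then obtain M where "\<And>t. t \<in> {-R..R} \<Longrightarrow> \<bar>g t\<bar> \<le> M" by (fastforce simp: bounded_iff)
  then show ?thesis by (intro that[of "max 0 M"]) (auto simp: le_max_iff_disj abs_le_iff)
qed

context neumann
begin

definition J :: "(real \<Rightarrow> real) \<Rightarrow> real \<Rightarrow> state \<Rightarrow> real" where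
  "J F q z = A F z - q * B z"

lemma J_integral:
  assumes "continuous_on UNIV F" and z: "is_state (u, v, p)"
  shows "J F q (u, v, p) = integral {0..L} (\<lambda>x. (p x)\<^sup>2 / 2 + F (u x) - q * ((v x)\<^sup>2 / 2))"
proof -
  have "continuous_on {0..L} (\<lambda>x. F (u x))"
    using continuous_on_compose2[OF assms(1) stateD(3)[OF z]] by simp
  then have "(\<lambda>x. (p x)\<^sup>2 / 2 + F (u x)) integrable_on {0..L}" "(\<lambda>x. q * ((v x)\<^sup>2 / 2)) integrable_on {0..L}"
    by (intro integrable_continuous_real continuous_intros stateD[OF z]; simp)+
  from integral_diff[OF this] show ?thesis by (simp add: J_def A_def B_def)
qed

lemma B_nonneg: "is_state z \<Longrightarrow> B z \<ge> 0"
proof (cases z)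
  case (fields u v p)
  assume "is_state z"
  then have "continuous_on {0..L} v" using stateD(4) fields by blast
  then show ?thesis
    unfolding fields B_def prod.case
    by (intro integral_nonneg integrable_continuous_real continuous_intros) auto
qed

lemma step_descent:
  assumes F: "\<And>t. (F has_real_derivative f t) (at t)" and f: "\<And>t. (f has_real_derivative f' t) (at t)"
    and \<Lambda>: "\<And>t. \<bar>t\<bar> \<le> R \<Longrightarrow> \<bar>f' t\<bar> \<le> \<Lambda>" and z: "is_state (u, v, p)"
    and u: "\<And>x. x \<in> {0..L} \<Longrightarrow> \<bar>u x\<bar> + \<bar>udir f q u p x\<bar> \<le> R"
    and q: "0 \<le> q" and \<eta>: "0 \<le> \<eta>" "\<eta> \<le> 1"
  shows "J F q (step f q \<eta> (u, v, p)) \<le> J F q (u, v, p) - \<eta> * slope f q (u, v, p)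
    + \<eta>\<^sup>2 * ((1 / 2 + \<Lambda> * L * (2 + 2 * L ^ 3)) * slope f q (u, v, p))"
proof -
  have cF: "continuous_on UNIV F" and cf: "continuous_on UNIV f"
    using F f by (auto intro: DERIV_continuous_on)
  define \<phi> \<psi> \<pi> where "\<phi> = udir f q u p" and "\<psi> = vdir f q u p" and "\<pi> = pdir f q u p"
  note zD = stateD[OF z] and dD = stateD[OF dir_state[OF cf z, of q], folded \<phi>_def \<psi>_def \<pi>_def]
  let ?N = "slope f q (u, v, p)"
  have \<Lambda>0: "0 \<le> \<Lambda>" using u[of 0] L \<Lambda>[of 0] by fastforce
  have cFu: "continuous_on {0..L} (\<lambda>x. F (u x))" "continuous_on {0..L} (\<lambda>x. f (u x))"
    using continuous_on_compose2[OF cF zD(3)] continuous_on_compose2[OF cf zD(3)] by auto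
  define j where "j x = (p x)\<^sup>2 / 2 + F (u x) - q * ((v x)\<^sup>2 / 2)" for x
  define d where "d x = p x * \<pi> x - q * v x * \<psi> x + f (u x) * \<phi> x" for x
  have cj: "continuous_on {0..L} j" "continuous_on {0..L} d"
    unfolding j_def[abs_def] d_def[abs_def] by (intro continuous_intros zD dD cFu; simp)+
  have "J F q (step f q \<eta> (u, v, p)) = integral {0..L} (\<lambda>x. (p x - \<eta> * \<pi> x)\<^sup>2 / 2
      + F (u x - \<eta> * \<phi> x) - q * ((v x - \<eta> * \<psi> x)\<^sup>2 / 2))"
    using J_integral[OF cF step_state[OF cf z, of q \<eta>, unfolded step_def prod.case], of q]
    by (simp add: step_def \<phi>_def \<psi>_def \<pi>_def)
  also have "\<dots> \<le> integral {0..L} (\<lambda>x. j x - \<eta> * d x + \<eta>\<^sup>2 * ((\<pi> x)\<^sup>2 / 2 + \<Lambda> * ((2 + 2 * L ^ 3) * ?N)))"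
  proof (rule integral_le)
    show "(\<lambda>x. (p x - \<eta> * \<pi> x)\<^sup>2 / 2 + F (u x - \<eta> * \<phi> x) - q * ((v x - \<eta> * \<psi> x)\<^sup>2 / 2)) integrable_on {0..L}"
      by (intro integrable_continuous_real continuous_intros continuous_on_compose2[OF cF] zD dD) auto
    show "(\<lambda>x. j x - \<eta> * d x + \<eta>\<^sup>2 * ((\<pi> x)\<^sup>2 / 2 + \<Lambda> * ((2 + 2 * L ^ 3) * ?N))) integrable_on {0..L}"
      by (intro integrable_continuous_real continuous_intros cj dD) auto
    fix x assume x: "x \<in> {0..L}"
    have "\<eta> * \<bar>\<phi> x\<bar> \<le> 1 * \<bar>\<phi> x\<bar>" using \<eta> by (intro mult_right_mono) auto
    then have "\<bar>u x - \<eta> * \<phi> x\<bar> \<le> \<bar>u x\<bar> + \<bar>\<phi> x\<bar>"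
      using abs_triangle_ineq4[of "u x" "\<eta> * \<phi> x"] \<eta> by (simp add: abs_mult)
    then have R: "\<bar>u x - \<eta> * \<phi> x\<bar> \<le> R" "\<bar>u x\<bar> \<le> R" using u[OF x] unfolding \<phi>_def by linarith+
    have "F (u x - \<eta> * \<phi> x) \<le> F (u x) + f (u x) * (- (\<eta> * \<phi> x)) + \<Lambda> * (\<eta> * \<phi> x)\<^sup>2"
      using second_order_bound[OF F f \<Lambda> R(2,1)] by simp
    also have "\<Lambda> * (\<eta> * \<phi> x)\<^sup>2 \<le> \<eta>\<^sup>2 * (\<Lambda> * ((2 + 2 * L ^ 3) * ?N))"
    proof -
      have "\<Lambda> * (\<eta> * \<phi> x)\<^sup>2 = \<eta>\<^sup>2 * (\<Lambda> * (\<phi> x)\<^sup>2)" by (simp add: power_mult_distrib mult_ac)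
      also have "\<dots> \<le> \<eta>\<^sup>2 * (\<Lambda> * ((2 + 2 * L ^ 3) * ?N))"
        using udir_bound[OF cf z x, of q] \<Lambda>0 unfolding \<phi>_def by (intro mult_left_mono) auto
      finally show ?thesis .
    qed
    finally have 1: "F (u x - \<eta> * \<phi> x) \<le> F (u x) - \<eta> * (f (u x) * \<phi> x) + \<eta>\<^sup>2 * (\<Lambda> * ((2 + 2 * L ^ 3) * ?N))"
      by (simp add: mult_ac)
    have 2: "(p x - \<eta> * \<pi> x)\<^sup>2 / 2 = (p x)\<^sup>2 / 2 - \<eta> * (p x * \<pi> x) + \<eta>\<^sup>2 * ((\<pi> x)\<^sup>2 / 2)"
      by (simp add: power2_eq_square field_simps)
    have "- ((v x - \<eta> * \<psi> x)\<^sup>2 / 2) \<le> - ((v x)\<^sup>2 / 2) + \<eta> * (v x * \<psi> x)"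
      using zero_le_power2[of "\<eta> * \<psi> x"] by (simp add: power2_eq_square field_simps)
    from mult_left_mono[OF this q]
    have 3: "- (q * ((v x - \<eta> * \<psi> x)\<^sup>2 / 2)) \<le> - (q * ((v x)\<^sup>2 / 2)) + \<eta> * (q * v x * \<psi> x)"
      by (simp add: algebra_simps)
    have 4: "\<eta> * d x = \<eta> * (p x * \<pi> x) - \<eta> * (q * v x * \<psi> x) + \<eta> * (f (u x) * \<phi> x)"
      by (simp add: d_def algebra_simps)
    show "(p x - \<eta> * \<pi> x)\<^sup>2 / 2 + F (u x - \<eta> * \<phi> x) - q * ((v x - \<eta> * \<psi> x)\<^sup>2 / 2)
      \<le> j x - \<eta> * d x + \<eta>\<^sup>2 * ((\<pi> x)\<^sup>2 / 2 + \<Lambda> * ((2 + 2 * L ^ 3) * ?N))"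
      using 1 2 3 4 unfolding j_def distrib_left[of "\<eta>\<^sup>2"] by linarith
  qed
  also have "\<dots> = integral {0..L} j - \<eta> * integral {0..L} d + \<eta>\<^sup>2 *
      (integral {0..L} (\<lambda>x. (\<pi> x)\<^sup>2) / 2 + L * (\<Lambda> * ((2 + 2 * L ^ 3) * ?N)))"
  proof (rule integral_unique)
    have ij: "(j has_integral integral {0..L} j) {0..L}" "(d has_integral integral {0..L} d) {0..L}"
      "((\<lambda>x. (\<pi> x)\<^sup>2) has_integral integral {0..L} (\<lambda>x. (\<pi> x)\<^sup>2)) {0..L}"
      by (intro integrable_integral integrable_continuous_real continuous_intros cj dD)+
    have "((\<lambda>x. \<Lambda> * ((2 + 2 * L ^ 3) * ?N)) has_integral L * (\<Lambda> * ((2 + 2 * L ^ 3) * ?N))) {0..L}"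
      using has_integral_const_real[of "\<Lambda> * ((2 + 2 * L ^ 3) * ?N)" 0 L] L by simp
    with ij show "((\<lambda>x. j x - \<eta> * d x + \<eta>\<^sup>2 * ((\<pi> x)\<^sup>2 / 2 + \<Lambda> * ((2 + 2 * L ^ 3) * ?N))) has_integral
      (integral {0..L} j - \<eta> * integral {0..L} d + \<eta>\<^sup>2 *
      (integral {0..L} (\<lambda>x. (\<pi> x)\<^sup>2) / 2 + L * (\<Lambda> * ((2 + 2 * L ^ 3) * ?N))))) {0..L}"
      by (intro has_integral_add has_integral_diff has_integral_mult_right has_integral_divide)
  qed
  also have "integral {0..L} j = J F q (u, v, p)"
    unfolding j_def[abs_def] using J_integral[OF cF z, of q] by simp
  also have "integral {0..L} d = ?N"
    unfolding d_def[abs_def] \<phi>_def \<psi>_def \<pi>_def by (rule first_variation[OF cf z])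
  also have "\<eta>\<^sup>2 * (integral {0..L} (\<lambda>x. (\<pi> x)\<^sup>2) / 2 + L * (\<Lambda> * ((2 + 2 * L ^ 3) * ?N)))
      \<le> \<eta>\<^sup>2 * ((1 / 2 + \<Lambda> * L * (2 + 2 * L ^ 3)) * ?N)"
  proof (rule mult_left_mono)
    have "integral {0..L} (\<lambda>x. (\<pi> x)\<^sup>2) \<le> ?N" by (simp add: slope_def \<pi>_def)
    then show "integral {0..L} (\<lambda>x. (\<pi> x)\<^sup>2) / 2 + L * (\<Lambda> * ((2 + 2 * L ^ 3) * ?N))
      \<le> (1 / 2 + \<Lambda> * L * (2 + 2 * L ^ 3)) * ?N"
      by (simp add: algebra_simps)
  qed simp
  finally show ?thesis by simp
qed

lemma integral_split_A:
  assumes "continuous_on UNIV F" and z: "is_state (u, v, p)"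
  shows "A F (u, v, p) = integral {0..L} (\<lambda>x. (p x)\<^sup>2) / 2 + integral {0..L} (\<lambda>x. F (u x))"
proof -
  have "continuous_on {0..L} (\<lambda>x. F (u x))"
    using continuous_on_compose2[OF assms(1) stateD(3)[OF z]] by simp
  then have "(\<lambda>x. (p x)\<^sup>2 / 2) integrable_on {0..L}" "(\<lambda>x. F (u x)) integrable_on {0..L}"
    by (intro integrable_continuous_real continuous_intros stateD[OF z]; simp)+
  from integral_add[OF this] show ?thesis by (simp add: A_def)
qed

text \<open>Bounds on J and B bound the integral of u''^2, hence the oscillation of u, and
  coercivity of \<open>F\<close> bounds u at some point. So u, the force and the slope stay in fixed
  compact ranges, and one step size serves all such states and all \<open>q\<close> in
  \<open>{0..Q}\<close>.\<close>

lemma uniform_descent: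
  assumes F: "\<And>t. (F has_real_derivative f t) (at t)" and f: "\<And>t. (f has_real_derivative f' t) (at t)"
    and f': "continuous_on UNIV f'" and \<kappa>: "\<kappa> > 0" "\<And>t. \<kappa> * t\<^sup>2 \<le> F t" and Q: "0 \<le> Q"
  obtains \<eta>0 where "0 < \<eta>0" "\<And>q z \<eta>. 0 \<le> q \<Longrightarrow> q \<le> Q \<Longrightarrow> is_state z \<Longrightarrow> J F q z \<le> D \<Longrightarrow> B z \<le> D \<Longrightarrow>
    0 \<le> \<eta> \<Longrightarrow> \<eta> \<le> \<eta>0 \<Longrightarrow> J F q (step f q \<eta> z) \<le> J F q z - \<eta> / 2 * slope f q z"
proof -
  have cF: "continuous_on UNIV F" and cf: "continuous_on UNIV f"
    using F f by (auto intro: DERIV_continuous_on)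
  \<comment> \<open>In order: \<open>E\<close> bounds A, \<open>k\<close> bounds the Lipschitz
    constant of u, \<open>R1\<close> bounds u, \<open>Mf\<close> the force, \<open>M2\<close> the
    difference of \<open>residual\<close> and u'', \<open>N1\<close> the slope, \<open>R\<close> the
    sum of u and the direction. Finally \<open>\<eta>0\<close> makes the quadratic term at most half
    of the linear one.\<close>
  define E where "E = D + Q * D"
  define k where "k = sqrt (L * (2 * E))"
  define R1 where "R1 = sqrt (E / (L * \<kappa>)) + k * L"
  obtain Mf where Mf: "Mf \<ge> 0" "\<And>t. \<bar>t\<bar> \<le> R1 \<Longrightarrow> \<bar>f t\<bar> \<le> Mf" using bounded_on_interval[OF cf] by blast
  define M2 where "M2 = Q * R1 + L * (L * Mf) + L * Mf * L"
  define N1 where "N1 = 4 * E + L * (8 * M2\<^sup>2) + (L * Mf)\<^sup>2"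
  define R where "R = R1 + sqrt ((2 + 2 * L ^ 3) * N1)"
  obtain \<Lambda> where \<Lambda>: "\<Lambda> \<ge> 0" "\<And>t. \<bar>t\<bar> \<le> R \<Longrightarrow> \<bar>f' t\<bar> \<le> \<Lambda>" using bounded_on_interval[OF f'] by blast
  define C where "C = 1 / 2 + \<Lambda> * L * (2 + 2 * L ^ 3)"
  have C: "C > 0" unfolding C_def using \<Lambda>(1) L by (intro add_pos_nonneg) auto
  define \<eta>0 where "\<eta>0 = min 1 (1 / (2 * C))"
  have "J F q (step f q \<eta> z) \<le> J F q z - \<eta> / 2 * slope f q z"
    if q: "0 \<le> q" "q \<le> Q" and z: "is_state z" and JD: "J F q z \<le> D" and BD: "B z \<le> D"
      and \<eta>: "0 \<le> \<eta>" "\<eta> \<le> \<eta>0" for q z \<eta>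
  proof -
    obtain u v p where zz: "z = (u, v, p)" by (cases z)
    note z = z[unfolded zz]
    note zD = stateD[OF z]
    have cFu: "continuous_on {0..L} (\<lambda>x. F (u x))"
      using continuous_on_compose2[OF cF zD(3)] by simp
    have D0: "0 \<le> D" using B_nonneg[OF z] BD zz by simp
    have "q * B z \<le> Q * D" using q BD B_nonneg[OF z] zz by (intro mult_mono) auto
    then have AE: "A F (u, v, p) \<le> E" using JD by (simp add: J_def E_def zz)
    have E0: "0 \<le> E" using D0 Q by (simp add: E_def)
    have ip: "0 \<le> integral {0..L} (\<lambda>x. (p x)\<^sup>2)"
      by (intro integral_nonneg integrable_continuous_real continuous_intros zD) auto
    have iF: "0 \<le> integral {0..L} (\<lambda>x. F (u x))"
    proof (intro integral_nonneg integrable_continuous_real cFu)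
      show "0 \<le> F (u x)" for x using \<kappa>(2)[of "u x"] \<kappa>(1) by (meson less_imp_le mult_nonneg_nonneg order_trans zero_le_power2)
    qed
    have p2: "integral {0..L} (\<lambda>x. (p x)\<^sup>2) \<le> 2 * E" and iFE: "integral {0..L} (\<lambda>x. F (u x)) \<le> E"
      using AE integral_split_A[OF cF z] ip iF by linarith+
    have kge: "sqrt (L * integral {0..L} (\<lambda>x. (p x)\<^sup>2)) \<le> k"
      unfolding k_def using p2 L by (intro real_sqrt_le_mono mult_left_mono) auto
    have k0: "0 \<le> k" unfolding k_def using E0 L by simp
    have "\<exists>x0\<in>{0..L}. \<kappa> * (u x0)\<^sup>2 \<le> E / L"
    proof (rule ccontr)
      assume "\<not> ?thesis"
      then have *: "E / L < F (u x)" if "x \<in> {0..L}" for x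
        using that \<kappa>(2)[of "u x"] by (meson less_le_trans not_le)
      obtain x where x: "x \<in> {0..L}" "\<And>y. y \<in> {0..L} \<Longrightarrow> F (u x) \<le> F (u y)"
        using continuous_attains_inf[OF compact_Icc _ cFu] L by auto
      have "L * F (u x) \<le> integral {0..L} (\<lambda>x. F (u x))"
        using x L cFu by (intro const_le_integral) auto
      then have "L * F (u x) \<le> L * (E / L)" using iFE L by simp
      then show False using *[OF x(1)] L by (simp add: field_simps)
    qed
    then obtain x0 where x0: "x0 \<in> {0..L}" "\<kappa> * (u x0)\<^sup>2 \<le> E / L" by blast
    have u0: "\<bar>u x0\<bar> \<le> sqrt (E / (L * \<kappa>))"
      using x0(2) \<kappa>(1) L by (intro real_le_rsqrt) (simp add: field_simps)
    have uR1: "\<bar>u x\<bar> \<le> R1" if x: "x \<in> {0..L}" for x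
    proof -
      have "\<bar>u x - u x0\<bar> \<le> sqrt (L * integral {0..L} (\<lambda>x. (p x)\<^sup>2)) * \<bar>x - x0\<bar>"
        by (rule state_bounds(2)[OF z x x0(1)])
      also have "\<dots> \<le> k * L" using kge k0 x x0(1) ip L by (intro mult_mono) auto
      finally show ?thesis using u0 unfolding R1_def by linarith
    qed
    have R10: "0 \<le> R1" using uR1[of 0] L by force
    have fu: "\<bar>f (u x)\<bar> \<le> Mf" if "x \<in> {0..L}" for x using Mf uR1[OF that] by blast
    have f1: "\<bar>force1 f u x\<bar> \<le> L * Mf" if x: "x \<in> {0..L}" for x
    proof -
      have "\<bar>force1 f u x - force1 f u 0\<bar> \<le> Mf * \<bar>x - 0\<bar>"
        using field_differentiable_bound[OF convex_real_interval(5) force_props(2)[OF cf z], of Mf x 0] fu x L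
        by (auto simp: real_norm_def)
      also have "\<dots> \<le> Mf * L" using x Mf by (intro mult_left_mono) auto
      finally show ?thesis by (simp add: force1_def mult.commute)
    qed
    have f2: "\<bar>force2 f u x\<bar> \<le> L * (L * Mf)" if x: "x \<in> {0..L}" for x
    proof -
      have "\<bar>force2 f u x - force2 f u 0\<bar> \<le> (L * Mf) * \<bar>x - 0\<bar>"
        using field_differentiable_bound[OF convex_real_interval(5) force_props(3)[OF cf z], of "L * Mf" x 0] f1 x L
        by (auto simp: real_norm_def)
      also have "\<dots> \<le> (L * Mf) * L" using x Mf L by (intro mult_left_mono) auto
      finally show ?thesis by (simp add: force2_def mult.commute)
    qed
    have M20: "0 \<le> M2" unfolding M2_def using Q R10 Mf L by simp
    have rp: "\<bar>residual f q u p x - p x\<bar> \<le> M2" if x: "x \<in> {0..L}" for x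
    proof -
      have "\<bar>residual f q u p x - p x\<bar> \<le> \<bar>q * u x\<bar> + \<bar>force2 f u x\<bar> + \<bar>force1 f u L * x\<bar>"
        unfolding residual_def by linarith
      also have "\<bar>q * u x\<bar> \<le> Q * R1" unfolding abs_mult using q uR1[OF x] by (intro mult_mono) auto
      also have "\<bar>force1 f u L * x\<bar> \<le> L * Mf * L"
        unfolding abs_mult using f1[of L] x L Mf by (intro mult_mono) auto
      finally show ?thesis using f2[OF x] unfolding M2_def by linarith
    qed
    have crp: "continuous_on {0..L} (\<lambda>x. residual f q u p x - p x)"
      by (intro continuous_intros residual_cont[OF cf z] zD)
    \<comment> \<open>There is no pointwise bound on \<open>p\<close>, but its mean is 0, so the
      mean of \<open>residual\<close> is controlled by the bounded part alone.\<close>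
    have "integral {0..L} (\<lambda>x. residual f q u p x - p x) = integral {0..L} (residual f q u p) - integral {0..L} p"
      by (intro integral_diff integrable_continuous_real residual_cont[OF cf z] zD)
    moreover have "integral {0..L} p = 0" using integral_deriv[OF zD(2), of L] L zD(6,7) by simp
    ultimately have "\<bar>integral {0..L} (residual f q u p)\<bar> = norm (integral {0..L} (\<lambda>x. residual f q u p x - p x))"
      by simp
    also have "\<dots> \<le> M2 * (L - 0)"
      using rp by (intro integral_bound[OF _ crp]) (use L in auto)
    finally have mean: "\<bar>integral {0..L} (residual f q u p) / L\<bar> \<le> M2"
      using L by (simp add: field_simps)
    have "integral {0..L} (\<lambda>x. (pdir f q u p x)\<^sup>2) \<le> integral {0..L} (\<lambda>x. 2 * (p x)\<^sup>2 + 8 * M2\<^sup>2)"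
    proof (intro integral_le integrable_continuous_real continuous_intros residual_cont[OF cf z] zD)
      fix x assume x: "x \<in> {0..L}"
      have "\<bar>pdir f q u p x - p x\<bar> \<le> 2 * M2"
        using rp[OF x] mean unfolding pdir_def by linarith
      then have "(pdir f q u p x - p x)\<^sup>2 \<le> (2 * M2)\<^sup>2"
        using M20 abs_le_square_iff[of "pdir f q u p x - p x" "2 * M2"] by simp
      moreover have "(pdir f q u p x)\<^sup>2 \<le> 2 * (p x)\<^sup>2 + 2 * (pdir f q u p x - p x)\<^sup>2"
        using zero_le_power2[of "pdir f q u p x - 2 * p x"] by (simp add: power2_eq_square algebra_simps)
      ultimately show "(pdir f q u p x)\<^sup>2 \<le> 2 * (p x)\<^sup>2 + 8 * M2\<^sup>2" by (simp add: power_mult_distrib)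
    qed
    also have "\<dots> = 2 * integral {0..L} (\<lambda>x. (p x)\<^sup>2) + L * (8 * M2\<^sup>2)"
      by (subst integral_add) (use L in \<open>auto intro!: integrable_continuous_real continuous_intros zD\<close>)
    also have "\<dots> \<le> 4 * E + L * (8 * M2\<^sup>2)" using p2 by simp
    finally have "slope f q (u, v, p) \<le> N1"
      unfolding slope_def prod.case N1_def using f1[of L] L Mf
      by (intro add_mono) (auto simp: abs_le_square_iff[symmetric])
    then have sl: "(2 + 2 * L ^ 3) * slope f q (u, v, p) \<le> (2 + 2 * L ^ 3) * N1"
      using L by (intro mult_left_mono) auto
    have "\<bar>u x\<bar> + \<bar>udir f q u p x\<bar> \<le> R" if x: "x \<in> {0..L}" for x
    proof -
      have "\<bar>udir f q u p x\<bar> \<le> sqrt ((2 + 2 * L ^ 3) * N1)"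
        using udir_bound[OF cf z x, of q] sl by (intro real_le_rsqrt) simp
      then show ?thesis using uR1[OF x] by (simp add: R_def)
    qed
    moreover have \<eta>1: "\<eta> \<le> 1" "\<eta> * C \<le> 1 / 2" using \<eta> C by (auto simp: \<eta>0_def field_simps)
    ultimately have "J F q (step f q \<eta> z) \<le> J F q z - \<eta> * slope f q z + \<eta>\<^sup>2 * (C * slope f q z)"
      unfolding C_def zz using \<eta> by (intro step_descent[OF F f \<Lambda>(2) z _ q(1)]) auto
    also have "\<eta>\<^sup>2 * (C * slope f q z) = \<eta> * (\<eta> * C * slope f q z)" by (simp add: power2_eq_square mult_ac)
    also have "\<dots> \<le> \<eta> * (1 / 2 * slope f q z)"
      using \<eta> \<eta>1(2) slope_nonneg[OF cf z, of q] zz by (intro mult_left_mono mult_right_mono) auto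
    finally show ?thesis by simp
  qed
  moreover have "0 < \<eta>0" using C by (simp add: \<eta>0_def)
  ultimately show ?thesis by (rule_tac that)
qed

end

section \<open>Mountain pass paths\<close>

lemma continuous_on_integral_param:
  fixes g :: "'a::topological_space \<Rightarrow> real \<Rightarrow> real"
  assumes "continuous_on (S \<times> {0..X}) (\<lambda>(s, x). g s x)"
  shows "continuous_on S (\<lambda>s. integral {0..X} (g s))"
  using integral_continuous_on_param[of S 0 X g] assms by simp

context neumann
begin

definition zero :: state where "zero = (\<lambda>_. 0, \<lambda>_. 0, \<lambda>_. 0)"

text \<open>On compact intervals joint continuity of the components is continuity of the path in the
  C^2 norm; stated this way it passes directly through integrals and compositions.\<close>

definition joint :: "(real \<Rightarrow> real \<Rightarrow> real) \<Rightarrow> bool" where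
  "joint g \<longleftrightarrow> continuous_on ({0..1} \<times> {0..L}) (\<lambda>(s, x). g s x)"

definition paths :: "state \<Rightarrow> (real \<Rightarrow> state) set" where
  "paths e = {\<gamma>. (\<forall>s\<in>{0..1}. is_state (\<gamma> s)) \<and> joint (\<lambda>s. fst (\<gamma> s)) \<and>
    joint (\<lambda>s. fst (snd (\<gamma> s))) \<and> joint (\<lambda>s. snd (snd (\<gamma> s))) \<and> \<gamma> 0 = zero \<and> \<gamma> 1 = e}"

lemma joint_intros:
  "joint g \<Longrightarrow> joint h \<Longrightarrow> joint (\<lambda>s x. g s x + h s x)"
  "joint g \<Longrightarrow> joint h \<Longrightarrow> joint (\<lambda>s x. g s x - h s x)"
  "joint g \<Longrightarrow> joint h \<Longrightarrow> joint (\<lambda>s x. g s x * h s x)"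
  "continuous_on {0..1} w \<Longrightarrow> joint (\<lambda>s x. w s)"
  "joint (\<lambda>s x. x)"
  "joint (\<lambda>s x. k)"
  unfolding joint_def case_prod_unfold
  by (auto intro!: continuous_intros continuous_on_compose2[of "{0..1}" w _ fst])

lemma joint_compose: "joint g \<Longrightarrow> continuous_on UNIV f \<Longrightarrow> joint (\<lambda>s x. f (g s x))"
  unfolding joint_def case_prod_unfold by (rule continuous_on_compose2) auto

lemma joint_integral: "joint g \<Longrightarrow> joint (\<lambda>s x. integral {0..x} (g s))"
  unfolding joint_def by (rule continuous_on_indefinite_integral)

lemma joint_total_integral: "joint g \<Longrightarrow> continuous_on {0..1} (\<lambda>s. integral {0..L} (g s))"
  unfolding joint_def by (rule continuous_on_integral_param)

text \<open>The step length may vary along the path; its vanishing at the ends keeps the endpoints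
  fixed. Continuity of the deformed path holds because the gradient is built from integrals and the
  force alone.\<close>

lemma path_step:
  assumes \<gamma>: "\<gamma> \<in> paths e" and f: "continuous_on UNIV f"
    and w: "continuous_on {0..1} w" "w 0 = 0" "w 1 = 0"
  shows "(\<lambda>s. step f q (w s) (\<gamma> s)) \<in> paths e"
proof -
  define u v p where "u s = fst (\<gamma> s)" and "v s = fst (snd (\<gamma> s))" and "p s = snd (snd (\<gamma> s))" for s
  have \<gamma>s: "\<gamma> s = (u s, v s, p s)" for s by (simp add: u_def v_def p_def)
  have j: "joint u" "joint v" "joint p"
    using \<gamma> by (auto simp: paths_def u_def[abs_def] v_def[abs_def] p_def[abs_def])
  have F1: "joint (\<lambda>s. force1 f (u s))"
    unfolding force1_def[abs_def] by (intro joint_integral joint_compose[OF _ f] j)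
  have F2: "joint (\<lambda>s. force2 f (u s))"
    unfolding force2_def[abs_def] by (intro joint_integral F1)
  have sg: "continuous_on {0..1} (\<lambda>s. force1 f (u s) L)"
    unfolding force1_def by (intro joint_total_integral joint_compose[OF _ f] j)
  have R: "joint (\<lambda>s. residual f q (u s) (p s))"
    unfolding residual_def[abs_def] by (intro joint_intros j F2 sg)
  have P: "joint (\<lambda>s. pdir f q (u s) (p s))"
    unfolding pdir_def[abs_def] using L
    by (intro joint_intros R continuous_intros joint_total_integral) auto
  have V: "joint (\<lambda>s. vdir f q (u s) (p s))"
    unfolding vdir_def[abs_def] by (intro joint_integral P)
  have U: "joint (\<lambda>s. udir f q (u s) (p s))"
    unfolding udir_def[abs_def] by (intro joint_intros joint_integral V sg)
  have z: "step f q 0 z = z" for z by (cases z) (simp add: step_def)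
  have "is_state (step f q (w s) (\<gamma> s))" if "s \<in> {0..1}" for s
  proof -
    have "is_state (u s, v s, p s)" using \<gamma> that by (auto simp: paths_def simp flip: \<gamma>s)
    from step_state[OF f this] show ?thesis by (simp flip: \<gamma>s)
  qed
  moreover have "step f q (w 0) (\<gamma> 0) = zero" "step f q (w 1) (\<gamma> 1) = e"
    using \<gamma> w z by (auto simp: paths_def)
  moreover have "joint (\<lambda>s. fst (step f q (w s) (\<gamma> s)))" "joint (\<lambda>s. fst (snd (step f q (w s) (\<gamma> s))))"
    "joint (\<lambda>s. snd (snd (step f q (w s) (\<gamma> s))))"
    unfolding \<gamma>s step_def prod.case fst_conv snd_conv by (intro joint_intros j U V P w)+
  ultimately show ?thesis by (auto simp: paths_def)
qed

lemma path_continuous: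
  assumes \<gamma>: "\<gamma> \<in> paths e" and F: "continuous_on UNIV F"
  shows "continuous_on {0..1} (\<lambda>s. J F q (\<gamma> s))"
    and "continuous_on {0..1} (\<lambda>s. integral {0..L} (\<lambda>x. (snd (snd (\<gamma> s)) x)\<^sup>2 + (fst (\<gamma> s) x)\<^sup>2))"
proof -
  have j: "joint (\<lambda>s. fst (\<gamma> s))" "joint (\<lambda>s. fst (snd (\<gamma> s)))" "joint (\<lambda>s. snd (snd (\<gamma> s)))"
    using \<gamma> by (auto simp: paths_def)
  have sq: "joint (\<lambda>s x. (g s x)\<^sup>2)" "joint (\<lambda>s x. g s x / 2)" if "joint g" for g
    using joint_intros(3)[OF that that] joint_intros(3)[OF that joint_intros(6)[of "1 / 2"]]
    by (simp_all add: power2_eq_square)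
  show "continuous_on {0..1} (\<lambda>s. J F q (\<gamma> s))"
    unfolding J_def A_def B_def case_prod_unfold
    by (intro continuous_intros joint_total_integral joint_intros(1) sq joint_compose[OF _ F] j)
  show "continuous_on {0..1} (\<lambda>s. integral {0..L} (\<lambda>x. (snd (snd (\<gamma> s)) x)\<^sup>2 + (fst (\<gamma> s) x)\<^sup>2))"
    by (intro joint_total_integral joint_intros(1) sq j)
qed

definition peak :: "(real \<Rightarrow> real) \<Rightarrow> real \<Rightarrow> (real \<Rightarrow> state) \<Rightarrow> real" where
  "peak F q \<gamma> = (SUP s\<in>{0..1}. J F q (\<gamma> s))"

definition level :: "(real \<Rightarrow> real) \<Rightarrow> state \<Rightarrow> real \<Rightarrow> real" where
  "level F e q = (INF \<gamma>\<in>paths e. peak F q \<gamma>)"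

lemma peak_upper:
  assumes "\<gamma> \<in> paths e" "continuous_on UNIV F" "s \<in> {0..1}"
  shows "J F q (\<gamma> s) \<le> peak F q \<gamma>"
  unfolding peak_def
proof (rule cSUP_upper[OF assms(3)])
  show "bdd_above ((\<lambda>s. J F q (\<gamma> s)) ` {0..1})"
    by (intro bounded_imp_bdd_above compact_imp_bounded compact_continuous_image
        path_continuous(1)[OF assms(1,2)]) auto
qed

lemma peak_least: "(\<And>s. s \<in> {0..1} \<Longrightarrow> J F q (\<gamma> s) \<le> c) \<Longrightarrow> peak F q \<gamma> \<le> c"
  unfolding peak_def by (intro cSUP_least) auto

lemma J_zero: "F 0 = 0 \<Longrightarrow> J F q zero = 0"
  by (simp add: J_def A_def B_def zero_def)

context
  fixes F :: "real \<Rightarrow> real" and e :: state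
  assumes F: "continuous_on UNIV F" "F 0 = 0" and ne: "paths e \<noteq> {}"
begin

lemma peak_nonneg: "\<gamma> \<in> paths e \<Longrightarrow> 0 \<le> peak F q \<gamma>"
  using peak_upper[of \<gamma> e F 0 q] F J_zero[of F q] by (auto simp: paths_def)

lemma level_le: "\<gamma> \<in> paths e \<Longrightarrow> level F e q \<le> peak F q \<gamma>"
  unfolding level_def using peak_nonneg by (intro cINF_lower bdd_belowI2[of _ 0]) auto

lemma level_ge: "(\<And>\<gamma>. \<gamma> \<in> paths e \<Longrightarrow> c \<le> peak F q \<gamma>) \<Longrightarrow> c \<le> level F e q"
  unfolding level_def using ne by (intro cINF_greatest) auto

lemma level_nonneg: "0 \<le> level F e q"
  by (intro level_ge peak_nonneg)

lemma level_approx: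
  assumes "\<epsilon> > 0"
  obtains \<gamma> where "\<gamma> \<in> paths e" "peak F q \<gamma> < level F e q + \<epsilon>"
proof -
  have "\<exists>\<gamma>\<in>paths e. peak F q \<gamma> < level F e q + \<epsilon>"
    using level_ge[of "level F e q + \<epsilon>" q] assms by (force simp: not_less)
  then show ?thesis using that by blast
qed

lemma J_antimono: "is_state z \<Longrightarrow> q \<le> q' \<Longrightarrow> J F q' z \<le> J F q z"
  unfolding J_def using B_nonneg[of z] by (simp add: mult_right_mono)

lemma level_antimono: "antimono (level F e)"
proof (rule antimonoI)
  fix q q' :: real assume q: "q \<le> q'"
  show "level F e q' \<le> level F e q"
  proof (rule level_ge)
    fix \<gamma> assume \<gamma>: "\<gamma> \<in> paths e"
    have "peak F q' \<gamma> \<le> peak F q \<gamma>"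
    proof (rule peak_least)
      fix s :: real assume s: "s \<in> {0..1}"
      then have "J F q' (\<gamma> s) \<le> J F q (\<gamma> s)" using \<gamma> q by (intro J_antimono) (auto simp: paths_def)
      then show "J F q' (\<gamma> s) \<le> peak F q \<gamma>" using peak_upper[OF \<gamma> F(1) s, of q] by simp
    qed
    then show "level F e q' \<le> peak F q \<gamma>" using level_le[OF \<gamma>, of q'] by simp
  qed
qed

text \<open>Struwe's monotonicity trick: where the level does not vary too fast with \<open>q\<close>, almost optimal paths
  have bounded \<open>B\<close> near their top, and pushing the top down by one step must fail somewhere.\<close>

lemma monotonicity_trick:
  assumes f: "continuous_on UNIV f" and q: "0 \<le> q" and h: "0 < h" and K: "0 \<le> K"
    and descent: "\<And>z \<eta>. is_state z \<Longrightarrow> J F q z \<le> D \<Longrightarrow> B z \<le> D \<Longrightarrow> 0 \<le> \<eta> \<Longrightarrow> \<eta> \<le> \<eta>0 \<Longrightarrow>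
      J F q (step f q \<eta> z) \<le> J F q z - \<eta> / 2 * slope f q z"
    and D: "level F e q + (K + 1) * h \<le> D" "K + 2 \<le> D"
    and \<eta>0: "0 < \<eta>0" and small: "(K + 2) * h \<le> \<eta>0 * \<delta> / 2"
    and low: "h \<le> level F e q" and e: "J F q e \<le> 0"
    and rate: "level F e (q - h) - level F e q \<le> K * h"
  shows "\<exists>z. is_state z \<and> B z \<le> K + 2 \<and> level F e q - h \<le> J F q z \<and>
    J F q z \<le> level F e q + (K + 1) * h \<and> slope f q z < \<delta>"
proof (rule ccontr)
  assume neg: "\<not> ?thesis"
  let ?c = "level F e q"
  obtain \<gamma> where \<gamma>: "\<gamma> \<in> paths e" and pk: "peak F (q - h) \<gamma> < level F e (q - h) + h"
    using level_approx[OF h] by blast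
  have st: "is_state (\<gamma> s)" if "s \<in> {0..1}" for s using \<gamma> that by (auto simp: paths_def)
  \<comment> \<open>The path is almost optimal for \<open>q - h\<close>, not for \<open>q\<close>.
    Since J at \<open>q - h\<close> is J at \<open>q\<close> plus \<open>h * B\<close>, the bound on
    the growth of the level controls both summands.\<close>
  have Jle: "J F q (\<gamma> s) + h * B (\<gamma> s) < ?c + (K + 1) * h" if s: "s \<in> {0..1}" for s
  proof -
    have "J F q (\<gamma> s) + h * B (\<gamma> s) = J F (q - h) (\<gamma> s)" by (simp add: J_def algebra_simps)
    also have "\<dots> \<le> peak F (q - h) \<gamma>" by (rule peak_upper[OF \<gamma> F(1) s])
    also have "\<dots> < ?c + (K + 1) * h" using pk rate by (simp add: algebra_simps)
    finally show ?thesis .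
  qed
  have top: "B (\<gamma> s) \<le> K + 2" "J F q (\<gamma> s) \<le> ?c + (K + 1) * h" "\<delta> \<le> slope f q (\<gamma> s)"
    if s: "s \<in> {0..1}" and J: "?c - h \<le> J F q (\<gamma> s)" for s
  proof -
    have "h * B (\<gamma> s) \<le> h * (K + 2)" using Jle[OF s] J by (simp add: algebra_simps)
    then show 1: "B (\<gamma> s) \<le> K + 2" using h by simp
    have "0 \<le> h * B (\<gamma> s)" using h B_nonneg[OF st[OF s]] by simp
    then show 2: "J F q (\<gamma> s) \<le> ?c + (K + 1) * h" using Jle[OF s] by simp
    show "\<delta> \<le> slope f q (\<gamma> s)" using neg 1 2 st[OF s] J by (meson not_less)
  qed
  \<comment> \<open>A ramp from no step at height \<open>?c - h\<close> to the full step at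
    \<open>?c - h / 2\<close>. The endpoints lie at or below 0, which is at most
    \<open>?c - h\<close>, and do not move.\<close>
  define w where "w s = \<eta>0 * max 0 (min 1 ((J F q (\<gamma> s) - (?c - h)) / (h / 2)))" for s
  have w: "0 \<le> w s" "w s \<le> \<eta>0" for s using \<eta>0 by (auto simp: w_def mult_left_le)
  have w0: "w s = 0" if "J F q (\<gamma> s) \<le> ?c - h" for s
  proof -
    have "(J F q (\<gamma> s) - (?c - h)) / (h / 2) \<le> 0" using that h by (intro divide_nonpos_pos) auto
    then have "max 0 (min 1 ((J F q (\<gamma> s) - (?c - h)) / (h / 2))) = 0" by (intro max_absorb1) linarith
    then show ?thesis unfolding w_def by simp
  qed
  have "(\<lambda>s. step f q (w s) (\<gamma> s)) \<in> paths e"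
  proof (rule path_step[OF \<gamma> f])
    show "continuous_on {0..1} w"
      unfolding w_def by (intro continuous_intros path_continuous[OF \<gamma> F(1)]) (use h in auto)
    have "\<gamma> 0 = zero" "\<gamma> 1 = e" using \<gamma> by (auto simp: paths_def)
    then show "w 0 = 0" "w 1 = 0" using w0 low e J_zero[of F q] F by auto
  qed
  from level_le[OF this, of q] have "?c \<le> peak F q (\<lambda>s. step f q (w s) (\<gamma> s))" .
  also have "\<dots> \<le> ?c - h / 2"
  proof (rule peak_least)
    fix s :: real assume s: "s \<in> {0..1}"
    have z: "step f q 0 z = z" for z by (cases z) (simp add: step_def)
    show "J F q (step f q (w s) (\<gamma> s)) \<le> ?c - h / 2"
    proof (cases "?c - h \<le> J F q (\<gamma> s)")
      case True
      note t = top[OF s True]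
      have *: "J F q (step f q (w s) (\<gamma> s)) \<le> J F q (\<gamma> s) - w s / 2 * slope f q (\<gamma> s)"
        using t D w by (intro descent st s) auto
      have sl: "0 \<le> slope f q (\<gamma> s)" using slope_nonneg[OF f] st[OF s] by (cases "\<gamma> s") auto
      show ?thesis
      proof (cases "J F q (\<gamma> s) \<le> ?c - h / 2")
        case True
        have "0 \<le> w s / 2 * slope f q (\<gamma> s)" using w[of s] sl by (intro mult_nonneg_nonneg) auto
        then show ?thesis using True * by linarith
      next
        case False
        \<comment> \<open>A full step lowers J by at least \<open>(K + 2) * h\<close>, which is the
          distance from the highest value \<open>?c + (K + 1) * h\<close> down to
          \<open>?c - h\<close>.\<close>
        then have "1 \<le> (J F q (\<gamma> s) - (?c - h)) / (h / 2)" using h by (simp add: field_simps)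
        then have "w s = \<eta>0" by (simp add: w_def)
        then have "\<eta>0 * \<delta> / 2 \<le> w s / 2 * slope f q (\<gamma> s)" using t(3) \<eta>0 by simp
        moreover have "(K + 2) * h = (K + 1) * h + h" by (simp add: algebra_simps)
        ultimately show ?thesis using * t(2) small h by linarith
      qed
    next
      case False
      then have "step f q (w s) (\<gamma> s) = \<gamma> s" using w0 z by simp
      then show ?thesis using False h by simp
    qed
  qed
  finally show False using h by simp
qed

end

section \<open>Mountain pass geometry: the barrier around zero and a negative endpoint\<close>

lemma sobolev:
  assumes z: "is_state (u, v, p)" and x: "x \<in> {0..L}"
  shows "(u x)\<^sup>2 \<le> (2 / L + 2 * L ^ 3) * integral {0..L} (\<lambda>x. (p x)\<^sup>2 + (u x)\<^sup>2)"
proof -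
  note zD = stateD[OF z]
  let ?P = "integral {0..L} (\<lambda>x. (p x)\<^sup>2)" and ?U = "integral {0..L} (\<lambda>x. (u x)\<^sup>2)"
  have nn: "0 \<le> ?P" "0 \<le> ?U"
    by (intro integral_nonneg integrable_continuous_real continuous_intros zD; simp)+
  have "continuous_on {0..L} (\<lambda>x. (u x)\<^sup>2)" by (intro continuous_intros zD)
  then obtain x0 where x0: "x0 \<in> {0..L}" "\<And>y. y \<in> {0..L} \<Longrightarrow> (u x0)\<^sup>2 \<le> (u y)\<^sup>2"
    using continuous_attains_inf[of "{0..L}" "\<lambda>x. (u x)\<^sup>2"] L by auto
  have "L * (u x0)\<^sup>2 \<le> ?U"
    using x0 L by (intro const_le_integral continuous_intros zD) auto
  then have 1: "(u x0)\<^sup>2 \<le> 1 / L * ?U" using L by (simp add: field_simps)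
  have "\<bar>u x - u x0\<bar> \<le> sqrt (L * ?P) * \<bar>x - x0\<bar>" by (rule state_bounds(2)[OF z x x0(1)])
  also have "\<dots> \<le> sqrt (L * ?P) * L" using x x0(1) nn L by (intro mult_left_mono) auto
  finally have "(u x - u x0)\<^sup>2 \<le> (sqrt (L * ?P) * L)\<^sup>2"
    using abs_le_square_iff[of _ "sqrt (L * ?P) * L"] L nn by simp
  also have "\<dots> = L ^ 3 * ?P" using L nn by (simp add: power_mult_distrib power3_eq_cube power2_eq_square)
  finally have 2: "(u x - u x0)\<^sup>2 \<le> L ^ 3 * ?P" .
  have "(u x)\<^sup>2 \<le> 2 * (u x - u x0)\<^sup>2 + 2 * (u x0)\<^sup>2"
    using zero_le_power2[of "u x - 2 * u x0"] by (simp add: power2_eq_square algebra_simps)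
  also have "\<dots> \<le> 2 * (L ^ 3 * ?P) + 2 * (1 / L * ?U)" using 1 2 by simp
  also have "\<dots> \<le> (2 / L + 2 * L ^ 3) * (?P + ?U)" using nn L by (simp add: algebra_simps)
  also have "?P + ?U = integral {0..L} (\<lambda>x. (p x)\<^sup>2 + (u x)\<^sup>2)"
    by (intro integral_add[symmetric] integrable_continuous_real continuous_intros zD)
  finally show ?thesis .
qed

text \<open>Positive definiteness by the discriminant, uniformly in \<open>q\<close>; with a = u''
  and b = u this is where the upper bound on q^2 enters.\<close>

lemma coercive_form:
  assumes \<theta>: "q2\<^sup>2 < 4 * \<theta>"
  obtains \<nu> where "\<nu> > 0" "\<And>q a b :: real. 0 \<le> q \<Longrightarrow> q \<le> q2 \<Longrightarrow>
    \<nu> * (a\<^sup>2 + b\<^sup>2) \<le> a\<^sup>2 / 2 + \<theta> / 2 * b\<^sup>2 + q / 2 * (a * b)"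
proof -
  have \<theta>0: "\<theta> > 0" using \<theta> zero_le_power2[of q2] by linarith
  \<comment> \<open>Strictly between the critical ratio and 1, so that completing the square with
    weight \<open>\<tau>\<close> leaves room in both coefficients.\<close>
  define \<tau> where "\<tau> = (q2\<^sup>2 / (4 * \<theta>) + 1) / 2"
  have 1: "q2\<^sup>2 / (4 * \<theta>) < 1" "0 \<le> q2\<^sup>2 / (4 * \<theta>)" using \<theta> \<theta>0 by auto
  then have \<tau>: "0 < \<tau>" "\<tau> < 1" "q2\<^sup>2 / (4 * \<theta>) < \<tau>" by (auto simp: \<tau>_def)
  then have \<tau>2: "q2\<^sup>2 / (4 * \<tau>) < \<theta>" using \<theta>0 by (simp add: field_simps)
  define \<nu> where "\<nu> = min (1 - \<tau>) (\<theta> - q2\<^sup>2 / (4 * \<tau>)) / 2"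
  have "\<nu> * (a\<^sup>2 + b\<^sup>2) \<le> a\<^sup>2 / 2 + \<theta> / 2 * b\<^sup>2 + q / 2 * (a * b)" if q: "0 \<le> q" "q \<le> q2" for q a b
  proof -
    have "0 \<le> \<tau> * (a + q * b / (2 * \<tau>))\<^sup>2" using \<tau> by simp
    also have "\<dots> = \<tau> * a\<^sup>2 + q * (a * b) + q\<^sup>2 / (4 * \<tau>) * b\<^sup>2"
      using \<tau> by (simp add: power2_eq_square field_simps)
    also have "q\<^sup>2 / (4 * \<tau>) * b\<^sup>2 \<le> q2\<^sup>2 / (4 * \<tau>) * b\<^sup>2"
      using q \<tau> by (intro mult_right_mono divide_right_mono power_mono) auto
    finally have "- (\<tau> * a\<^sup>2) - q2\<^sup>2 / (4 * \<tau>) * b\<^sup>2 \<le> q * (a * b)" by simp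
    moreover have "2 * \<nu> * a\<^sup>2 \<le> (1 - \<tau>) * a\<^sup>2" "2 * \<nu> * b\<^sup>2 \<le> (\<theta> - q2\<^sup>2 / (4 * \<tau>)) * b\<^sup>2"
      by (intro mult_right_mono; simp add: \<nu>_def)+
    ultimately show ?thesis by (simp add: algebra_simps)
  qed
  moreover have "\<nu> > 0" using \<tau> \<tau>2 by (simp add: \<nu>_def)
  ultimately show ?thesis by (rule_tac that)
qed

text \<open>While \<open>S z\<close> is at most \<rho>^2 / C, \<open>sobolev\<close> keeps u in the
  range where \<open>F\<close> dominates its quadratic part, and J is at least
  \<open>\<nu> * S z\<close>. An endpoint with negative J therefore lies outside, every path crosses
  the sphere, and the bound there depends neither on \<open>F\<close> nor on \<open>q\<close> and
  \<open>e\<close>.\<close>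

lemma barrier:
  assumes \<theta>: "q2\<^sup>2 < 4 * \<theta>" and \<rho>: "\<rho> > 0"
  obtains c0 where "c0 > 0" "\<And>F q e \<gamma>. continuous_on UNIV F \<Longrightarrow>
    (\<And>t. \<bar>t\<bar> \<le> \<rho> \<Longrightarrow> \<theta> / 2 * t\<^sup>2 \<le> F t) \<Longrightarrow> 0 \<le> q \<Longrightarrow> q \<le> q2 \<Longrightarrow> J F q e < 0 \<Longrightarrow>
    \<gamma> \<in> paths e \<Longrightarrow> c0 \<le> peak F q \<gamma>"
proof -
  obtain \<nu> where \<nu>: "\<nu> > 0" "\<And>q a b :: real. 0 \<le> q \<Longrightarrow> q \<le> q2 \<Longrightarrow>
    \<nu> * (a\<^sup>2 + b\<^sup>2) \<le> a\<^sup>2 / 2 + \<theta> / 2 * b\<^sup>2 + q / 2 * (a * b)"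
    using coercive_form[OF \<theta>] by blast
  define C where "C = 2 / L + 2 * L ^ 3"
  have C: "C > 0" using L by (simp add: C_def add_pos_pos)
  define S :: "state \<Rightarrow> real" where "S z = integral {0..L} (\<lambda>x. (snd (snd z) x)\<^sup>2 + (fst z x)\<^sup>2)" for z
  have JS: "\<nu> * S z \<le> J F q z"
    if F: "continuous_on UNIV F" "\<And>t. \<bar>t\<bar> \<le> \<rho> \<Longrightarrow> \<theta> / 2 * t\<^sup>2 \<le> F t" and q: "0 \<le> q" "q \<le> q2"
      and z: "is_state z" and S: "S z \<le> \<rho>\<^sup>2 / C" for F q z
  proof -
    obtain u v p where zz: "z = (u, v, p)" by (cases z)
    note z = z[unfolded zz]
    note zD = stateD[OF z]
    have cFu: "continuous_on {0..L} (\<lambda>x. F (u x))"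
      using continuous_on_compose2[OF F(1) zD(3)] by simp
    have u: "\<bar>u x\<bar> \<le> \<rho>" if "x \<in> {0..L}" for x
    proof -
      have "(u x)\<^sup>2 \<le> C * S z" using sobolev[OF z that] by (simp add: C_def S_def zz)
      also have "\<dots> \<le> C * (\<rho>\<^sup>2 / C)" using S C by (intro mult_left_mono) auto
      finally show ?thesis using C \<rho> abs_le_square_iff[of "u x" \<rho>] by simp
    qed
    have "((\<lambda>x. u x * v x) has_real_derivative v x * v x + u x * p x) (at x within {0..L})"
      if "x \<in> {0..L}" for x
      using DERIV_mult[OF zD(1,2)[OF that]] by (simp add: add.commute mult.commute)
    from integral_deriv[OF this, of L]
    have "integral {0..L} (\<lambda>x. v x * v x + u x * p x) = u L * v L - u 0 * v 0"
      using L by simp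
    \<comment> \<open>Adding q / 2 times this vanishing integral trades the term in u'^2 for the
      product u u'', to which the quadratic form applies.\<close>
    then have parts: "integral {0..L} (\<lambda>x. (v x)\<^sup>2 + u x * p x) = 0"
      using zD(6,7) by (simp add: power2_eq_square)
    have "\<nu> * S z = integral {0..L} (\<lambda>x. \<nu> * ((p x)\<^sup>2 + (u x)\<^sup>2))" by (simp add: S_def zz)
    also have "\<dots> \<le> integral {0..L} (\<lambda>x. ((p x)\<^sup>2 / 2 + F (u x) - q * ((v x)\<^sup>2 / 2)) + q / 2 * ((v x)\<^sup>2 + u x * p x))"
    proof (rule integral_le)
      fix x assume x: "x \<in> {0..L}"
      have "\<nu> * ((p x)\<^sup>2 + (u x)\<^sup>2) \<le> (p x)\<^sup>2 / 2 + \<theta> / 2 * (u x)\<^sup>2 + q / 2 * (p x * u x)" by (rule \<nu>(2)[OF q])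
      also have "\<theta> / 2 * (u x)\<^sup>2 \<le> F (u x)" by (rule F(2)[OF u[OF x]])
      finally show "\<nu> * ((p x)\<^sup>2 + (u x)\<^sup>2) \<le>
        ((p x)\<^sup>2 / 2 + F (u x) - q * ((v x)\<^sup>2 / 2)) + q / 2 * ((v x)\<^sup>2 + u x * p x)"
        by (simp add: algebra_simps)
    qed (intro integrable_continuous_real continuous_intros zD cFu; simp)+
    also have "\<dots> = J F q z + q / 2 * integral {0..L} (\<lambda>x. (v x)\<^sup>2 + u x * p x)"
      unfolding zz J_integral[OF F(1) z] integral_mult_right[symmetric]
      by (rule integral_add; intro integrable_continuous_real continuous_intros zD cFu; simp)
    finally show ?thesis using parts by simp
  qed
  have main: "\<nu> * (\<rho>\<^sup>2 / C) \<le> peak F q \<gamma>"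
    if F: "continuous_on UNIV F" "\<And>t. \<bar>t\<bar> \<le> \<rho> \<Longrightarrow> \<theta> / 2 * t\<^sup>2 \<le> F t" and q: "0 \<le> q" "q \<le> q2"
      and e: "J F q e < 0" and \<gamma>: "\<gamma> \<in> paths e" for F q e \<gamma>
  proof -
    have st: "is_state (\<gamma> s)" if "s \<in> {0..1}" for s using \<gamma> that by (auto simp: paths_def)
    have ends: "\<gamma> 0 = zero" "\<gamma> 1 = e" using \<gamma> by (auto simp: paths_def)
    have c: "continuous_on {0..1} (\<lambda>s. S (\<gamma> s))"
      unfolding S_def by (rule path_continuous(2)[OF \<gamma> F(1)])
    have S0: "S (\<gamma> 0) \<le> \<rho>\<^sup>2 / C" using C by (simp add: ends S_def zero_def)
    have S1: "\<rho>\<^sup>2 / C \<le> S (\<gamma> 1)"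
    proof (rule ccontr)
      assume "\<not> ?thesis"
      then have "\<nu> * S e \<le> J F q e" using st[of 1] ends by (intro JS[OF F q]) auto
      moreover have "0 \<le> S e"
        using stateD[of "fst e" "fst (snd e)" "snd (snd e)"] st[of 1] ends unfolding S_def
        by (intro integral_nonneg integrable_continuous_real continuous_intros) auto
      ultimately show False using e \<nu>(1) by (smt (verit) mult_nonneg_nonneg)
    qed
    obtain s where s: "s \<in> {0..1}" "S (\<gamma> s) = \<rho>\<^sup>2 / C"
      using IVT'[OF S0 S1 _ c] by auto
    then have "\<nu> * (\<rho>\<^sup>2 / C) \<le> J F q (\<gamma> s)" using JS[OF F q st[OF s(1)]] by simp
    also have "\<dots> \<le> peak F q \<gamma>" by (rule peak_upper[OF \<gamma> F(1) s(1)])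
    finally show ?thesis .
  qed
  have "\<nu> * (\<rho>\<^sup>2 / C) > 0" using \<nu>(1) \<rho> C by simp
  then show ?thesis by (rule that) (rule main; assumption)
qed

text \<open>A single Fourier mode, shifted so that only the values of \<open>F\<close> on the negative axis matter.\<close>

definition endpoint :: "real \<Rightarrow> state" where
  "endpoint M = (\<lambda>x. - M * (1 - cos (pi / L * x)), \<lambda>x. - M * (pi / L) * sin (pi / L * x),
    \<lambda>x. - M * (pi / L)\<^sup>2 * cos (pi / L * x))"

lemma endpoint_state: "is_state (endpoint M)"
  unfolding is_state_def endpoint_def prod.case
  using L by (auto intro!: derivative_eq_intros continuous_intros simp: power2_eq_square)

lemma endpoint_path: "(\<lambda>s. endpoint (s * M)) \<in> paths (endpoint M)"
proof -
  have "joint (\<lambda>s. fst (endpoint (s * M)))" "joint (\<lambda>s. fst (snd (endpoint (s * M))))"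
    "joint (\<lambda>s. snd (snd (endpoint (s * M))))"
    unfolding joint_def endpoint_def case_prod_unfold fst_conv snd_conv using L
    by (auto intro!: continuous_intros)
  then show ?thesis
    using endpoint_state by (auto simp: paths_def endpoint_def zero_def)
qed

text \<open>The averages over \<open>{0..L}\<close> with (pi / L)^2 = q1 / 2 give - d M^2 + C per
  unit length, and \<open>d > 0\<close> is the same as \<open>24 * a < q1\<^sup>2\<close>. One
  \<open>M\<close> serves every \<open>F\<close> with the same quadratic bound.\<close>

lemma endpoint_negative:
  assumes q1: "q1 = 2 * (pi / L)\<^sup>2" and a: "24 * a < q1\<^sup>2"
  obtains M where "M > 0" "\<And>F. continuous_on UNIV F \<Longrightarrow> (\<And>t. t \<le> 0 \<Longrightarrow> F t \<le> a * t\<^sup>2 + C) \<Longrightarrow>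
    J F q1 (endpoint M) < 0"
proof -
  define k where "k = pi / L"
  have k: "k > 0" using L by (simp add: k_def)
  define d where "d = q1\<^sup>2 / 16 - 3 / 2 * a"
  have d: "d > 0" using a by (simp add: d_def)
  \<comment> \<open>Makes M^2 d equal to \<bar>C\<bar> + d, so that the additive constant is
    outweighed.\<close>
  define M where "M = sqrt (\<bar>C\<bar> / d + 1)"
  have "0 \<le> \<bar>C\<bar> / d" using d by simp
  then have M: "M > 0" "M\<^sup>2 = \<bar>C\<bar> / d + 1" by (auto simp: M_def)
  have main: "J F q1 (endpoint M) < 0"
    if F: "continuous_on UNIV F" "\<And>t. t \<le> 0 \<Longrightarrow> F t \<le> a * t\<^sup>2 + C" for F
  proof -
    define u v p where "u x = - M * (1 - cos (k * x))" and "v x = - M * k * sin (k * x)"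
      and "p x = - M * k\<^sup>2 * cos (k * x)" for x
    have e: "endpoint M = (u, v, p)" by (simp add: endpoint_def u_def[abs_def] v_def[abs_def] p_def[abs_def] k_def)
    note z = endpoint_state[of M, unfolded e]
    note zD = stateD[OF z]
    have cFu: "continuous_on {0..L} (\<lambda>x. F (u x))"
      using continuous_on_compose2[OF F(1) zD(3)] by simp
    \<comment> \<open>An explicit antiderivative: the linear term carries the averages, and the
      oscillating terms vanish at both ends because sin(k L) = 0.\<close>
    define G where "G x = (M\<^sup>2 * (k ^ 4 / 4 - q1 * k\<^sup>2 / 4 + 3 / 2 * a) + C) * x
      + M\<^sup>2 * (k ^ 4 / 4 + q1 * k\<^sup>2 / 4 + a / 2) / k * (sin (k * x) * cos (k * x))
      - M\<^sup>2 * 2 * a / k * sin (k * x)" for x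
    define g where "g x = (p x)\<^sup>2 / 2 + (a * (u x)\<^sup>2 + C) - q1 * ((v x)\<^sup>2 / 2)" for x
    have G: "(G has_real_derivative g x) (at x within {0..L})" for x
    proof -
      have "(G has_real_derivative (M\<^sup>2 * (k ^ 4 / 4 - q1 * k\<^sup>2 / 4 + 3 / 2 * a) + C)
        + M\<^sup>2 * (k ^ 4 / 4 + q1 * k\<^sup>2 / 4 + a / 2) * ((cos (k * x))\<^sup>2 - (sin (k * x))\<^sup>2)
        - M\<^sup>2 * 2 * a * cos (k * x)) (at x within {0..L})"
        unfolding G_def using k
        by (auto intro!: derivative_eq_intros simp: field_simps power2_eq_square)
      moreover have "g x = (M\<^sup>2 * (k ^ 4 / 4 - q1 * k\<^sup>2 / 4 + 3 / 2 * a) + C)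
        + M\<^sup>2 * (k ^ 4 / 4 + q1 * k\<^sup>2 / 4 + a / 2) * ((cos (k * x))\<^sup>2 - (sin (k * x))\<^sup>2)
        - M\<^sup>2 * 2 * a * cos (k * x)"
      proof -
        have E: "(u x)\<^sup>2 = M\<^sup>2 * (1 - cos (k * x))\<^sup>2" "(v x)\<^sup>2 = M\<^sup>2 * k\<^sup>2 * (1 - (cos (k * x))\<^sup>2)"
          "(p x)\<^sup>2 = M\<^sup>2 * k ^ 4 * (cos (k * x))\<^sup>2"
          by (simp_all add: u_def v_def p_def power_mult_distrib sin_squared_eq flip: power_mult)
        show ?thesis
          unfolding g_def E sin_squared_eq by (simp add: power2_eq_square field_simps)
      qed
      ultimately show ?thesis by simp
    qed
    have "J F q1 (endpoint M) = integral {0..L} (\<lambda>x. (p x)\<^sup>2 / 2 + F (u x) - q1 * ((v x)\<^sup>2 / 2))"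
      unfolding e by (rule J_integral[OF F(1) z])
    also have "\<dots> \<le> integral {0..L} g"
    proof (rule integral_le)
      show "g integrable_on {0..L}"
        unfolding g_def[abs_def] by (intro integrable_continuous_real continuous_intros zD) auto
      have "u x \<le> 0" for x unfolding u_def using M by simp
      then show "(p x)\<^sup>2 / 2 + F (u x) - q1 * ((v x)\<^sup>2 / 2) \<le> g x" for x
        using F(2)[of "u x"] by (simp add: g_def)
    qed (intro integrable_continuous_real continuous_intros zD cFu; simp)
    also have "\<dots> = G L - G 0" using integral_deriv[OF G, of L] L by simp
    also have "\<dots> = (M\<^sup>2 * (k ^ 4 / 4 - q1 * k\<^sup>2 / 4 + 3 / 2 * a) + C) * L"
    proof -
      have "sin (k * L) = 0" using L by (simp add: k_def)
      then show ?thesis by (simp add: G_def)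
    qed
    also have "k ^ 4 / 4 - q1 * k\<^sup>2 / 4 + 3 / 2 * a = - d"
      unfolding d_def q1 k_def[symmetric] by (simp add: power2_eq_square power4_eq_xxxx)
    also have "(M\<^sup>2 * (- d) + C) * L < 0"
    proof -
      have "M\<^sup>2 * d = \<bar>C\<bar> + d" unfolding M(2) using d by (simp add: field_simps)
      then have "M\<^sup>2 * (- d) + C < 0" using d by simp
      then show ?thesis using L by (simp add: mult_neg_pos)
    qed
    finally show ?thesis .
  qed
  from M(1) show ?thesis by (rule that) (rule main; assumption)
qed

text \<open>Dropping - q B gives an upper bound for the level that is uniform in
  \<open>q \<ge> 0\<close> and in all \<open>F\<close> below the same quadratic, as the integration
  over \<open>q\<close> requires.\<close>

lemma endpoint_peak:
  assumes F: "continuous_on UNIV F" "\<And>t. t \<le> 0 \<Longrightarrow> F t \<le> a * t\<^sup>2 + C" and "0 \<le> a" "0 \<le> q" "0 \<le> M"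
  shows "peak F q (\<lambda>s. endpoint (s * M)) \<le> L * ((M * (pi / L)\<^sup>2)\<^sup>2 / 2 + (a * (2 * M)\<^sup>2 + C))"
proof (rule peak_least)
  fix s :: real assume s: "s \<in> {0..1}"
  define u v p where "u = fst (endpoint (s * M))" and "v = fst (snd (endpoint (s * M)))"
    and "p = snd (snd (endpoint (s * M)))"
  have e: "endpoint (s * M) = (u, v, p)" by (simp add: u_def v_def p_def)
  note z = endpoint_state[of "s * M", unfolded e]
  note zD = stateD[OF z]
  have cFu: "continuous_on {0..L} (\<lambda>x. F (u x))"
    using continuous_on_compose2[OF F(1) zD(3)] by simp
  have sM: "0 \<le> s * M" "s * M \<le> M" using s assms by (auto simp: mult_left_le_one_le)
  show "J F q (endpoint (s * M)) \<le> L * ((M * (pi / L)\<^sup>2)\<^sup>2 / 2 + (a * (2 * M)\<^sup>2 + C))"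
    unfolding e J_integral[OF F(1) z]
  proof (rule integral_le_const)
    fix x assume "x \<in> {0..L}"
    have "\<bar>p x\<bar> \<le> M * (pi / L)\<^sup>2"
    proof -
      have "\<bar>p x\<bar> = s * M * (pi / L)\<^sup>2 * \<bar>cos (pi / L * x)\<bar>"
        using sM s \<open>0 \<le> M\<close> by (simp add: p_def endpoint_def abs_mult)
      also have "\<dots> \<le> s * M * (pi / L)\<^sup>2 * 1" using sM by (intro mult_left_mono) auto
      also have "\<dots> \<le> M * (pi / L)\<^sup>2" using sM by (simp add: mult_right_mono)
      finally show ?thesis .
    qed
    then have 1: "(p x)\<^sup>2 \<le> (M * (pi / L)\<^sup>2)\<^sup>2"
      using abs_le_square_iff[of "p x" "M * (pi / L)\<^sup>2"] assms by simp
    have u: "u x = - (s * M * (1 - cos (pi / L * x)))" by (simp add: u_def endpoint_def)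
    have "s * M * (1 - cos (pi / L * x)) \<le> M * 2"
      using sM cos_ge_minus_one[of "pi / L * x"] by (intro mult_mono) auto
    moreover have u0: "u x \<le> 0" using sM by (simp add: u)
    ultimately have "(u x)\<^sup>2 \<le> (2 * M)\<^sup>2"
      using abs_le_square_iff[of "u x" "2 * M"] assms by (simp add: u)
    then have "a * (u x)\<^sup>2 + C \<le> a * (2 * M)\<^sup>2 + C" using assms by (simp add: mult_left_mono)
    moreover have "0 \<le> q * ((v x)\<^sup>2 / 2)" using assms by simp
    ultimately show "(p x)\<^sup>2 / 2 + F (u x) - q * ((v x)\<^sup>2 / 2) \<le> (M * (pi / L)\<^sup>2)\<^sup>2 / 2 + (a * (2 * M)\<^sup>2 + C)"
      using 1 F(2)[OF u0] by linarith
  qed (use L in \<open>auto intro!: continuous_intros zD cFu\<close>)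
qed

end

section \<open>Difference quotients of monotone functions\<close>

text \<open>The functions change with \<open>n\<close>, so differentiability of one monotone
  function says nothing. But the integral of each quotient over \<open>{a..b}\<close> telescopes and
  is at most \<open>C\<close>; Fatou's lemma makes the lower limit finite almost everywhere. A
  finite lower limit bounds the quotients only for infinitely many \<open>n\<close>, hence the
  frequently.\<close>

lemma AE_bounded_difference_quotients:
  fixes c :: "nat \<Rightarrow> real \<Rightarrow> real" and h :: "nat \<Rightarrow> real"
  assumes anti: "\<And>n. antimono (c n)" and c0: "\<And>n q. 0 \<le> c n q" and cC: "\<And>n q. 0 \<le> q \<Longrightarrow> c n q \<le> C"
    and h: "\<And>n. 0 < h n" "\<And>n. h n \<le> a" and "a \<le> b"
  shows "AE q in lborel. q \<in> {a..b} \<longrightarrow> (\<exists>K\<ge>0. \<exists>\<^sub>F n in sequentially. c n (q - h n) - c n q \<le> K * h n)"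
proof -
  have C: "0 \<le> C" using c0[of 0 0] cC[of 0 0] by simp
  have meas: "c n \<in> borel_measurable borel" for n
  proof -
    have "(\<lambda>q. - c n q) \<in> borel_measurable borel"
      using anti[of n] by (intro borel_measurable_mono) (auto simp: mono_def antimono_def)
    then have "(\<lambda>q. - (- c n q)) \<in> borel_measurable borel" by (rule borel_measurable_uminus)
    then show ?thesis by simp
  qed
  define d where "d n q = (c n (q - h n) - c n q) / h n" for n q
  have d0: "0 \<le> d n q" for n q
    using anti[of n] h(1)[of n] by (simp add: d_def antimono_def less_imp_le)
  have [measurable]: "d n \<in> borel_measurable borel" for n
    unfolding d_def using measurable_compose[OF _ meas, of "\<lambda>q. q - h n" borel n] meas[of n] by simp
  have int: "(\<integral>\<^sup>+q. ennreal (indicator {a..b} q * d n q) \<partial>lborel) \<le> ennreal C" for n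
  proof -
    have io: "c n integrable_on {x..y}" for x y
    proof -
      have "(\<lambda>q. - c n q) integrable_on {x..y}"
        using anti[of n] by (intro integrable_on_mono_on) (auto simp: monotone_on_def antimono_def)
      from integrable_neg[OF this] show ?thesis by simp
    qed
    let ?I = "\<lambda>x y. integral {x..y} (c n)"
    have a: "0 \<le> a - h n" using h(2)[of n] by simp
    have "((\<lambda>q. c n (q - h n)) has_integral ?I (a - h n) (b - h n)) {a..b}"
      using has_integral_shift_Icc_real[of "c n" "- h n" "?I (a - h n) (b - h n)" a b]
        integrable_integral[OF io[of "a - h n" "b - h n"]] by (simp add: o_def)
    from has_integral_divide[OF has_integral_diff[OF this integrable_integral[OF io]], of "h n"]
    have hi: "(d n has_integral (?I (a - h n) (b - h n) - ?I a b) / h n) {a..b}"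
      by (simp add: d_def[abs_def])
    \<comment> \<open>After the shift only an integral of length \<open>h n\<close> just left of
      \<open>a\<close>, at most \<open>C * h n\<close>, and a nonnegative one just left of
      \<open>b\<close>, which is subtracted, remain. The condition \<open>h n \<le> a\<close> keeps
      the first where the bound by \<open>C\<close> holds.\<close>
    have "?I (a - h n) (b - h n) + ?I (b - h n) b = ?I (a - h n) b" "?I (a - h n) a + ?I a b = ?I (a - h n) b"
      using h(1)[of n] \<open>a \<le> b\<close> by (intro Henstock_Kurzweil_Integration.integral_combine io; simp)+
    moreover have "0 \<le> ?I (b - h n) b" by (intro integral_nonneg io c0)
    moreover have "?I (a - h n) a \<le> C * h n"
      using integral_le[OF io[of "a - h n" a] integrable_const_ivl, of C] cC a h(1)[of n] by (auto simp: mult.commute)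
    ultimately have "(?I (a - h n) (b - h n) - ?I a b) / h n \<le> C" using h(1)[of n] by (simp add: field_simps)
    moreover have "(\<integral>\<^sup>+q. ennreal (indicator {a..b} q * d n q) \<partial>lborel) = ennreal ((?I (a - h n) (b - h n) - ?I a b) / h n)"
    proof (rule nn_integral_has_integral_lborel)
      have "(\<lambda>q. if q \<in> {a..b} then d n q else 0) = (\<lambda>q. indicator {a..b} q * d n q)"
        by (auto simp: fun_eq_iff)
      with hi show "((\<lambda>q. indicator {a..b} q * d n q) has_integral
          (?I (a - h n) (b - h n) - ?I a b) / h n) UNIV"
        using has_integral_restrict_UNIV[of "{a..b}" "d n"] by simp
    qed (use d0 in \<open>auto simp: indicator_def\<close>)
    ultimately show ?thesis by (simp add: ennreal_leI)
  qed
  have "(\<integral>\<^sup>+q. liminf (\<lambda>n. ennreal (indicator {a..b} q * d n q)) \<partial>lborel) \<le>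
      liminf (\<lambda>n. \<integral>\<^sup>+q. ennreal (indicator {a..b} q * d n q) \<partial>lborel)"
    by (rule nn_integral_liminf) measurable
  also have "\<dots> \<le> ennreal C"
    using Liminf_mono[OF always_eventually[OF allI[OF int]], of sequentially] by (simp add: Liminf_const)
  finally have "(\<integral>\<^sup>+q. liminf (\<lambda>n. ennreal (indicator {a..b} q * d n q)) \<partial>lborel) \<noteq> \<infinity>"
    using ennreal_less_top[of C] by (auto simp: top_unique)
  then have "AE q in lborel. liminf (\<lambda>n. ennreal (indicator {a..b} q * d n q)) \<noteq> \<infinity>"
    by (intro nn_integral_noteq_infinite) measurable
  then show ?thesis
  proof (rule eventually_mono, intro impI)
    fix q assume fin: "liminf (\<lambda>n. ennreal (indicator {a..b} q * d n q)) \<noteq> \<infinity>" and q: "q \<in> {a..b}"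
    then have "liminf (\<lambda>n. ennreal (d n q)) \<noteq> \<infinity>" by simp
    then obtain r where r: "0 \<le> r" "liminf (\<lambda>n. ennreal (d n q)) = ennreal r"
      by (cases "liminf (\<lambda>n. ennreal (d n q))") auto
    define K where "K = r + 1"
    have K: "0 \<le> K" "liminf (\<lambda>n. ennreal (d n q)) < ennreal K"
      using r by (auto simp: K_def ennreal_less_iff)
    have "\<exists>\<^sub>F n in sequentially. ennreal (d n q) < ennreal K"
    proof (rule ccontr)
      assume "\<not> ?thesis"
      then have "\<forall>\<^sub>F n in sequentially. ennreal K \<le> ennreal (d n q)"
        by (simp add: not_frequently not_less)
      then have "ennreal K \<le> liminf (\<lambda>n. ennreal (d n q))" by (rule Liminf_bounded)
      with K show False by simp
    qed
    then have "\<exists>\<^sub>F n in sequentially. c n (q - h n) - c n q \<le> K * h n"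
    proof (rule frequently_elim1)
      fix n assume "ennreal (d n q) < ennreal K"
      then have "d n q \<le> K" using d0[of n q] by (simp add: ennreal_less_iff)
      then show "c n (q - h n) - c n q \<le> K * h n" using h(1)[of n] by (simp add: d_def field_simps)
    qed
    then show "\<exists>K\<ge>0. \<exists>\<^sub>F n in sequentially. c n (q - h n) - c n q \<le> K * h n" using K(1) by blast
  qed
qed

section \<open>Limits of almost critical states\<close>

lemma uniform_limit_comp:
  fixes g :: "real \<Rightarrow> real" and u :: "nat \<Rightarrow> real \<Rightarrow> real"
  assumes g: "continuous_on UNIV g" and u: "uniform_limit S u U sequentially"
    and M: "\<And>n x. x \<in> S \<Longrightarrow> \<bar>u n x\<bar> \<le> M"
  shows "uniform_limit S (\<lambda>n x. g (u n x)) (\<lambda>x. g (U x)) sequentially"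
proof (rule uniform_limitI)
  fix e :: real assume "e > 0"
  have UM: "\<bar>U x\<bar> \<le> M" if "x \<in> S" for x
    using LIMSEQ_le_const2[OF tendsto_rabs[OF tendsto_uniform_limitI[OF u that]]] M[OF that] by blast
  have "uniformly_continuous_on {-M..M} g"
    by (intro compact_uniformly_continuous continuous_on_subset[OF g]) auto
  then obtain d where d: "d > 0" "\<And>s t. s \<in> {-M..M} \<Longrightarrow> t \<in> {-M..M} \<Longrightarrow> dist t s < d \<Longrightarrow> dist (g t) (g s) < e"
    unfolding uniformly_continuous_on_def using \<open>e > 0\<close> by blast
  have "\<forall>\<^sub>F n in sequentially. \<forall>x\<in>S. dist (u n x) (U x) < d"
    using uniform_limitD[OF u d(1)] .
  then show "\<forall>\<^sub>F n in sequentially. \<forall>x\<in>S. dist (g (u n x)) (g (U x)) < e"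
  proof (rule eventually_mono, intro ballI)
    fix n x assume "\<forall>x\<in>S. dist (u n x) (U x) < d" and x: "x \<in> S"
    then show "dist (g (u n x)) (g (U x)) < e"
      using M[OF x, of n] UM[OF x] by (intro d(2)) (auto simp: abs_le_iff)
  qed
qed

lemma uniform_limit_indefinite_integral:
  fixes g :: "nat \<Rightarrow> real \<Rightarrow> real"
  assumes g: "uniform_limit {0..L} g G sequentially" and c: "\<And>n. continuous_on {0..L} (g n)" and "0 \<le> L"
  shows "uniform_limit {0..L} (\<lambda>n x. integral {0..x} (g n)) (\<lambda>x. integral {0..x} G) sequentially"
    and "continuous_on {0..L} G"
proof -
  show cG: "continuous_on {0..L} G"
    by (rule uniform_limit_theorem[OF _ g]) (use c in auto)
  show "uniform_limit {0..L} (\<lambda>n x. integral {0..x} (g n)) (\<lambda>x. integral {0..x} G) sequentially"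
  proof (rule uniform_limitI)
    fix e :: real assume e: "e > 0"
    define e' where "e' = e / (L + 1)"
    have e': "e' > 0" "L * e' < e" using e \<open>0 \<le> L\<close> by (auto simp: e'_def field_simps)
    from uniform_limitD[OF g e'(1)]
    show "\<forall>\<^sub>F n in sequentially. \<forall>x\<in>{0..L}. dist (integral {0..x} (g n)) (integral {0..x} G) < e"
    proof (rule eventually_mono, intro ballI)
      fix n x assume n: "\<forall>x\<in>{0..L}. dist (g n x) (G x) < e'" and x: "x \<in> {0..L}"
      have cx: "continuous_on {0..x} (g n)" "continuous_on {0..x} G"
        using x by (auto intro: continuous_on_subset[OF c[of n]] continuous_on_subset[OF cG])
      have "dist (integral {0..x} (g n)) (integral {0..x} G) = norm (integral {0..x} (\<lambda>t. g n t - G t))"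
        using cx by (simp add: dist_norm integral_diff integrable_continuous_real)
      also have "\<dots> \<le> e' * (x - 0)"
        using n x by (intro integral_bound continuous_intros cx) (auto simp: dist_norm less_imp_le)
      also have "\<dots> \<le> L * e'" using x e' by (simp add: mult.commute mult_right_mono)
      finally show "dist (integral {0..x} (g n)) (integral {0..x} G) < e" using e'(2) by simp
    qed
  qed
qed

lemma uniform_limit_const_fun:
  fixes a :: "nat \<Rightarrow> real"
  assumes "a \<longlonglongrightarrow> l" and "\<And>x. x \<in> S \<Longrightarrow> \<bar>w x\<bar> \<le> M"
  shows "uniform_limit S (\<lambda>n x. a n * w x) (\<lambda>x. l * w x) sequentially"
proof (rule uniform_limitI)
  fix e :: real assume e: "e > 0"
  have "(\<lambda>n. \<bar>a n - l\<bar> * M) \<longlonglongrightarrow> \<bar>l - l\<bar> * M" by (intro tendsto_intros assms)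
  from order_tendstoD(2)[OF this, of e] e
  have "\<forall>\<^sub>F n in sequentially. \<bar>a n - l\<bar> * M < e" by simp
  then show "\<forall>\<^sub>F n in sequentially. \<forall>x\<in>S. dist (a n * w x) (l * w x) < e"
  proof (rule eventually_mono, intro ballI)
    fix n x assume n: "\<bar>a n - l\<bar> * M < e" and x: "x \<in> S"
    have "dist (a n * w x) (l * w x) = \<bar>a n - l\<bar> * \<bar>w x\<bar>"
      by (simp add: dist_real_def abs_mult flip: left_diff_distrib)
    also have "\<dots> \<le> \<bar>a n - l\<bar> * M" using assms(2)[OF x] by (rule mult_left_mono) simp
    finally show "dist (a n * w x) (l * w x) < e" using n by simp
  qed
qed

context neumann
begin

text \<open>The second derivatives are known to be close to their limit only in the square mean.
  This is enough: u'' is the gradient part plus a part that depends on u alone and converges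
  uniformly, and one integration makes the gradient part uniformly small.\<close>

lemma limit_of_almost_critical:
  fixes F f :: "real \<Rightarrow> real" and \<kappa> \<delta> \<epsilon> :: "nat \<Rightarrow> real"
  defines "Fn \<equiv> \<lambda>n t. F t + \<kappa> n * t\<^sup>2" and "fn \<equiv> \<lambda>n t. f t + 2 * \<kappa> n * t"
  assumes F: "continuous_on UNIV F" "F 0 = 0" and f: "continuous_on UNIV f" "f 0 = 0"
    and z: "\<And>n. is_state (u n, v n, p n)"
    and \<kappa>: "\<kappa> \<longlonglongrightarrow> 0" and \<delta>: "\<delta> \<longlonglongrightarrow> 0" and slope: "\<And>n. slope (fn n) q (u n, v n, p n) \<le> \<delta> n"
    and \<epsilon>: "\<epsilon> \<longlonglongrightarrow> 0" "\<And>n. \<exists>x\<in>{0..L}. \<bar>u n x\<bar> \<le> \<epsilon> n"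
    and M: "\<And>n x. x \<in> {0..L} \<Longrightarrow> \<bar>u n x\<bar> \<le> M" and q: "0 \<le> q"
    and c: "0 < c" "\<And>n. c \<le> J (Fn n) q (u n, v n, p n)"
    and U: "uniform_limit {0..L} u U sequentially"
  obtains V P T where "\<And>x. x \<in> {0..L} \<Longrightarrow> (U has_real_derivative V x) (at x within {0..L})"
    "\<And>x. x \<in> {0..L} \<Longrightarrow> (V has_real_derivative P x) (at x within {0..L})"
    "\<And>x. x \<in> {0..L} \<Longrightarrow> (P has_real_derivative T x) (at x within {0..L})"
    "\<And>x. x \<in> {0..L} \<Longrightarrow> (T has_real_derivative - (q * P x + f (U x))) (at x within {0..L})"
    "V 0 = 0" "V L = 0" "T 0 = 0" "T L = 0" "\<not> U constant_on {0..L}"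
proof -
  have L0: "0 \<le> L" using L by simp
  have in0L: "0 \<in> {0..L}" "L \<in> {0..L}" using L by auto
  note zD = stateD[OF z]
  have cfn: "continuous_on UNIV (fn n)" and cFn: "continuous_on UNIV (Fn n)" for n
    unfolding fn_def Fn_def by (intro continuous_intros f F)+
  note fp = force_props[OF cfn z]
  have \<kappa>w: "uniform_limit {0..L} (\<lambda>n x. \<kappa> n * w n x) (\<lambda>x. 0) sequentially"
    if "\<And>n x. x \<in> {0..L} \<Longrightarrow> \<bar>w n x\<bar> \<le> K" for w :: "nat \<Rightarrow> real \<Rightarrow> real" and K
  proof (rule uniform_limitI)
    fix e :: real assume e: "e > 0"
    have "(\<lambda>n. \<bar>\<kappa> n\<bar> * K) \<longlonglongrightarrow> \<bar>0\<bar> * K" by (intro tendsto_intros \<kappa>)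
    from order_tendstoD(2)[OF this, of e] e have "\<forall>\<^sub>F n in sequentially. \<bar>\<kappa> n\<bar> * K < e" by simp
    then show "\<forall>\<^sub>F n in sequentially. \<forall>x\<in>{0..L}. dist (\<kappa> n * w n x) 0 < e"
    proof (rule eventually_mono, intro ballI)
      fix n x assume n: "\<bar>\<kappa> n\<bar> * K < e" and x: "x \<in> {0..L}"
      have "dist (\<kappa> n * w n x) 0 = \<bar>\<kappa> n\<bar> * \<bar>w n x\<bar>" by (simp add: abs_mult)
      also have "\<dots> \<le> \<bar>\<kappa> n\<bar> * K" using that[OF x] by (rule mult_left_mono) simp
      finally show "dist (\<kappa> n * w n x) 0 < e" using n by simp
    qed
  qed
  have cU: "continuous_on {0..L} U"
    by (rule uniform_limit_theorem[OF _ U]) (use zD(3) in auto)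
  have "uniform_limit {0..L} (\<lambda>n x. f (u n x) + \<kappa> n * (2 * u n x)) (\<lambda>x. f (U x) + 0) sequentially"
    using M by (intro uniform_limit_add uniform_limit_comp[OF f(1) U M] \<kappa>w[of _ "2 * M"]) (auto simp: abs_mult)
  then have l0: "uniform_limit {0..L} (\<lambda>n x. fn n (u n x)) (\<lambda>x. f (U x)) sequentially"
    by (simp add: fn_def mult_ac)
  define H1 where "H1 x = integral {0..x} (\<lambda>t. f (U t))" for x
  define H2 where "H2 x = integral {0..x} H1" for x
  have l1: "uniform_limit {0..L} (\<lambda>n. force1 (fn n) (u n)) H1 sequentially"
    using uniform_limit_indefinite_integral(1)[OF l0 fp(1) L0]
    by (simp add: force1_def[abs_def] H1_def[abs_def])
  have l2: "uniform_limit {0..L} (\<lambda>n. force2 (fn n) (u n)) H2 sequentially"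
    using uniform_limit_indefinite_integral(1)[OF l1 fp(4) L0]
    by (simp add: force2_def[abs_def] H2_def[abs_def])
  have s0: "0 \<le> slope (fn n) q (u n, v n, p n)" for n by (rule slope_nonneg[OF cfn z])
  have slope0: "(\<lambda>n. slope (fn n) q (u n, v n, p n)) \<longlonglongrightarrow> 0"
    using tendsto_sandwich[OF _ _ tendsto_const \<delta>] s0 slope by (simp add: always_eventually)
  have sq: "0 \<le> integral {0..L} (\<lambda>x. (pdir (fn n) q (u n) (p n) x)\<^sup>2)" for n
    by (intro integral_nonneg integrable_continuous_real continuous_intros residual_cont[OF cfn z]) auto
  have sq_le: "integral {0..L} (\<lambda>x. (pdir (fn n) q (u n) (p n) x)\<^sup>2) \<le> slope (fn n) q (u n, v n, p n)" for n
    by (simp add: slope_def)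
  \<comment> \<open>The force integral is a component of the gradient; its vanishing in the limit
    yields the natural boundary condition \<open>T L = 0\<close>.\<close>
  have sg0: "(\<lambda>n. force1 (fn n) (u n) L) \<longlonglongrightarrow> 0"
  proof -
    have "(\<lambda>n. (force1 (fn n) (u n) L)\<^sup>2) \<longlonglongrightarrow> 0"
    proof (rule tendsto_sandwich[OF _ _ tendsto_const slope0])
      show "\<forall>\<^sub>F n in sequentially. (force1 (fn n) (u n) L)\<^sup>2 \<le> slope (fn n) q (u n, v n, p n)"
        using sq by (intro always_eventually) (auto simp: slope_def)
    qed simp
    then show ?thesis using tendsto_real_sqrt[of "\<lambda>n. (force1 (fn n) (u n) L)\<^sup>2" 0] by (simp add: tendsto_rabs_zero_iff)
  qed
  have H1L: "H1 L = 0"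
    using LIMSEQ_unique[OF tendsto_uniform_limitI[OF l1 in0L(2)] sg0] .
  define w where "w n x = q * u n x + force2 (fn n) (u n) x - force1 (fn n) (u n) L * x" for n x
  define W where "W x = q * U x + H2 x" for x
  have "uniform_limit {0..L} (\<lambda>n x. q * u n x + force2 (fn n) (u n) x - force1 (fn n) (u n) L * x)
      (\<lambda>x. q * U x + H2 x - 0 * x) sequentially"
    by (intro uniform_limit_add uniform_limit_minus uniform_limit_const_fun[OF sg0, of _ _ L]
        bounded_linear_uniform_limit_intros U l2) auto
  then have lw: "uniform_limit {0..L} w W sequentially" by (simp add: w_def[abs_def] W_def[abs_def])
  have cw: "continuous_on {0..L} (w n)" for n
    unfolding w_def[abs_def] by (intro continuous_intros zD fp)
  define m where "m n = integral {0..L} (w n) / L" for n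
  define m0 where "m0 = integral {0..L} W / L"
  have lm: "m \<longlonglongrightarrow> m0"
    unfolding m_def m0_def using L
    by (intro tendsto_divide tendsto_const tendsto_uniform_limitI[OF uniform_limit_indefinite_integral(1)[OF lw cw L0] in0L(2)]) auto
  \<comment> \<open>Solves the definition of \<open>pdir\<close> for u''; the mean of
    \<open>residual\<close> reduces to the mean of \<open>w n\<close> because u'' has mean
    zero.\<close>
  have pdec: "p n x = pdir (fn n) q (u n) (p n) x + (m n - w n x)" for n x
  proof -
    have R: "residual (fn n) q (u n) (p n) = (\<lambda>x. p n x + w n x)"
      by (simp add: residual_def w_def fun_eq_iff)
    have "integral {0..L} (\<lambda>x. p n x + w n x) = integral {0..L} (p n) + integral {0..L} (w n)"
      by (intro integral_add integrable_continuous_real zD cw)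
    also have "integral {0..L} (p n) = 0" using integral_deriv[OF zD(2) in0L(2)] zD(6,7) by simp
    finally have "integral {0..L} (residual (fn n) q (u n) (p n)) = integral {0..L} (w n)"
      unfolding R by simp
    then show ?thesis unfolding pdir_def m_def by (simp add: R)
  qed
  define P where "P x = m0 - W x" for x
  define V where "V x = integral {0..x} P" for x
  define T where "T x = - (q * V x + H1 x)" for x
  have lP: "uniform_limit {0..L} (\<lambda>n x. m n - w n x) P sequentially"
    using uniform_limit_const_fun[OF lm, of "{0..L}" "\<lambda>_. 1" 1] lw
    unfolding P_def by (auto intro!: uniform_limit_minus)
  have cP: "continuous_on {0..L} (\<lambda>x. m n - w n x)" for n by (intro continuous_intros cw)
  have "uniform_limit {0..L} (\<lambda>n. vdir (fn n) q (u n) (p n)) (\<lambda>_. 0) sequentially"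
  proof (rule uniform_limitI)
    fix e :: real assume e: "e > 0"
    have "(\<lambda>n. sqrt (L * slope (fn n) q (u n, v n, p n))) \<longlonglongrightarrow> sqrt (L * 0)"
      by (intro tendsto_intros slope0)
    from order_tendstoD(2)[OF this, of e] e
    have "\<forall>\<^sub>F n in sequentially. sqrt (L * slope (fn n) q (u n, v n, p n)) < e" by simp
    then show "\<forall>\<^sub>F n in sequentially. \<forall>x\<in>{0..L}. dist (vdir (fn n) q (u n) (p n) x) 0 < e"
    proof (rule eventually_mono, intro ballI)
      fix n x assume n: "sqrt (L * slope (fn n) q (u n, v n, p n)) < e" and x: "x \<in> {0..L}"
      have "\<bar>vdir (fn n) q (u n) (p n) x\<bar> \<le> sqrt (L * integral {0..L} (\<lambda>x. (pdir (fn n) q (u n) (p n) x)\<^sup>2))"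
        by (rule state_bounds(1)[OF dir_state[OF cfn z] x])
      also have "\<dots> \<le> sqrt (L * slope (fn n) q (u n, v n, p n))"
        using sq_le L by (intro real_sqrt_le_mono mult_left_mono) auto
      finally show "dist (vdir (fn n) q (u n) (p n) x) 0 < e" using n by simp
    qed
  qed
  then have "uniform_limit {0..L} (\<lambda>n x. vdir (fn n) q (u n) (p n) x + integral {0..x} (\<lambda>x. m n - w n x))
      (\<lambda>x. 0 + V x) sequentially"
    unfolding V_def by (intro uniform_limit_add uniform_limit_indefinite_integral(1)[OF lP cP L0])
  moreover have "vdir (fn n) q (u n) (p n) x + integral {0..x} (\<lambda>x. m n - w n x) = v n x"
    if x: "x \<in> {0..L}" for n x
  proof -
    have "v n x = integral {0..x} (p n)" using integral_deriv[OF zD(2) x] zD(6) by simp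
    also have "\<dots> = integral {0..x} (\<lambda>x. pdir (fn n) q (u n) (p n) x + (m n - w n x))"
      by (rule integral_cong) (rule pdec)
    also have "\<dots> = integral {0..x} (pdir (fn n) q (u n) (p n)) + integral {0..x} (\<lambda>x. m n - w n x)"
      using x by (intro integral_add integrable_continuous_real continuous_on_subset[OF residual_cont(2)[OF cfn z]]
          continuous_on_subset[OF cP]) auto
    finally show ?thesis by (simp add: vdir_def)
  qed
  ultimately have lV: "uniform_limit {0..L} v V sequentially"
    using uniform_limit_cong'[of "{0..L}" "\<lambda>n x. vdir (fn n) q (u n) (p n) x + integral {0..x} (\<lambda>x. m n - w n x)" v "\<lambda>x. 0 + V x" V]
    by simp
  have U_eq: "U x = U 0 + integral {0..x} V" if x: "x \<in> {0..L}" for x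
  proof (rule LIMSEQ_unique)
    show "(\<lambda>n. u n x) \<longlonglongrightarrow> U x" by (rule tendsto_uniform_limitI[OF U x])
    have "(\<lambda>n. u n 0 + integral {0..x} (v n)) \<longlonglongrightarrow> U 0 + integral {0..x} V"
      by (intro tendsto_add tendsto_uniform_limitI[OF U in0L(1)]
          tendsto_uniform_limitI[OF uniform_limit_indefinite_integral(1)[OF lV zD(4) L0] x])
    moreover have "u n 0 + integral {0..x} (v n) = u n x" for n
      using integral_deriv[OF zD(1) x] by simp
    ultimately show "(\<lambda>n. u n x) \<longlonglongrightarrow> U 0 + integral {0..x} V" by simp
  qed
  have cV: "continuous_on {0..L} V" by (rule uniform_limit_indefinite_integral(2)[OF lV zD(4) L0])
  have cfU: "continuous_on {0..L} (\<lambda>x. f (U x))" by (rule uniform_limit_indefinite_integral(2)[OF l0 fp(1) L0])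
  have cH1: "continuous_on {0..L} H1" by (rule uniform_limit_indefinite_integral(2)[OF l1 fp(4) L0])
  have cPP: "continuous_on {0..L} P" by (rule uniform_limit_indefinite_integral(2)[OF lP cP L0])
  have dU: "(U has_real_derivative V x) (at x within {0..L})" if x: "x \<in> {0..L}" for x
  proof (rule has_field_derivative_transform_within[OF _ zero_less_one x])
    show "((\<lambda>x. U 0 + integral {0..x} V) has_real_derivative V x) (at x within {0..L})"
      using deriv_integral(1)[OF cV x] by (auto intro!: derivative_eq_intros)
  qed (rule U_eq[symmetric])
  have dH1: "(H1 has_real_derivative f (U x)) (at x within {0..L})" if "x \<in> {0..L}" for x
    using deriv_integral(1)[OF cfU that] by (simp add: H1_def[abs_def])
  have dH2: "(H2 has_real_derivative H1 x) (at x within {0..L})" if "x \<in> {0..L}" for x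
    using deriv_integral(1)[OF cH1 that] by (simp add: H2_def[abs_def])
  have dV: "(V has_real_derivative P x) (at x within {0..L})" if "x \<in> {0..L}" for x
    using deriv_integral(1)[OF cPP that] by (simp add: V_def[abs_def])
  show ?thesis
  proof (rule that[OF dU dV])
    show "(P has_real_derivative T x) (at x within {0..L})" if "x \<in> {0..L}" for x
      unfolding P_def[abs_def] W_def T_def using that by (auto intro!: derivative_eq_intros dU dH2)
    show "(T has_real_derivative - (q * P x + f (U x))) (at x within {0..L})" if "x \<in> {0..L}" for x
      unfolding T_def[abs_def] using that by (auto intro!: derivative_eq_intros dV dH1)
    show "V 0 = 0" by (simp add: V_def)
    show VL: "V L = 0"
      using LIMSEQ_unique[OF tendsto_uniform_limitI[OF lV in0L(2)], of 0] zD(7) by simp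
    show "T 0 = 0" by (simp add: T_def V_def H1_def)
    show "T L = 0" by (simp add: T_def VL H1L)
    show "\<not> U constant_on {0..L}"
    proof
      assume "U constant_on {0..L}"
      then obtain k where k: "\<And>x. x \<in> {0..L} \<Longrightarrow> U x = k" by (auto simp: constant_on_def)
      \<comment> \<open>A constant limit must be 0, since \<open>u n\<close> comes within
        \<open>\<epsilon> n\<close> of 0 somewhere. What follows excludes 0 by showing that J would
        tend to something at most 0 < c.\<close>
      have "\<bar>k\<bar> \<le> 0"
      proof (rule field_le_epsilon)
        fix e :: real assume "e > 0"
        then have "\<forall>\<^sub>F n in sequentially. \<epsilon> n < e / 2" "\<forall>\<^sub>F n in sequentially. \<forall>x\<in>{0..L}. dist (u n x) (U x) < e / 2"
          using order_tendstoD(2)[OF \<epsilon>(1), of "e / 2"] uniform_limitD[OF U, of "e / 2"] by auto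
        then have "\<forall>\<^sub>F n in sequentially. \<epsilon> n < e / 2 \<and> (\<forall>x\<in>{0..L}. dist (u n x) (U x) < e / 2)"
          by (rule eventually_conj)
        then obtain n where n: "\<epsilon> n < e / 2" "\<forall>x\<in>{0..L}. dist (u n x) (U x) < e / 2"
          by (auto simp: eventually_sequentially)
        obtain x where x: "x \<in> {0..L}" "\<bar>u n x\<bar> \<le> \<epsilon> n" using \<epsilon>(2) by blast
        then have "\<bar>u n x - k\<bar> < e / 2" using n(2) k by (auto simp: dist_real_def)
        then show "\<bar>k\<bar> \<le> 0 + e" using x n(1) by linarith
      qed
      then have U0: "U x = 0" if "x \<in> {0..L}" for x using k that by simp
      have H1z: "H1 x = 0" if "x \<in> {0..L}" for x
        unfolding H1_def using integral_cong[of "{0..x}" "\<lambda>t. f (U t)" "\<lambda>_. 0"] U0 f(2) that by auto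
      have H2z: "H2 x = 0" if "x \<in> {0..L}" for x
        unfolding H2_def using integral_cong[of "{0..x}" H1 "\<lambda>_. 0"] H1z that by auto
      have Wz: "W x = 0" if "x \<in> {0..L}" for x using U0 H2z that by (simp add: W_def)
      have m0z: "m0 = 0" unfolding m0_def using integral_cong[of "{0..L}" W "\<lambda>_. 0"] Wz by auto
      have Pz: "P x = 0" if "x \<in> {0..L}" for x using Wz m0z that by (simp add: P_def)
      have "uniform_limit {0..L} (\<lambda>n x. m n - w n x) (\<lambda>_. 0) sequentially"
        using lP Pz uniform_limit_cong'[of "{0..L}" "\<lambda>n x. m n - w n x" "\<lambda>n x. m n - w n x" P "\<lambda>_. 0"] by simp
      note lP0 = this
      have lsq: "uniform_limit {0..L} (\<lambda>n x. (m n - w n x)\<^sup>2) (\<lambda>_. 0) sequentially"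
      proof (rule uniform_limitI)
        fix e :: real assume "e > 0"
        then have "sqrt e > 0" by simp
        from uniform_limitD[OF lP0 this]
        show "\<forall>\<^sub>F n in sequentially. \<forall>x\<in>{0..L}. dist ((m n - w n x)\<^sup>2) 0 < e"
        proof (rule eventually_mono, intro ballI)
          fix n x assume "\<forall>x\<in>{0..L}. dist (m n - w n x) 0 < sqrt e" "x \<in> {0..L}"
          then have "\<bar>m n - w n x\<bar> < sqrt e" by simp
          from power_strict_mono[OF this, of 2] \<open>e > 0\<close> show "dist ((m n - w n x)\<^sup>2) 0 < e" by simp
        qed
      qed
      have lF: "uniform_limit {0..L} (\<lambda>n x. Fn n (u n x)) (\<lambda>_. 0) sequentially"
      proof -
        have "uniform_limit {0..L} (\<lambda>n x. F (u n x) + \<kappa> n * (u n x)\<^sup>2) (\<lambda>x. F (U x) + 0) sequentially"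
        proof (intro uniform_limit_add uniform_limit_comp[OF F(1) U M] \<kappa>w[of _ "M\<^sup>2"])
          show "\<bar>(u n x)\<^sup>2\<bar> \<le> M\<^sup>2" if "x \<in> {0..L}" for n x
            using power_mono[OF M[OF that, of n], of 2] by simp
        qed
        then show ?thesis
          using uniform_limit_cong'[of "{0..L}" "\<lambda>n x. Fn n (u n x)" "\<lambda>n x. Fn n (u n x)" "\<lambda>x. F (U x)" "\<lambda>_. 0"] U0 F(2)
          by (simp add: Fn_def)
      qed
      have cFu: "continuous_on {0..L} (\<lambda>x. Fn n (u n x))" for n
        using continuous_on_compose2[OF cFn zD(3)] by simp
      have "J (Fn n) q (u n, v n, p n) \<le> slope (fn n) q (u n, v n, p n) +
          integral {0..L} (\<lambda>x. (m n - w n x)\<^sup>2) + integral {0..L} (\<lambda>x. Fn n (u n x))" for n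
      proof -
        have "0 \<le> q * B (u n, v n, p n)" using q B_nonneg[OF z] by simp
        then have "J (Fn n) q (u n, v n, p n) \<le> integral {0..L} (\<lambda>x. (p n x)\<^sup>2) / 2 + integral {0..L} (\<lambda>x. Fn n (u n x))"
          using integral_split_A[OF cFn z] by (simp add: J_def)
        moreover have "integral {0..L} (\<lambda>x. (p n x)\<^sup>2) \<le>
            integral {0..L} (\<lambda>x. 2 * (pdir (fn n) q (u n) (p n) x)\<^sup>2 + 2 * (m n - w n x)\<^sup>2)"
        proof (intro integral_le integrable_continuous_real continuous_intros zD cw residual_cont[OF cfn z])
          fix x
          show "(p n x)\<^sup>2 \<le> 2 * (pdir (fn n) q (u n) (p n) x)\<^sup>2 + 2 * (m n - w n x)\<^sup>2"
            unfolding pdec[of n x]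
            using zero_le_power2[of "pdir (fn n) q (u n) (p n) x - (m n - w n x)"]
            by (simp add: power2_eq_square algebra_simps)
        qed
        moreover have "integral {0..L} (\<lambda>x. 2 * (pdir (fn n) q (u n) (p n) x)\<^sup>2 + 2 * (m n - w n x)\<^sup>2)
            = 2 * integral {0..L} (\<lambda>x. (pdir (fn n) q (u n) (p n) x)\<^sup>2) + 2 * integral {0..L} (\<lambda>x. (m n - w n x)\<^sup>2)"
          unfolding integral_mult_right[symmetric]
          by (intro integral_add integrable_continuous_real continuous_intros cw residual_cont[OF cfn z])
        ultimately show ?thesis using sq_le[of n] by linarith
      qed
      then have le: "c \<le> slope (fn n) q (u n, v n, p n) +
          integral {0..L} (\<lambda>x. (m n - w n x)\<^sup>2) + integral {0..L} (\<lambda>x. Fn n (u n x))" for n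
        using c(2)[of n] by (rule order_trans[rotated])
      have "(\<lambda>n. slope (fn n) q (u n, v n, p n) + integral {0..L} (\<lambda>x. (m n - w n x)\<^sup>2)
          + integral {0..L} (\<lambda>x. Fn n (u n x))) \<longlonglongrightarrow> 0 + integral {0..L} (\<lambda>_. 0) + integral {0..L} (\<lambda>_. 0)"
        by (intro tendsto_add slope0
            tendsto_uniform_limitI[OF uniform_limit_indefinite_integral(1)[OF lsq _ L0] in0L(2)]
            tendsto_uniform_limitI[OF uniform_limit_indefinite_integral(1)[OF lF cFu L0] in0L(2)]
            continuous_intros cw)
      from LIMSEQ_le_const[OF this] le have "c \<le> 0" by auto
      with c(1) show False by simp
    qed
  qed
qed

end

section \<open>Existence for almost every parameter\<close>

text \<open>If u avoided [-\<epsilon>, \<epsilon>], continuity would keep it on one side, and the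
  force integral, whose square is at most the slope, would be at least \<open>L * k\<close> in
  absolute value.\<close>

lemma (in neumann) small_slope_hits_zero:
  assumes f: "continuous_on UNIV f" and z: "is_state (u, v, p)"
    and pos: "\<And>t. \<epsilon> \<le> t \<Longrightarrow> k \<le> f t" and neg: "\<And>t. t \<le> - \<epsilon> \<Longrightarrow> f t \<le> - k" and "0 < k"
    and slope: "slope f q (u, v, p) < (L * k)\<^sup>2" and \<epsilon>: "0 \<le> \<epsilon>"
  shows "\<exists>x\<in>{0..L}. \<bar>u x\<bar> \<le> \<epsilon>"
proof (rule ccontr)
  assume "\<not> ?thesis"
  then have far: "\<epsilon> < u x \<or> u x < - \<epsilon>" if "x \<in> {0..L}" for x
    using that by (force simp: not_le abs_if split: if_splits)
  have cu: "continuous_on {0..L} u" by (rule stateD(3)[OF z])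
  have c: "continuous_on {0..L} (\<lambda>x. f (u x))" by (rule force_props(1)[OF f z])
  have "\<bar>force1 f u L\<bar> < L * k"
  proof -
    have "(force1 f u L)\<^sup>2 \<le> slope f q (u, v, p)"
      by (simp add: slope_def) (intro integral_nonneg integrable_continuous_real continuous_intros residual_cont[OF f z]; simp)
    then have "(force1 f u L)\<^sup>2 < (L * k)\<^sup>2" using slope by simp
    then show ?thesis using power2_less_imp_less[of "\<bar>force1 f u L\<bar>" "L * k"] L \<open>0 < k\<close> by simp
  qed
  moreover have "(\<forall>x\<in>{0..L}. \<epsilon> < u x) \<or> (\<forall>x\<in>{0..L}. u x < - \<epsilon>)"
  proof (rule ccontr)
    assume "\<not> ?thesis"
    then obtain x y where xy: "x \<in> {0..L}" "y \<in> {0..L}" "u x < - \<epsilon>" "\<epsilon> < u y" using far by blast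
    have "connected (u ` {0..L})" by (intro connected_continuous_image cu) simp
    then have "0 \<in> u ` {0..L}" using xy \<epsilon> connectedD_interval[of "u ` {0..L}" "u x" "u y" 0] by auto
    then show False using far \<epsilon> by force
  qed
  then have "L * k \<le> \<bar>force1 f u L\<bar>"
  proof
    assume "\<forall>x\<in>{0..L}. \<epsilon> < u x"
    then have "L * k \<le> force1 f u L"
      unfolding force1_def using L by (intro const_le_integral c pos) (auto intro: less_imp_le)
    then show ?thesis by simp
  next
    assume "\<forall>x\<in>{0..L}. u x < - \<epsilon>"
    then have "force1 f u L \<le> L * (- k)"
      unfolding force1_def using L by (intro integral_le_const c neg) (auto intro: less_imp_le)
    then show ?thesis by simp
  qed
  ultimately show False by simp
qed

lemma quadratic_lower_bound:
  fixes F :: "real \<Rightarrow> real"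
  assumes F: "\<And>t. (F has_real_derivative f t) (at t)" and f: "\<And>t. (f has_real_derivative f' t) (at t)"
    and f': "continuous_on UNIV f'" and F0: "F 0 = 0" "f 0 = 0" and \<theta>: "\<theta> < f' 0"
  obtains \<rho> where "\<rho> > 0" "\<And>t. \<bar>t\<bar> \<le> \<rho> \<Longrightarrow> \<theta> / 2 * t\<^sup>2 \<le> F t"
proof -
  have "isCont (\<lambda>t. - f' t) 0" using f' by (simp add: continuous_on_eq_continuous_at)
  then obtain e where e: "e > 0" "\<And>t. dist t 0 < e \<Longrightarrow> - f' t < - \<theta>"
    using near_less[of 0 "\<lambda>t. - f' t" "- \<theta>"] \<theta> by auto
  have "\<theta> / 2 * t\<^sup>2 \<le> F t" if t: "\<bar>t\<bar> \<le> e / 2" for t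
  proof -
    define d where "d n = [F, f, f'] ! n" for n
    have "\<exists>s. \<bar>s\<bar> \<le> \<bar>t\<bar> \<and> F t = (\<Sum>m<2. d m 0 / fact m * t ^ m) + d 2 s / fact 2 * t ^ 2"
    proof (rule Maclaurin_bi_le)
      show "\<forall>m s. m < 2 \<and> \<bar>s\<bar> \<le> \<bar>t\<bar> \<longrightarrow> (d m has_real_derivative d (Suc m) s) (at s)"
        using F f by (auto simp: d_def less_Suc_eq numeral_2_eq_2)
    qed (simp add: d_def)
    then obtain s where s: "\<bar>s\<bar> \<le> \<bar>t\<bar>" "F t = f' s / 2 * t\<^sup>2"
      using F0 by (auto simp: d_def numeral_2_eq_2)
    have "\<theta> \<le> f' s" using e(2)[of s] s(1) t e(1) by simp
    then show ?thesis unfolding s(2) by (intro mult_right_mono divide_right_mono) auto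
  qed
  moreover have "e / 2 > 0" using e by simp
  ultimately show ?thesis by (rule_tac that)
qed

lemma equi_lipschitz_subsequence:
  fixes u :: "nat \<Rightarrow> real \<Rightarrow> real"
  assumes M: "\<And>n x. x \<in> {0..L} \<Longrightarrow> \<bar>u n x\<bar> \<le> M"
    and lip: "\<And>n x y. x \<in> {0..L} \<Longrightarrow> y \<in> {0..L} \<Longrightarrow> \<bar>u n x - u n y\<bar> \<le> k * \<bar>x - y\<bar>" and k: "0 \<le> k"
  obtains U r where "strict_mono (r :: nat \<Rightarrow> nat)" "uniform_limit {0..L} (\<lambda>n. u (r n)) U sequentially"
proof -
  have equi: "\<exists>d>0. \<forall>n y. y \<in> {0..L} \<and> norm (x - y) < d \<longrightarrow> norm (u n x - u n y) < e"
    if x: "x \<in> {0..L}" and e: "0 < e" for x e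
  proof (intro exI[of _ "e / (k + 1)"] conjI allI impI)
    show "0 < e / (k + 1)" using e k by simp
    fix n y assume y: "y \<in> {0..L} \<and> norm (x - y) < e / (k + 1)"
    then have "norm (u n x - u n y) \<le> k * \<bar>x - y\<bar>" using lip x by simp
    also have "\<dots> \<le> k * (e / (k + 1))" using y k by (intro mult_left_mono) auto
    also have "\<dots> < e" using e k by (simp add: field_simps)
    finally show "norm (u n x - u n y) < e" .
  qed
  from Arzela_Ascoli[of "{0..L}" u M, OF compact_Icc _ equi] M
  obtain U r where r: "strict_mono (r :: nat \<Rightarrow> nat)"
    "\<And>e. 0 < e \<Longrightarrow> \<exists>N. \<forall>n x. n \<ge> N \<and> x \<in> {0..L} \<longrightarrow> norm (u (r n) x - U x) < e"
    by (metis real_norm_def)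
  have "uniform_limit {0..L} (\<lambda>n. u (r n)) U sequentially"
  proof (rule uniform_limitI)
    fix e :: real assume "e > 0"
    from r(2)[OF this] obtain N where
      "\<And>n x. N \<le> n \<Longrightarrow> x \<in> {0..L} \<Longrightarrow> norm (u (r n) x - U x) < e" by blast
    then show "\<forall>\<^sub>F n in sequentially. \<forall>x\<in>{0..L}. dist (u (r n) x) (U x) < e"
      unfolding dist_norm by (intro eventually_sequentiallyI[of N] ballI) blast
  qed
  with r(1) show ?thesis by (rule_tac that)
qed

text \<open>J decreases with \<open>q\<close>, so an endpoint that is negative at \<open>q1\<close>
  is negative on the whole interval, while the barrier is taken at \<open>q2\<close>. Thus one
  \<open>L\<close>, one endpoint and one barrier height serve all \<open>q\<close> and all
  \<open>n\<close>.\<close>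

lemma AE_solution_monotone:
  fixes F :: "real \<Rightarrow> real"
  assumes F: "\<And>t. (F has_real_derivative deriv F t) (at t)"
    and f: "\<And>t. (deriv F has_real_derivative f' t) (at t)" and f': "continuous_on UNIV f'"
    and F0: "F 0 = 0" "\<And>t. 0 \<le> F t"
    and sign: "\<And>t. 0 \<le> t \<Longrightarrow> 0 \<le> deriv F t" "\<And>t. t \<le> 0 \<Longrightarrow> deriv F t \<le> 0"
    and q12: "0 < q1" "q1 \<le> q2" "q2\<^sup>2 < 4 * f' 0"
    and a: "0 \<le> a" "24 * a < q1\<^sup>2" "\<And>t. t \<le> - t0 \<Longrightarrow> F t \<le> a * t\<^sup>2"
  shows "AE q in lborel. q \<in> {q1..q2} \<longrightarrow> (\<exists>u. is_solution q F u \<and> nontrivial u \<and> periodic u)"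
proof -
  let ?f = "deriv F"
  have cF: "continuous_on UNIV F" and cf: "continuous_on UNIV ?f"
    using F f by (auto intro: DERIV_continuous_on)
  have f0: "?f 0 = 0" using sign(1)[of 0] sign(2)[of 0] by simp
  \<comment> \<open>Gives (pi / L)^2 = q1 / 2, the minimiser of k^4 - q1 k^2 as a function of
    k^2.\<close>
  define L where "L = pi / sqrt (q1 / 2)"
  have L: "L > 0" using q12 by (simp add: L_def)
  have Lq: "q1 = 2 * (pi / L)\<^sup>2" using q12 by (simp add: L_def)
  interpret neumann L by standard (rule L)
  obtain C where C: "\<And>t. t \<le> 0 \<Longrightarrow> F t \<le> a * t\<^sup>2 + C"
  proof -
    obtain C where C: "C \<ge> 0" "\<And>t. \<bar>t\<bar> \<le> t0 \<Longrightarrow> \<bar>F t\<bar> \<le> C" using bounded_on_interval[OF cF] by blast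
    have "F t \<le> a * t\<^sup>2 + C" if "t \<le> 0" for t
    proof (cases "t \<le> - t0")
      case True then show ?thesis using a(3) C(1) by (simp add: add_increasing2)
    next
      case False
      then have "F t \<le> C" using C(2)[of t] that by simp
      moreover have "0 \<le> a * t\<^sup>2" using a by simp
      ultimately show ?thesis by simp
    qed
    then show ?thesis by (rule that)
  qed
  \<comment> \<open>The midpoint leaves room for the added quadratic:
    \<open>\<kappa> n \<le> a' - a\<close> keeps \<open>Fn n\<close> below a' t^2 + C on the
    negative axis, with \<open>24 * a'\<close> still below q1^2.\<close>
  define a' where "a' = (a + q1\<^sup>2 / 24) / 2"
  have a': "0 \<le> a'" "24 * a' < q1\<^sup>2" "a < a'" using a by (auto simp: a'_def)
  define \<kappa> where "\<kappa> n = (a' - a) / (real n + 1)" for n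
  have \<kappa>: "0 < \<kappa> n" "\<kappa> n \<le> a' - a" for n using a' by (auto simp: \<kappa>_def divide_le_eq intro: mult_left_mono[of 1 "real n + 1" "a' - a", simplified])
  define Fn where "Fn n t = F t + \<kappa> n * t\<^sup>2" for n t
  define fn where "fn n t = ?f t + 2 * \<kappa> n * t" for n t
  have dFn: "(Fn n has_real_derivative fn n t) (at t)" for n t
    unfolding Fn_def fn_def by (auto intro!: derivative_eq_intros F)
  have dfn: "(fn n has_real_derivative f' t + 2 * \<kappa> n) (at t)" for n t
    unfolding fn_def by (auto intro!: derivative_eq_intros f)
  have cFn: "continuous_on UNIV (Fn n)" and cfn: "continuous_on UNIV (fn n)" for n
    using DERIV_continuous_on[of UNIV "Fn n" "fn n"] dFn
      DERIV_continuous_on[of UNIV "fn n" "\<lambda>t. f' t + 2 * \<kappa> n"] dfn by simp_all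
  have Fn0: "Fn n 0 = 0" for n by (simp add: Fn_def F0)
  have Fn_upper: "Fn n t \<le> a' * t\<^sup>2 + C" if "t \<le> 0" for n t
  proof -
    have "\<kappa> n * t\<^sup>2 \<le> (a' - a) * t\<^sup>2" using \<kappa> by (intro mult_right_mono) auto
    then show ?thesis using C[OF that] by (simp add: Fn_def algebra_simps)
  qed
  obtain M where M: "M > 0" "\<And>F. continuous_on UNIV F \<Longrightarrow> (\<And>t. t \<le> 0 \<Longrightarrow> F t \<le> a' * t\<^sup>2 + C) \<Longrightarrow>
      J F q1 (endpoint M) < 0"
    using endpoint_negative[OF Lq a'(2)] by blast
  define e where "e = endpoint M"
  have Je: "J (Fn n) q e < 0" if "q1 \<le> q" for n q
  proof -
    have "J (Fn n) q1 e < 0" unfolding e_def by (rule M(2)[OF cFn Fn_upper])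
    moreover have "J (Fn n) q e \<le> J (Fn n) q1 e"
      using mult_right_mono[OF that B_nonneg[OF endpoint_state[of M]]] by (simp add: J_def e_def)
    ultimately show ?thesis by simp
  qed
  have path: "(\<lambda>s. endpoint (s * M)) \<in> paths e" unfolding e_def by (rule endpoint_path)
  then have ne: "paths e \<noteq> {}" by blast
  define \<theta> where "\<theta> = (q2\<^sup>2 / 4 + f' 0) / 2"
  have \<theta>: "q2\<^sup>2 < 4 * \<theta>" "\<theta> < f' 0" using q12 by (auto simp: \<theta>_def)
  obtain \<rho> where \<rho>: "\<rho> > 0" "\<And>t. \<bar>t\<bar> \<le> \<rho> \<Longrightarrow> \<theta> / 2 * t\<^sup>2 \<le> F t"
    using quadratic_lower_bound[OF F f f' F0(1) f0 \<theta>(2)] by blast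
  have \<rho>n: "\<theta> / 2 * t\<^sup>2 \<le> Fn n t" if "\<bar>t\<bar> \<le> \<rho>" for n t
  proof -
    have "0 \<le> \<kappa> n * t\<^sup>2" using \<kappa>[of n] by simp
    then show ?thesis using \<rho>(2)[OF that] by (simp add: Fn_def)
  qed
  obtain c0 where c0: "c0 > 0" "\<And>F q e \<gamma>. continuous_on UNIV F \<Longrightarrow>
      (\<And>t. \<bar>t\<bar> \<le> \<rho> \<Longrightarrow> \<theta> / 2 * t\<^sup>2 \<le> F t) \<Longrightarrow> 0 \<le> q \<Longrightarrow> q \<le> q2 \<Longrightarrow> J F q e < 0 \<Longrightarrow>
      \<gamma> \<in> paths e \<Longrightarrow> c0 \<le> peak F q \<gamma>"
    using barrier[OF \<theta>(1) \<rho>(1)] by blast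
  have low: "c0 \<le> level (Fn n) e q" if "q1 \<le> q" "q \<le> q2" for n q
    by (rule level_ge[OF cFn Fn0 ne], rule c0(2)[OF cFn \<rho>n]) (use that q12 Je in auto)
  define C1 where "C1 = L * ((M * (pi / L)\<^sup>2)\<^sup>2 / 2 + (a' * (2 * M)\<^sup>2 + C))"
  have up: "level (Fn n) e q \<le> C1" if "0 \<le> q" for n q
    using level_le[OF cFn Fn0 ne path, of n q] endpoint_peak[OF cFn Fn_upper a'(1) that, of M n] M(1)
    by (simp add: C1_def)
  have nonneg: "0 \<le> level (Fn n) e q" for n q by (rule level_nonneg[OF cFn Fn0 ne])
  define \<epsilon> where "\<epsilon> n = 1 / (real n + 1)" for n
  \<comment> \<open>Outside \<open>{- \<epsilon> n..\<epsilon> n}\<close> the perturbed force has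
    size at least \<open>2 * \<kappa> n * \<epsilon> n\<close>, so this is the threshold of
    \<open>small_slope_hits_zero\<close>.\<close>
  define \<delta> where "\<delta> n = (L * (2 * \<kappa> n * \<epsilon> n))\<^sup>2" for n
  have \<epsilon>: "0 < \<epsilon> n" "\<epsilon> n \<le> 1" for n by (auto simp: \<epsilon>_def)
  have \<delta>: "0 < \<delta> n" for n using L \<kappa>[of n] \<epsilon>[of n] by (simp add: \<delta>_def)
  \<comment> \<open>The bound on B needed later is \<open>K + 2\<close>, where \<open>K\<close>
    depends on \<open>q\<close>. Letting \<open>D n\<close> grow with \<open>n\<close> allows the
    step size to be fixed before \<open>K\<close> is known.\<close>
  define D where "D n = C1 + 1 + (real n + 2)" for n
  have Fn_coercive: "\<kappa> n * t\<^sup>2 \<le> Fn n t" for n t using F0(2)[of t] by (simp add: Fn_def)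
  have "\<exists>\<eta>>0. \<forall>q z \<eta>'. 0 \<le> q \<longrightarrow> q \<le> q2 \<longrightarrow> is_state z \<longrightarrow> J (Fn n) q z \<le> D n \<longrightarrow> B z \<le> D n \<longrightarrow>
      0 \<le> \<eta>' \<longrightarrow> \<eta>' \<le> \<eta> \<longrightarrow> J (Fn n) q (step (fn n) q \<eta>' z) \<le> J (Fn n) q z - \<eta>' / 2 * slope (fn n) q z" for n
  proof -
    have c: "continuous_on UNIV (\<lambda>t. f' t + 2 * \<kappa> n)" by (intro continuous_intros f')
    have Q: "0 \<le> q2" using q12 by simp
    obtain \<eta> where "0 < \<eta>" and "\<And>q z \<eta>'. 0 \<le> q \<Longrightarrow> q \<le> q2 \<Longrightarrow> is_state z \<Longrightarrow>
      J (Fn n) q z \<le> D n \<Longrightarrow> B z \<le> D n \<Longrightarrow> 0 \<le> \<eta>' \<Longrightarrow> \<eta>' \<le> \<eta> \<Longrightarrow>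
      J (Fn n) q (step (fn n) q \<eta>' z) \<le> J (Fn n) q z - \<eta>' / 2 * slope (fn n) q z"
      by (rule uniform_descent[OF dFn[of n] dfn[of n] c \<kappa>(1)[of n] Fn_coercive Q, where D = "D n"])
        (rule that; assumption)
    then show ?thesis by (intro exI[of _ \<eta>]) simp
  qed
  then obtain \<eta> where \<eta>: "\<And>n. 0 < \<eta> n" "\<And>n q z \<eta>'. 0 \<le> q \<Longrightarrow> q \<le> q2 \<Longrightarrow> is_state z \<Longrightarrow>
      J (Fn n) q z \<le> D n \<Longrightarrow> B z \<le> D n \<Longrightarrow> 0 \<le> \<eta>' \<Longrightarrow> \<eta>' \<le> \<eta> n \<Longrightarrow>
      J (Fn n) q (step (fn n) q \<eta>' z) \<le> J (Fn n) q z - \<eta>' / 2 * slope (fn n) q z"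
    by metis
  \<comment> \<open>The bounds serve in turn: \<open>q - h n \<ge> 0\<close>; a level still at least
    \<open>c0 / 2\<close> after losing \<open>h n\<close>; \<open>(K + 1) * h n \<le> 1\<close>;
    and, in the monotonicity trick, a full step outweighing \<open>(K + 2) * h n\<close>. The last
    two hold as soon as \<open>K \<le> n\<close>.\<close>
  define h where "h n = min (min q1 (c0 / 2)) (min (1 / (real n + 1)) (\<eta> n * \<delta> n / (2 * (real n + 2))))" for n
  have h: "0 < h n" "h n \<le> q1" "h n \<le> c0 / 2" "h n \<le> 1 / (real n + 1)" "h n \<le> \<eta> n * \<delta> n / (2 * (real n + 2))" for n
  proof -
    have "0 < 1 / (real n + 1)" "0 < \<eta> n * \<delta> n / (2 * (real n + 2))"
      using \<eta>(1)[of n] \<delta>[of n] by simp_all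
    then show "0 < h n" "h n \<le> q1" "h n \<le> c0 / 2" "h n \<le> 1 / (real n + 1)"
      "h n \<le> \<eta> n * \<delta> n / (2 * (real n + 2))"
      unfolding h_def using q12(1) c0(1) by linarith+
  qed
  have "AE q in lborel. q \<in> {q1..q2} \<longrightarrow> (\<exists>K\<ge>0. \<exists>\<^sub>F n in sequentially.
      level (Fn n) e (q - h n) - level (Fn n) e q \<le> K * h n)"
    by (rule AE_bounded_difference_quotients[OF level_antimono[OF cFn Fn0 ne] nonneg up h(1,2) q12(2)])
  then show ?thesis
  proof (rule eventually_mono, intro impI)
    fix q assume "q \<in> {q1..q2} \<longrightarrow> (\<exists>K\<ge>0. \<exists>\<^sub>F n in sequentially.
      level (Fn n) e (q - h n) - level (Fn n) e q \<le> K * h n)" and q: "q \<in> {q1..q2}"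
    then obtain K where K: "0 \<le> K" and freq: "\<exists>\<^sub>F n in sequentially. level (Fn n) e (q - h n) - level (Fn n) e q \<le> K * h n"
      by blast
    have q': "q1 \<le> q" "q \<le> q2" "0 \<le> q" using q q12 by auto
    define E where "E = C1 + 1 + q2 * (K + 2)"
    have "\<exists>n\<ge>N. \<exists>z. is_state z \<and> B z \<le> K + 2 \<and> c0 / 2 \<le> J (Fn n) q z \<and> J (Fn n) q z \<le> C1 + 1 \<and>
        slope (fn n) q z < \<delta> n" for N
    proof -
      \<comment> \<open>The good indices are infinitely many, so one can be taken beyond
        \<open>K\<close>, where the choices of \<open>D\<close> and \<open>h\<close> cover this
        \<open>K\<close>.\<close>
      define N' where "N' = max N (nat \<lceil>K\<rceil>)"
      obtain n where n: "N' \<le> n" and rate: "level (Fn n) e (q - h n) - level (Fn n) e q \<le> K * h n"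
        using freq unfolding frequently_sequentially by blast
      have Kn: "K \<le> real n" using n unfolding N'_def by linarith
      have Kh: "(K + 1) * h n \<le> 1"
      proof -
        have "(K + 1) * h n \<le> (real n + 1) * (1 / (real n + 1))"
          using h(1,4)[of n] Kn K by (intro mult_mono) auto
        then show ?thesis by simp
      qed
      have "\<exists>z. is_state z \<and> B z \<le> K + 2 \<and> level (Fn n) e q - h n \<le> J (Fn n) q z \<and>
        J (Fn n) q z \<le> level (Fn n) e q + (K + 1) * h n \<and> slope (fn n) q z < \<delta> n"
      proof (rule monotonicity_trick[OF cFn Fn0 ne cfn q'(3) h(1) K, where D = "D n" and ?\<eta>0.0 = "\<eta> n"])
        show "J (Fn n) q (step (fn n) q \<eta>' z) \<le> J (Fn n) q z - \<eta>' / 2 * slope (fn n) q z"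
          if "is_state z" "J (Fn n) q z \<le> D n" "B z \<le> D n" "0 \<le> \<eta>'" "\<eta>' \<le> \<eta> n" for z \<eta>'
          using \<eta>(2)[OF q'(3,2)] that by blast
        show "level (Fn n) e q + (K + 1) * h n \<le> D n" using up[OF q'(3), of n] Kh by (simp add: D_def)
        show "K + 2 \<le> D n"
          using Kn up[OF q'(3), of n] nonneg[of n q] by (simp add: D_def)
        show "(K + 2) * h n \<le> \<eta> n * \<delta> n / 2"
        proof -
          have "(K + 2) * h n \<le> (real n + 2) * (\<eta> n * \<delta> n / (2 * (real n + 2)))"
            using h(1,5)[of n] Kn K by (intro mult_mono) auto
          also have "\<dots> = \<eta> n * \<delta> n / 2" by (simp add: field_simps)
          finally show ?thesis .
        qed
        show "h n \<le> level (Fn n) e q" using h(3)[of n] low[OF q'(1,2), of n] c0(1) by simp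
        show "J (Fn n) q e \<le> 0" using Je[OF q'(1)] by (simp add: less_imp_le)
      qed (fact \<eta>(1) rate)+
      then obtain z where z: "is_state z" "B z \<le> K + 2" "level (Fn n) e q - h n \<le> J (Fn n) q z"
        "J (Fn n) q z \<le> level (Fn n) e q + (K + 1) * h n" "slope (fn n) q z < \<delta> n" by blast
      have "c0 / 2 \<le> J (Fn n) q z" using z(3) h(3)[of n] low[OF q'(1,2), of n] by simp
      moreover have "J (Fn n) q z \<le> C1 + 1" using z(4) Kh up[OF q'(3), of n] by simp
      moreover have "N \<le> n" using n by (simp add: N'_def)
      ultimately show ?thesis using z by blast
    qed
    then obtain r z where r: "\<And>N. N \<le> r N" and z: "\<And>N. is_state (z N)" "\<And>N. B (z N) \<le> K + 2"
      "\<And>N. c0 / 2 \<le> J (Fn (r N)) q (z N)" "\<And>N. J (Fn (r N)) q (z N) \<le> C1 + 1"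
      "\<And>N. slope (fn (r N)) q (z N) < \<delta> (r N)" by metis
    define u v p where "u N = fst (z N)" and "v N = fst (snd (z N))" and "p N = snd (snd (z N))" for N
    have zN: "z N = (u N, v N, p N)" for N by (simp add: u_def v_def p_def)
    note st = z(1)[unfolded zN]
    have hit: "\<exists>x\<in>{0..L}. \<bar>u N x\<bar> \<le> \<epsilon> (r N)" for N
    proof (rule small_slope_hits_zero[OF cfn[of "r N"] st[of N], where q = q and \<epsilon> = "\<epsilon> (r N)" and k = "2 * \<kappa> (r N) * \<epsilon> (r N)"])
      show "0 < 2 * \<kappa> (r N) * \<epsilon> (r N)" using \<kappa> \<epsilon> by simp
      show "slope (fn (r N)) q (u N, v N, p N) < (L * (2 * \<kappa> (r N) * \<epsilon> (r N)))\<^sup>2"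
        using z(5)[of N] by (simp add: zN \<delta>_def)
      show "2 * \<kappa> (r N) * \<epsilon> (r N) \<le> fn (r N) t" if "\<epsilon> (r N) \<le> t" for t
      proof -
        have "2 * \<kappa> (r N) * \<epsilon> (r N) \<le> 2 * \<kappa> (r N) * t" using that \<kappa>(1)[of "r N"] by (intro mult_left_mono) auto
        moreover have "0 \<le> ?f t" using that \<epsilon>(1)[of "r N"] by (intro sign) simp
        ultimately show ?thesis unfolding fn_def by linarith
      qed
      show "fn (r N) t \<le> - (2 * \<kappa> (r N) * \<epsilon> (r N))" if "t \<le> - \<epsilon> (r N)" for t
      proof -
        have "2 * \<kappa> (r N) * t \<le> 2 * \<kappa> (r N) * (- \<epsilon> (r N))" using that \<kappa>(1)[of "r N"] by (intro mult_left_mono) auto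
        moreover have "?f t \<le> 0" using that \<epsilon>(1)[of "r N"] by (intro sign) simp
        ultimately show ?thesis unfolding fn_def mult_minus_right by linarith
      qed
    qed (use \<epsilon> in \<open>auto intro: less_imp_le\<close>)
    define k where "k = sqrt (L * (2 * E))"
    have ip: "sqrt (L * integral {0..L} (\<lambda>x. (p N x)\<^sup>2)) \<le> k" for N
    proof -
      have "0 \<le> integral {0..L} (\<lambda>x. Fn (r N) (u N x))"
      proof (intro integral_nonneg integrable_continuous_real continuous_on_compose2[OF cFn stateD(3)[OF st]])
        show "0 \<le> Fn (r N) (u N x)" for x
          using F0(2)[of "u N x"] \<kappa>(1)[of "r N"] by (simp add: Fn_def)
      qed simp
      moreover have "A (Fn (r N)) (z N) = J (Fn (r N)) q (z N) + q * B (z N)" by (simp add: J_def)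
      moreover have "q * B (z N) \<le> q2 * (K + 2)" using q' z(2)[of N] B_nonneg[OF z(1)] q12 by (intro mult_mono) auto
      ultimately have "integral {0..L} (\<lambda>x. (p N x)\<^sup>2) \<le> 2 * E"
        using z(4)[of N] integral_split_A[OF cFn st, of "r N" N] by (simp add: E_def zN)
      then show ?thesis unfolding k_def using L by (intro real_sqrt_le_mono mult_left_mono) auto
    qed
    have ip0: "0 \<le> sqrt (L * integral {0..L} (\<lambda>x. (p N x)\<^sup>2))" for N
      using L stateD(5)[OF st, of N]
      by (intro real_sqrt_ge_zero mult_nonneg_nonneg integral_nonneg integrable_continuous_real continuous_intros) auto
    have k0: "0 \<le> k" using order_trans[OF ip0[of 0] ip[of 0]] .
    have lip: "\<bar>u N x - u N y\<bar> \<le> k * \<bar>x - y\<bar>" if "x \<in> {0..L}" "y \<in> {0..L}" for N x y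
      using state_bounds(2)[OF st[of N] that] mult_right_mono[OF ip abs_ge_zero, of N "x - y"] by linarith
    have bd: "\<bar>u N x\<bar> \<le> 1 + k * L" if x: "x \<in> {0..L}" for N x
    proof -
      obtain y where y: "y \<in> {0..L}" "\<bar>u N y\<bar> \<le> \<epsilon> (r N)" using hit by blast
      have "k * \<bar>x - y\<bar> \<le> k * L" using x y k0 by (intro mult_left_mono) auto
      then show ?thesis using lip[OF x y(1), of N] y(2) \<epsilon>(2)[of "r N"] by linarith
    qed
    obtain U s where s: "strict_mono (s :: nat \<Rightarrow> nat)" "uniform_limit {0..L} (\<lambda>n. u (s n)) U sequentially"
      by (rule equi_lipschitz_subsequence[of L u "1 + k * L" k, OF bd lip k0])
    have rs: "filterlim (\<lambda>n. r (s n)) at_top sequentially"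
    proof (rule filterlim_at_top_mono[OF filterlim_ident])
      show "\<forall>\<^sub>F n in sequentially. n \<le> r (s n)"
        by (intro always_eventually allI order_trans[OF strict_mono_imp_increasing[OF s(1)] r])
    qed
    have \<epsilon>0: "\<epsilon> \<longlonglongrightarrow> 0" unfolding \<epsilon>_def using LIMSEQ_inverse_real_of_nat by (simp add: inverse_eq_divide add.commute)
    have \<kappa>0: "\<kappa> \<longlonglongrightarrow> 0"
    proof -
      have "(\<lambda>n. (a' - a) * \<epsilon> n) \<longlonglongrightarrow> (a' - a) * 0" by (intro tendsto_intros \<epsilon>0)
      then show ?thesis by (simp add: \<kappa>_def[abs_def] \<epsilon>_def)
    qed
    have \<delta>0: "\<delta> \<longlonglongrightarrow> 0"
    proof -
      have "\<delta> \<longlonglongrightarrow> (L * (2 * 0 * 0))\<^sup>2" unfolding \<delta>_def by (intro tendsto_intros \<epsilon>0 \<kappa>0)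
      then show ?thesis by simp
    qed
    show "\<exists>u. is_solution q F u \<and> nontrivial u \<and> periodic u"
    proof (rule limit_of_almost_critical[OF cF F0(1) cf f0, where u = "\<lambda>n. u (s n)" and v = "\<lambda>n. v (s n)"
          and p = "\<lambda>n. p (s n)" and \<kappa> = "\<lambda>n. \<kappa> (r (s n))" and \<delta> = "\<lambda>n. \<delta> (r (s n))"
          and \<epsilon> = "\<lambda>n. \<epsilon> (r (s n))" and U = U and q = q and c = "c0 / 2" and M = "1 + k * L"])
      show "(\<lambda>n. \<kappa> (r (s n))) \<longlonglongrightarrow> 0" "(\<lambda>n. \<delta> (r (s n))) \<longlonglongrightarrow> 0" "(\<lambda>n. \<epsilon> (r (s n))) \<longlonglongrightarrow> 0"
        using filterlim_compose[OF \<kappa>0 rs] filterlim_compose[OF \<delta>0 rs] filterlim_compose[OF \<epsilon>0 rs] by auto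
      show "slope (\<lambda>t. ?f t + 2 * \<kappa> (r (s n)) * t) q (u (s n), v (s n), p (s n)) \<le> \<delta> (r (s n))" for n
        using z(5)[of "s n"] by (simp add: zN fn_def[abs_def] less_imp_le)
      show "c0 / 2 \<le> J (\<lambda>t. F t + \<kappa> (r (s n)) * t\<^sup>2) q (u (s n), v (s n), p (s n))" for n
        using z(3)[of "s n"] by (simp add: zN Fn_def[abs_def])
      show "is_state (u (s n), v (s n), p (s n))" for n by (rule st)
      show "\<exists>x\<in>{0..L}. \<bar>u (s n) x\<bar> \<le> \<epsilon> (r (s n))" for n by (rule hit)
      show "\<bar>u (s n) x\<bar> \<le> 1 + k * L" if "x \<in> {0..L}" for n x by (rule bd[OF that])
      show "0 \<le> q" "0 < c0 / 2" using q' c0 by auto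
      show "uniform_limit {0..L} (\<lambda>n. u (s n)) U sequentially" by (rule s(2))
      fix V P T
      assume sol: "\<And>x. x \<in> {0..L} \<Longrightarrow> (U has_real_derivative V x) (at x within {0..L})"
        "\<And>x. x \<in> {0..L} \<Longrightarrow> (V has_real_derivative P x) (at x within {0..L})"
        "\<And>x. x \<in> {0..L} \<Longrightarrow> (P has_real_derivative T x) (at x within {0..L})"
        "\<And>x. x \<in> {0..L} \<Longrightarrow> (T has_real_derivative - (q * P x + ?f (U x))) (at x within {0..L})"
        "V 0 = 0" "V L = 0" "T 0 = 0" "T L = 0" "\<not> U constant_on {0..L}"
      show "\<exists>u. is_solution q F u \<and> nontrivial u \<and> periodic u"
        by (rule solution_from_neumann[OF L cf sol])
    qed
  qed
qed

theorem theorem1p8: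
  fixes F :: "real \<Rightarrow> real"
  assumes "C_class 2 F"
    and "F 0 = 0"
    and "\<forall>t. F 0 \<le> F t"
    and "6 * quad_limsup F < ereal ((deriv ^^ 2) F 0)"
  shows "AE q in lebesgue.
           q > 0 \<and> 24 * quad_limsup F < ereal (q\<^sup>2) \<and> q\<^sup>2 < 4 * (deriv ^^ 2) F 0 \<longrightarrow>
           (\<exists>u. is_solution q F u \<and> nontrivial u \<and> periodic u)"
proof -
  let ?sol = "\<lambda>q. \<exists>u. is_solution q F u \<and> nontrivial u \<and> periodic u"
  define f' where "f' = (deriv ^^ 2) F"
  have diff: "(deriv ^^ j) F differentiable (at t)" if "j < 2" for j t
    using assms(1) that by (auto simp: C_class_def differentiable_on_def)
  have F: "(F has_real_derivative deriv F t) (at t)" for t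
    using diff[of 0 t] by (simp add: DERIV_deriv_iff_real_differentiable)
  have f: "(deriv F has_real_derivative f' t) (at t)" for t
    using diff[of 1 t] by (simp add: f'_def numeral_2_eq_2 DERIV_deriv_iff_real_differentiable)
  have f': "continuous_on UNIV f'" using assms(1) by (simp add: C_class_def f'_def)
  show ?thesis
  proof (cases "\<exists>t1 t2. t1 < t2 \<and> deriv F t1 > 0 \<and> deriv F t2 < 0")
    case True
    then show ?thesis using solution_at_downcrossing[OF _ f f'] by (intro AE_I2) blast
  next
    case False
    \<comment> \<open>The limit superior is nonnegative since F is, and finite by the hypothesis
      comparing it with F''(0); the same hypothesis then gives F''(0) > 0.\<close>
    have "0 \<le> quad_limsup F"
      unfolding quad_limsup_def using assms(2,3)
      by (intro le_Limsup always_eventually) (auto simp: trivial_limit_at_bot_linorder)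
    moreover have "quad_limsup F \<noteq> \<infinity>" using assms(4) by auto
    ultimately obtain a0 where a0: "quad_limsup F = ereal a0" "0 \<le> a0"
      by (cases "quad_limsup F") auto
    have scale: "6 * quad_limsup F = ereal (6 * a0)" "24 * quad_limsup F = ereal (24 * a0)"
      unfolding a0(1) numeral_eq_ereal times_ereal.simps(1) by (rule refl)+
    have pos: "f' 0 > 0" using assms(4) a0(2) unfolding scale(1) f'_def[symmetric] by simp
    have f0: "deriv F 0 = 0"
      using DERIV_local_min[OF F, of 1] assms(3) by simp
    obtain d1 where d1: "d1 > 0" "\<And>h. 0 < h \<Longrightarrow> h < d1 \<Longrightarrow> deriv F h > 0"
      using DERIV_pos_inc_right[OF f pos] f0 by auto
    obtain d2 where d2: "d2 > 0" "\<And>h. 0 < h \<Longrightarrow> h < d2 \<Longrightarrow> deriv F (- h) < 0"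
      using DERIV_pos_inc_left[OF f pos] f0 by auto
    \<comment> \<open>The force is positive just to the right of 0, so a negative value further
      right would be a change of sign from positive to negative. The left side is symmetric.\<close>
    have sign: "0 \<le> deriv F t" if "0 \<le> t" for t
    proof (rule ccontr)
      assume neg: "\<not> 0 \<le> deriv F t"
      then have "0 < t" using that f0 by (cases "t = 0") auto
      define s where "s = min (t / 2) (d1 / 2)"
      have "0 < s" "s < d1" "s < t" using \<open>0 < t\<close> d1(1) by (auto simp: s_def)
      then show False using d1(2)[of s] neg False by (meson not_le)
    qed
    have sign': "deriv F t \<le> 0" if "t \<le> 0" for t
    proof (rule ccontr)
      assume neg: "\<not> deriv F t \<le> 0"
      then have "t < 0" using that f0 by (cases "t = 0") auto
      define s where "s = min (- t / 2) (d2 / 2)"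
      have "0 < s" "s < d2" "t < - s" using \<open>t < 0\<close> d2(1) by (auto simp: s_def)
      then show False using d2(2)[of s] neg False by (meson not_le)
    qed
    have cover: "AE q in lborel. q \<in> {q1..q2} \<longrightarrow> ?sol q"
      if q: "0 < q1" "q1 \<le> q2" "24 * a0 < q1\<^sup>2" "q2\<^sup>2 < 4 * f' 0" for q1 q2
    proof -
      define a where "a = (a0 + q1\<^sup>2 / 24) / 2"
      have a: "0 \<le> a" "24 * a < q1\<^sup>2" "a0 < a" using q a0(2) by (auto simp: a_def)
      have "Limsup at_bot (\<lambda>t. ereal (F t / t\<^sup>2)) < ereal a"
        using a0(1) a(3) by (simp add: quad_limsup_def)
      then have "\<forall>\<^sub>F t in at_bot. ereal (F t / t\<^sup>2) < ereal a" by (rule Limsup_lessD)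
      then obtain t1 where t1: "\<And>t. t \<le> t1 \<Longrightarrow> F t / t\<^sup>2 < a"
        by (auto simp: eventually_at_bot_linorder)
      define t0 where "t0 = max 1 (- t1)"
      have quad: "F t \<le> a * t\<^sup>2" if "t \<le> - t0" for t
      proof -
        have "t \<le> t1" "t < 0" using that by (auto simp: t0_def)
        then show ?thesis using t1[of t] by (simp add: divide_less_eq)
      qed
      show ?thesis
        by (rule AE_solution_monotone[OF F f f' assms(2) _ sign sign' q(1,2,4) a(1,2) quad])
          (use assms(2,3) in auto)
    qed
    \<comment> \<open>Each interval has its own exceptional null set; rational endpoints make them
      countably many while still surrounding every admissible \<open>q\<close>, the conditions on
      \<open>q\<close> being strict.\<close>
    have "AE q in lborel. \<forall>(r :: rat \<times> rat). 0 < fst r \<and> fst r \<le> snd r \<and>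
        24 * a0 < (of_rat (fst r))\<^sup>2 \<and> (of_rat (snd r))\<^sup>2 < 4 * f' 0 \<longrightarrow>
        q \<in> {of_rat (fst r)..of_rat (snd r)} \<longrightarrow> ?sol q"
      unfolding AE_all_countable
    proof (intro allI)
      fix r :: "rat \<times> rat"
      show "AE q in lborel. 0 < fst r \<and> fst r \<le> snd r \<and>
        24 * a0 < (of_rat (fst r))\<^sup>2 \<and> (of_rat (snd r))\<^sup>2 < 4 * f' 0 \<longrightarrow>
        q \<in> {of_rat (fst r)..of_rat (snd r)} \<longrightarrow> ?sol q"
        using cover[of "of_rat (fst r)" "of_rat (snd r)"]
        by (cases "0 < fst r \<and> fst r \<le> snd r \<and> 24 * a0 < (of_rat (fst r) :: real)\<^sup>2 \<and>
          (of_rat (snd r) :: real)\<^sup>2 < 4 * f' 0") (auto simp: of_rat_less_eq)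
    qed
    then have "AE q in lborel. q > 0 \<and> 24 * a0 < q\<^sup>2 \<and> q\<^sup>2 < 4 * f' 0 \<longrightarrow> ?sol q"
    proof (rule eventually_mono, intro impI)
      fix q assume all: "\<forall>(r :: rat \<times> rat). 0 < fst r \<and> fst r \<le> snd r \<and>
        24 * a0 < (of_rat (fst r))\<^sup>2 \<and> (of_rat (snd r))\<^sup>2 < 4 * f' 0 \<longrightarrow>
        q \<in> {of_rat (fst r)..of_rat (snd r)} \<longrightarrow> ?sol q"
        and q: "q > 0 \<and> 24 * a0 < q\<^sup>2 \<and> q\<^sup>2 < 4 * f' 0"
      have "sqrt (24 * a0) < q" using q by (simp add: real_less_lsqrt)
      then obtain r1 :: rat where r1: "sqrt (24 * a0) < of_rat r1" "of_rat r1 < q" using of_rat_dense by blast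
      have "q < sqrt (4 * f' 0)" using q by (simp add: real_less_rsqrt)
      then obtain r2 :: rat where r2: "q < of_rat r2" "of_rat r2 < sqrt (4 * f' 0)" using of_rat_dense by blast
      have r1p: "0 < (of_rat r1 :: real)" using r1(1) a0(2) real_sqrt_ge_zero[of "24 * a0"] by linarith
      have "24 * a0 < (of_rat r1 :: real)\<^sup>2"
        using power_strict_mono[OF r1(1), of 2] a0(2) by simp
      moreover have "(of_rat r2 :: real)\<^sup>2 < 4 * f' 0"
      proof -
        have "0 \<le> (of_rat r2 :: real)" using r2(1) q by linarith
        from power_strict_mono[OF r2(2) this, of 2] show ?thesis using pos by simp
      qed
      moreover have "0 < r1" using r1p by simp
      moreover have "r1 \<le> r2" using r1(2) r2(1) of_rat_less_eq[of r1 r2] by (metis less_imp_le less_trans)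
      ultimately show "?sol q" using all[rule_format, of "(r1, r2)"] r1(2) r2(1) by simp
    qed
    then have "AE q in lebesgue. q > 0 \<and> 24 * a0 < q\<^sup>2 \<and> q\<^sup>2 < 4 * f' 0 \<longrightarrow> ?sol q"
      by (rule AE_completion)
    then show ?thesis unfolding scale(2) f'_def[symmetric] less_ereal.simps(1) .
  qed
qed

end
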